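(* The following holds with $\mathbb P$-probability one. For all $x\ne y$ in $\mathbb Z^2$ and all $\xi\in\operatorname{ri}\mathcal U$, statements (i) and (ii) below are equivalent: (i) $\xi\in\operatorname{supp}\mu_{x,y}$. (ii) Either $\gamma^{x,\xi-}\cap\gamma^{y,\xi+}=\varnothing$ or $\gamma^{x,\xi+}\cap\gamma^{y,\xi-}=\varnothing$. Moreover, if the shape function $g$ is strictly concave at every $\xi\in\operatorname{ri}\mathcal U$ with $\xi\notin\mathcal D$ (regularity condition), then (i) and (ii) are equivalent to (iii) There exist $\mathcal U_\xi$-directed semi-infinite geodesics $\pi^x$ and $\pi^y$ out of $x$ and $y$, respectively, such that $\pi^x\cap\pi^y=\varnothing$.
   Context: Directions. $e_1=e_+=(1,0)$, $e_2=e_-=(0,1)$, $\hat e=e_1+e_2$. $\mathcal U=\{te_1+(1-t)e_2:0\le t\le1\}$, $\operatorname{ri}\mathcal U=\mathcal U\setminus\{e_1,e_2\}$. For $\zeta,\eta\in\mathbb R^2$ with $\zeta\cdot\hat e=\eta\cdot\hat e$, $\zeta\prec\eta$ (resp. $\zeta\preceq\eta$) means $\zeta\cdot e_1<\eta\cdot e_1$ (resp. $\le$). Intervals $[\zeta,\eta]$, $]\zeta,\eta[$ etc. in $\mathcal U$ and monotone limits $\zeta\nearrow\xi$, $\zeta\searrow\xi$ refer to this order. Vector inequalities $x\le y$, $x<y$ are coordinatewise. $\sigma$ denotes a sign in $\{-,+\}$. Last-passage percolation. $(\Omega,\mathcal F,\mathbb P)$ is a Polish probability space with a group $\{T_x\}_{x\in\mathbb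 Z^2}$ of measurable $\mathbb P$-preserving bijections ($T_0=$ identity, $T_xT_y=T_{x+y}$) and real random variables (weights) $\omega_x$, $x\in\mathbb Z^2$, with $\omega_y(T_x\omega)=\omega_{x+y}(\omega)$, that are i.i.d. with continuous distribution, positive variance, and $\mathbb E|\omega_0|^p<\infty$ for some $p>2$. An up-right path has steps in $\{e_1,e_2\}$ and is indexed so that $\pi_k\cdot\hat e=k$. For $x\le y$, $k=x\cdot\hat e$, $m=y\cdot\hat e$, $G_{x,y}=\max\sum_{i=k}^{m-1}\omega_{\pi_i}$ over up-right paths from $x$ to $y$; a maximizer is a (finite) geodesic (a.s. unique). The shape function is the deterministic, concave, symmetric, 1-homogeneous $g:\mathbb R_+^2\to\mathbb R$ with a.s. $\lim_n\max_{x\in\mathbb Z_+^2,|x|_1=n}|G_{0,x}-g(x)|/n=0$. For $\xi\in\operatorname{ri}\mathcal U$: $\nabla g(\xi\pm)\cdot e_1=\lim_{\varepsilon\searrow0}\frac{g(\xi\pm\varepsilon e_1)-g(\xi)}{\pm\varepsilon}$, $\nabla g(\xi\pm)\cdot e_2=\lim_{\varepsilon\searrow0}\frac{g(\xi\mp\varepsilon e_2)-g(\xi)}{\mp\varepsilon}$. $\mathcal D=\{\xi\in\operatorname{ri}\mathcal U: g\text{ differentiable at }\xi\}$. $\mathcal U_{\xi\sigma}=\{\zeta\in\operatorname{ri}\mathcal U:g(\zeta)-g(\xi)=\nabla g(\xi\sigma)\cdot(\zeta-\xi)\}$, $\mathcal U_\xi=\mathcal U_{\xi-}\cup\mathcal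 U_{\xi+}=[\underline\xi,\overline\xi]$, $\mathcal U_{e_i}=\{e_i\}$. $g$ is strictly concave at $\xi$ if $\mathcal U_\xi=\{\xi\}$. Busemann process. On $\Omega$ there is a fixed family of real random variables $B^{\xi\sigma}(x,y)=B^{\xi\sigma}_{x,y}$ ($x,y\in\mathbb Z^2$, $\xi\in\operatorname{ri}\mathcal U$, $\sigma\in\{-,+\}$), measurable in $(x,y,\omega,\xi)$, constructed in earlier work, with these properties. (B1) On one $T$-invariant event of probability one, for all $x,y,z,\xi,\sigma$: $B^{\xi\sigma}(x+z,y+z,\omega)=B^{\xi\sigma}(x,y,T_z\omega)$; $B^{\xi\sigma}(x,y)+B^{\xi\sigma}(y,z)=B^{\xi\sigma}(x,z)$; $\min_{i}B^{\xi\sigma}(x,x+e_i)=\omega_x$; for $\xi\prec\xi'$, $B^{\xi-}(x,x+e_1)\ge B^{\xi+}(x,x+e_1)\ge B^{\xi'-}(x,x+e_1)\ge B^{\xi'+}(x,x+e_1)$ and the reversed inequalities with $e_2$ in place of $e_1$; $B^{\xi-}(x,y)=\lim_{\zeta\nearrow\xi}B^{\zeta\sigma}(x,y)$ and $B^{\xi+}(x,y)=\lim_{\zeta\searrow\xi}B^{\zeta\sigma}(x,y)$; $B^{\xi\sigma}(x,x+e_i)\to\infty$ as $\xi\to e_{3-i}$. (B2) $B^{\xi\sigma}(x,y)$ is integrable and $\mathbb E[B^{\xi\sigma}(x,x+e_i)]=\nabla g(\xi\sigma)\cdot e_i$. (B3) If $\nabla g(\zeta\sigma)=\nabla g(\eta\sigma)$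 then $B^{\zeta\sigma}\equiv B^{\eta\sigma}$. (B4) For any $I\subset\mathbb Z^2$, $\{(\omega_x,B^{\xi\sigma}(x,y)):x\in I,y\ge x,\sigma,\xi\}$ is independent of $\{\omega_x: x\not\ge z\ \forall z\in I\}$. (B5) For each fixed $\xi$, a.s.: $B^{\xi\sigma}(x,x+e_1)\ne B^{\xi\sigma}(x,x+e_2)$ for all $x,\sigma$; $n^{-1}\max_{x\in\mathbb Z_+^2,|x|_1=n}|B^{\xi\sigma}(0,x)-x\cdot\nabla g(\xi\sigma)|\to0$; if $\xi\in\mathcal D$ then $B^{\xi+}=B^{\xi-}$; if $\xi,\underline\xi,\overline\xi\in\mathcal D$ then $B^{\xi\pm}(x,y)=\lim_n(G_{x,v_n}-G_{y,v_n})$ whenever $|v_n|\to\infty$, $v_n/n\to\xi$. Geodesics. A semi-infinite geodesic out of $x$ is a semi-infinite up-right path started at $x$ all of whose finite segments are geodesics. It is directed into $\mathcal A\subset\mathcal U$ ($\mathcal A$-directed) if all limit points of $\pi_n/n$ as $n\to\infty$ lie in $\mathcal A$; $\xi$-directed means $\{\xi\}$-directed. The Busemann geodesic $\gamma^{x,\xi\sigma}$ starts at $x$ and from its current point $z$ steps to $z+e_1$ if $B^{\xi\sigma}(z,z+e_1)<B^{\xi\sigma}(z,z+e_2)$, to $z+e_2$ if $>$ holds, and to $z+e_\sigma$ if equality holds; it is a.s. a semi-infinite geodesic. Busemann measures. For $x,y\in\mathbb Z^2$ and a compact interval $K\subset\operatorname{ri}\mathcal U$, $\mu^K_{x,y}$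 is the signed measure on $K$ with $\mu^K_{x,y}(]\zeta,\eta])=B^{\eta+}_{x,y}-B^{\zeta+}_{x,y}$ and $\mu^K_{x,y}([\zeta,\eta[)=B^{\eta-}_{x,y}-B^{\zeta-}_{x,y}$ for $\zeta\prec\eta$, $[\zeta,\eta]\subset K$. $\operatorname{supp}\mu_{x,y}=\bigcup_{\zeta\prec\eta\text{ in }\operatorname{ri}\mathcal U}\operatorname{supp}\mu^{[\zeta,\eta]}_{x,y}$, where the support of a signed measure is the smallest closed set whose complement has zero total variation measure. *)

theory Defs
  imports "HOL-Probability.Probability"
begin

text \<open>
  Sites and directions are pairs; the order \<open>\<le>\<close> on pairs is the coordinatewise one of
  \<^theory>\<open>HOL-Library.Product_Order\<close>.
\<close>

type_synonym site = "int \<times> int"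
type_synonym dir = "real \<times> real"

datatype sign = Minus | Plus

abbreviation e1 :: "'a::zero_neq_one \<times> 'a" where "e1 \<equiv> (1, 0)"
abbreviation e2 :: "'a::zero_neq_one \<times> 'a" where "e2 \<equiv> (0, 1)"

fun e_sign :: "sign \<Rightarrow> site" where
  "e_sign Plus = e1"
| "e_sign Minus = e2"

text \<open>The inner product of \<open>x\<close> with \<open>e1 + e2\<close>.\<close>

definition level :: "'a::plus \<times> 'a \<Rightarrow> 'a" where
  "level x = fst x + snd x"

definition to_dir :: "site \<Rightarrow> dir" where
  "to_dir x = (real_of_int (fst x), real_of_int (snd x))"

definition U :: "dir set" where
  "U = {t *\<^sub>R e1 + (1 - t) *\<^sub>R e2 | t. 0 \<le> t \<and> t \<le> 1}"

definition riU :: "dir set" where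
  "riU = U - {e1, e2}"

definition dir_less :: "dir \<Rightarrow> dir \<Rightarrow> bool" (infix "\<prec>" 50) where
  "\<zeta> \<prec> \<eta> \<longleftrightarrow> level \<zeta> = level \<eta> \<and> fst \<zeta> < fst \<eta>"

definition dir_le :: "dir \<Rightarrow> dir \<Rightarrow> bool" (infix "\<preceq>" 50) where
  "\<zeta> \<preceq> \<eta> \<longleftrightarrow> level \<zeta> = level \<eta> \<and> fst \<zeta> \<le> fst \<eta>"

definition dir_Icc :: "dir \<Rightarrow> dir \<Rightarrow> dir set" where
  "dir_Icc a b = {\<zeta> \<in> U. a \<preceq> \<zeta> \<and> \<zeta> \<preceq> b}"

definition dir_Ioc :: "dir \<Rightarrow> dir \<Rightarrow> dir set" where
  "dir_Ioc a b = {\<zeta> \<in> U. a \<prec> \<zeta> \<and> \<zeta> \<preceq> b}"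

definition dir_Ico :: "dir \<Rightarrow> dir \<Rightarrow> dir set" where
  "dir_Ico a b = {\<zeta> \<in> U. a \<preceq> \<zeta> \<and> \<zeta> \<prec> b}"

text \<open>The filters for the monotone limits to \<open>\<xi>\<close> from below and from above.\<close>

definition at_below :: "dir \<Rightarrow> dir filter" where
  "at_below \<xi> = at \<xi> within {\<zeta> \<in> riU. \<zeta> \<prec> \<xi>}"

definition at_above :: "dir \<Rightarrow> dir filter" where
  "at_above \<xi> = at \<xi> within {\<zeta> \<in> riU. \<xi> \<prec> \<zeta>}"

fun sgn_val :: "sign \<Rightarrow> real" where
  "sgn_val Plus = 1"
| "sgn_val Minus = - 1"

text \<open>
  On the line \<open>U\<close>, moving right increases the first coordinate and decreases the second one;
  hence the opposite increments in the two components.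
\<close>

definition grad :: "(dir \<Rightarrow> real) \<Rightarrow> dir \<Rightarrow> sign \<Rightarrow> dir" where
  "grad g \<xi> \<sigma> =
    (Lim (at_right 0) (\<lambda>\<epsilon>. (g (\<xi> + (sgn_val \<sigma> * \<epsilon>) *\<^sub>R e1) - g \<xi>) / (sgn_val \<sigma> * \<epsilon>)),
     Lim (at_right 0) (\<lambda>\<epsilon>. (g (\<xi> - (sgn_val \<sigma> * \<epsilon>) *\<^sub>R e2) - g \<xi>) / (- (sgn_val \<sigma> * \<epsilon>))))"

definition diff_dirs :: "(dir \<Rightarrow> real) \<Rightarrow> dir set" where
  "diff_dirs g = {\<xi> \<in> riU. g differentiable (at \<xi>)}"

definition U_sided :: "(dir \<Rightarrow> real) \<Rightarrow> dir \<Rightarrow> sign \<Rightarrow> dir set" where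
  "U_sided g \<xi> \<sigma> = {\<zeta> \<in> riU. g \<zeta> - g \<xi> = grad g \<xi> \<sigma> \<bullet> (\<zeta> - \<xi>)}"

definition U_at :: "(dir \<Rightarrow> real) \<Rightarrow> dir \<Rightarrow> dir set" where
  "U_at g \<xi> = U_sided g \<xi> Minus \<union> U_sided g \<xi> Plus"

text \<open>
  The endpoints of the interval \<open>U_at g \<xi>\<close>; on \<open>U\<close> the order \<open>\<preceq>\<close> is the order of first
  coordinates.
\<close>

definition U_lower :: "(dir \<Rightarrow> real) \<Rightarrow> dir \<Rightarrow> dir" where
  "U_lower g \<xi> = (ARG_MIN fst \<zeta>. \<zeta> \<in> U_at g \<xi>)"

definition U_upper :: "(dir \<Rightarrow> real) \<Rightarrow> dir \<Rightarrow> dir" where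
  "U_upper g \<xi> = (ARG_MAX fst \<zeta>. \<zeta> \<in> U_at g \<xi>)"

definition strictly_concave_at :: "(dir \<Rightarrow> real) \<Rightarrow> dir \<Rightarrow> bool" where
  "strictly_concave_at g \<xi> \<longleftrightarrow> U_at g \<xi> = {\<xi>}"

text \<open>
  Paths are functions on \<^typ>\<open>int\<close> indexed by level (so that \<open>level (\<pi> k) = k\<close>); only the
  indices between the levels of the endpoints, respectively from the level of the starting
  point on, are relevant. The argument \<open>w\<close> is a fixed realization of the weights.
\<close>

definition path_between :: "site \<Rightarrow> site \<Rightarrow> (int \<Rightarrow> site) \<Rightarrow> bool" where
  "path_between x y \<pi> \<longleftrightarrow> level x \<le> level y \<and> \<pi> (level x) = x \<and> \<pi> (level y) = y \<and>
    (\<forall>k\<in>{level x..<level y}. \<pi> (k + 1) - \<pi> k \<in> {e1, e2})"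

definition path_weight :: "(site \<Rightarrow> real) \<Rightarrow> site \<Rightarrow> site \<Rightarrow> (int \<Rightarrow> site) \<Rightarrow> real" where
  "path_weight w x y \<pi> = (\<Sum>k\<in>{level x..<level y}. w (\<pi> k))"

text \<open>Meaningful for \<open>x \<le> y\<close> only; otherwise the set of paths is empty.\<close>

definition lpp :: "(site \<Rightarrow> real) \<Rightarrow> site \<Rightarrow> site \<Rightarrow> real" where
  "lpp w x y = Max (path_weight w x y ` {\<pi>. path_between x y \<pi>})"

definition geodesic_between :: "(site \<Rightarrow> real) \<Rightarrow> site \<Rightarrow> site \<Rightarrow> (int \<Rightarrow> site) \<Rightarrow> bool" where
  "geodesic_between w x y \<pi> \<longleftrightarrow> path_between x y \<pi> \<and> path_weight w x y \<pi> = lpp w x y"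

definition path_from :: "site \<Rightarrow> (int \<Rightarrow> site) \<Rightarrow> bool" where
  "path_from x \<pi> \<longleftrightarrow> \<pi> (level x) = x \<and> (\<forall>k\<ge>level x. \<pi> (k + 1) - \<pi> k \<in> {e1, e2})"

definition geodesic_from :: "(site \<Rightarrow> real) \<Rightarrow> site \<Rightarrow> (int \<Rightarrow> site) \<Rightarrow> bool" where
  "geodesic_from w x \<pi> \<longleftrightarrow> path_from x \<pi> \<and>
    (\<forall>k l. level x \<le> k \<and> k \<le> l \<longrightarrow> geodesic_between w (\<pi> k) (\<pi> l) \<pi>)"

definition points_from :: "site \<Rightarrow> (int \<Rightarrow> site) \<Rightarrow> site set" where
  "points_from x \<pi> = \<pi> ` {level x..}"

definition directed_into :: "(int \<Rightarrow> site) \<Rightarrow> dir set \<Rightarrow> bool" where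
  "directed_into \<pi> A \<longleftrightarrow>
    (\<forall>(r :: nat \<Rightarrow> nat) v. strict_mono r \<longrightarrow>
      (\<lambda>j. to_dir (\<pi> (int (r j))) /\<^sub>R real (r j)) \<longlonglongrightarrow> v \<longrightarrow> v \<in> A)"

text \<open>Here \<open>b\<close> is a realization of one Busemann function and \<open>\<sigma>\<close> is the tie-breaking rule.\<close>

definition busemann_step :: "(site \<Rightarrow> site \<Rightarrow> real) \<Rightarrow> sign \<Rightarrow> site \<Rightarrow> site" where
  "busemann_step b \<sigma> z =
    (if b z (z + e1) < b z (z + e2) then z + e1
     else if b z (z + e1) > b z (z + e2) then z + e2
     else z + e_sign \<sigma>)"

definition busemann_geodesic ::
    "(dir \<Rightarrow> sign \<Rightarrow> site \<Rightarrow> site \<Rightarrow> real) \<Rightarrow> site \<Rightarrow> dir \<Rightarrow> sign \<Rightarrow> int \<Rightarrow> site" where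
  "busemann_geodesic b x \<xi> \<sigma> k = (busemann_step (b \<xi> \<sigma>) \<sigma> ^^ nat (k - level x)) x"

definition busemann_points ::
    "(dir \<Rightarrow> sign \<Rightarrow> site \<Rightarrow> site \<Rightarrow> real) \<Rightarrow> site \<Rightarrow> dir \<Rightarrow> sign \<Rightarrow> site set" where
  "busemann_points b x \<xi> \<sigma> = points_from x (busemann_geodesic b x \<xi> \<sigma>)"

text \<open>
  A (finite) signed measure on a measurable space \<open>N\<close> is a real set function; of \<open>N\<close> only the
  \<open>\<sigma>\<close>-algebra is used. Extensionality makes it determined by its values on \<^term>\<open>sets N\<close>.
\<close>

definition signed_measure :: "'a measure \<Rightarrow> ('a set \<Rightarrow> real) \<Rightarrow> bool" where
  "signed_measure N \<mu> \<longleftrightarrow> \<mu> \<in> extensional (sets N) \<and>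
    (\<forall>A :: nat \<Rightarrow> 'a set. range A \<subseteq> sets N \<longrightarrow> disjoint_family A \<longrightarrow>
      (\<lambda>i. \<mu> (A i)) sums \<mu> (\<Union>i. A i))"

definition total_variation :: "'a measure \<Rightarrow> ('a set \<Rightarrow> real) \<Rightarrow> 'a set \<Rightarrow> ennreal" where
  "total_variation N \<mu> A =
    (SUP P \<in> {P. finite P \<and> P \<subseteq> sets N \<and> partition_on A P}. \<Sum>E\<in>P. ennreal \<bar>\<mu> E\<bar>)"

definition signed_support ::
    "'a::topological_space measure \<Rightarrow> ('a set \<Rightarrow> real) \<Rightarrow> 'a set" where
  "signed_support N \<mu> =
    \<Inter>{F. closedin (top_of_set (space N)) F \<and> total_variation N \<mu> (space N - F) = 0}"

definition borel_on :: "dir set \<Rightarrow> dir measure" where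
  "borel_on K = restrict_space borel K"

definition busemann_measure ::
    "(dir \<Rightarrow> sign \<Rightarrow> site \<Rightarrow> site \<Rightarrow> real) \<Rightarrow> site \<Rightarrow> site \<Rightarrow> dir set \<Rightarrow> dir set \<Rightarrow> real" where
  "busemann_measure b x y K = (THE \<mu>. signed_measure (borel_on K) \<mu> \<and>
    (\<forall>\<zeta> \<eta>. \<zeta> \<prec> \<eta> \<and> \<zeta> \<in> K \<and> \<eta> \<in> K \<and> dir_Icc \<zeta> \<eta> \<subseteq> K \<longrightarrow>
      \<mu> (dir_Ioc \<zeta> \<eta>) = b \<eta> Plus x y - b \<zeta> Plus x y \<and>
      \<mu> (dir_Ico \<zeta> \<eta>) = b \<eta> Minus x y - b \<zeta> Minus x y))"

definition busemann_support ::
    "(dir \<Rightarrow> sign \<Rightarrow> site \<Rightarrow> site \<Rightarrow> real) \<Rightarrow> site \<Rightarrow> site \<Rightarrow> dir set" where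
  "busemann_support b x y =
    (\<Union>(\<zeta>, \<eta>) \<in> {(\<zeta>, \<eta>). \<zeta> \<in> riU \<and> \<eta> \<in> riU \<and> \<zeta> \<prec> \<eta>}.
      signed_support (borel_on (dir_Icc \<zeta> \<eta>)) (busemann_measure b x y (dir_Icc \<zeta> \<eta>)))"

definition gen_events :: "'w measure \<Rightarrow> ('w \<Rightarrow> real) set \<Rightarrow> 'w set set" where
  "gen_events M F =
    sigma_sets (space M) {f -` A \<inter> space M | f A. f \<in> F \<and> A \<in> sets borel}"

definition quadrant_sphere :: "nat \<Rightarrow> site set" where
  "quadrant_sphere n = {x. 0 \<le> x \<and> level x = int n}"

text \<open>
  \<open>W \<omega> x\<close> is the weight at the site \<open>x\<close>, \<open>g\<close> the shape function (only its values on the closed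
  first quadrant matter), and \<open>B \<omega> \<xi> \<sigma> x y\<close> the Busemann process (only its values for
  \<open>\<xi> \<in> riU\<close> matter).
\<close>

locale lpp_setting = prob_space M
  for M :: "'w::polish_space measure" +
  fixes T :: "site \<Rightarrow> 'w \<Rightarrow> 'w"
    and W :: "'w \<Rightarrow> site \<Rightarrow> real"
    and g :: "dir \<Rightarrow> real"
  assumes sets_M: "sets M = sets borel"
    and T_measurable: "\<And>x. T x \<in> measurable M M"
    and T_bij: "\<And>x. bij (T x)"
    and T_preserving: "\<And>x. distr M M (T x) = M"
    and T_zero: "T 0 = id"
    and T_add: "\<And>x y. T x \<circ> T y = T (x + y)"
    and W_shift: "\<And>x y \<omega>. W (T x \<omega>) y = W \<omega> (x + y)"
    and W_indep: "indep_vars (\<lambda>_. borel) (\<lambda>x \<omega>. W \<omega> x) UNIV"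
    and W_ident: "\<And>x. distr M borel (\<lambda>\<omega>. W \<omega> x) = distr M borel (\<lambda>\<omega>. W \<omega> 0)"
    and W_continuous: "continuous_on UNIV (cdf (distr M borel (\<lambda>\<omega>. W \<omega> 0)))"
    and W_variance: "variance (\<lambda>\<omega>. W \<omega> 0) > 0"
    and W_moment: "\<exists>p>2. integrable M (\<lambda>\<omega>. \<bar>W \<omega> 0\<bar> powr p)"
    and g_concave: "concave_on {x. 0 \<le> x} g"
    and g_symmetric: "\<And>a b. 0 \<le> a \<Longrightarrow> 0 \<le> b \<Longrightarrow> g (b, a) = g (a, b)"
    and g_homogeneous: "\<And>c x. 0 \<le> c \<Longrightarrow> 0 \<le> x \<Longrightarrow> g (c *\<^sub>R x) = c * g x"
    and shape_theorem: "AE \<omega> in M.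
      (\<lambda>n. (MAX x\<in>quadrant_sphere n. \<bar>lpp (W \<omega>) 0 x - g (to_dir x)\<bar>) / real n) \<longlonglongrightarrow> 0"

locale busemann_setting = lpp_setting M T W g
  for M :: "'w::polish_space measure" and T W g +
  fixes B :: "'w \<Rightarrow> dir \<Rightarrow> sign \<Rightarrow> site \<Rightarrow> site \<Rightarrow> real"
  assumes B_measurable: "\<And>\<sigma> x y.
      (\<lambda>(\<omega>, \<xi>). B \<omega> \<xi> \<sigma> x y) \<in> borel_measurable (M \<Otimes>\<^sub>M borel_on riU)"
    and B1: "\<exists>\<Omega>\<^sub>0 \<in> events. prob \<Omega>\<^sub>0 = 1 \<and> (\<forall>z. T z -` \<Omega>\<^sub>0 = \<Omega>\<^sub>0) \<and> (\<forall>\<omega>\<in>\<Omega>\<^sub>0.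
      (\<forall>\<xi>\<in>riU. \<forall>\<sigma> x y z. B \<omega> \<xi> \<sigma> (x + z) (y + z) = B (T z \<omega>) \<xi> \<sigma> x y) \<and>
      (\<forall>\<xi>\<in>riU. \<forall>\<sigma> x y z. B \<omega> \<xi> \<sigma> x y + B \<omega> \<xi> \<sigma> y z = B \<omega> \<xi> \<sigma> x z) \<and>
      (\<forall>\<xi>\<in>riU. \<forall>\<sigma> x. min (B \<omega> \<xi> \<sigma> x (x + e1)) (B \<omega> \<xi> \<sigma> x (x + e2)) = W \<omega> x) \<and>
      (\<forall>\<xi>\<in>riU. \<forall>\<xi>'\<in>riU. \<xi> \<prec> \<xi>' \<longrightarrow> (\<forall>x.
        B \<omega> \<xi> Minus x (x + e1) \<ge> B \<omega> \<xi> Plus x (x + e1) \<and>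
        B \<omega> \<xi> Plus x (x + e1) \<ge> B \<omega> \<xi>' Minus x (x + e1) \<and>
        B \<omega> \<xi>' Minus x (x + e1) \<ge> B \<omega> \<xi>' Plus x (x + e1) \<and>
        B \<omega> \<xi> Minus x (x + e2) \<le> B \<omega> \<xi> Plus x (x + e2) \<and>
        B \<omega> \<xi> Plus x (x + e2) \<le> B \<omega> \<xi>' Minus x (x + e2) \<and>
        B \<omega> \<xi>' Minus x (x + e2) \<le> B \<omega> \<xi>' Plus x (x + e2))) \<and>
      (\<forall>\<xi>\<in>riU. \<forall>\<sigma> x y.
        ((\<lambda>\<zeta>. B \<omega> \<zeta> \<sigma> x y) \<longlongrightarrow> B \<omega> \<xi> Minus x y) (at_below \<xi>) \<and>
        ((\<lambda>\<zeta>. B \<omega> \<zeta> \<sigma> x y) \<longlongrightarrow> B \<omega> \<xi> Plus x y) (at_above \<xi>)) \<and>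
      (\<forall>\<sigma> x.
        filterlim (\<lambda>\<xi>. B \<omega> \<xi> \<sigma> x (x + e1)) at_top (at e2 within riU) \<and>
        filterlim (\<lambda>\<xi>. B \<omega> \<xi> \<sigma> x (x + e2)) at_top (at e1 within riU)))"
    and B2_integrable: "\<And>\<xi> \<sigma> x y. \<xi> \<in> riU \<Longrightarrow> integrable M (\<lambda>\<omega>. B \<omega> \<xi> \<sigma> x y)"
    and B2_e1: "\<And>\<xi> \<sigma> x. \<xi> \<in> riU \<Longrightarrow>
      expectation (\<lambda>\<omega>. B \<omega> \<xi> \<sigma> x (x + e1)) = grad g \<xi> \<sigma> \<bullet> e1"
    and B2_e2: "\<And>\<xi> \<sigma> x. \<xi> \<in> riU \<Longrightarrow>
      expectation (\<lambda>\<omega>. B \<omega> \<xi> \<sigma> x (x + e2)) = grad g \<xi> \<sigma> \<bullet> e2"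
    and B3: "AE \<omega> in M. \<forall>\<zeta>\<in>riU. \<forall>\<eta>\<in>riU. \<forall>\<sigma>.
      grad g \<zeta> \<sigma> = grad g \<eta> \<sigma> \<longrightarrow> (\<forall>x y. B \<omega> \<zeta> \<sigma> x y = B \<omega> \<eta> \<sigma> x y)"
    and B4: "\<And>I. indep_set
      (gen_events M ({(\<lambda>\<omega>. W \<omega> x) | x. x \<in> I} \<union>
        {(\<lambda>\<omega>. B \<omega> \<xi> \<sigma> x y) | \<xi> \<sigma> x y. x \<in> I \<and> x \<le> y \<and> \<xi> \<in> riU}))
      (gen_events M {(\<lambda>\<omega>. W \<omega> x) | x. \<forall>z\<in>I. \<not> z \<le> x})"
    and B5_no_ties: "\<And>\<xi>. \<xi> \<in> riU \<Longrightarrow>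
      AE \<omega> in M. \<forall>\<sigma> x. B \<omega> \<xi> \<sigma> x (x + e1) \<noteq> B \<omega> \<xi> \<sigma> x (x + e2)"
    and B5_shape: "\<And>\<xi>. \<xi> \<in> riU \<Longrightarrow> AE \<omega> in M. \<forall>\<sigma>.
      (\<lambda>n. (MAX x\<in>quadrant_sphere n. \<bar>B \<omega> \<xi> \<sigma> 0 x - to_dir x \<bullet> grad g \<xi> \<sigma>\<bar>) / real n)
        \<longlonglongrightarrow> 0"
    and B5_no_jump: "\<And>\<xi>. \<xi> \<in> diff_dirs g \<Longrightarrow>
      AE \<omega> in M. \<forall>x y. B \<omega> \<xi> Plus x y = B \<omega> \<xi> Minus x y"
    and B5_limit: "\<And>\<xi>. \<xi> \<in> diff_dirs g \<Longrightarrow> U_lower g \<xi> \<in> diff_dirs g \<Longrightarrow>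
      U_upper g \<xi> \<in> diff_dirs g \<Longrightarrow>
      AE \<omega> in M. \<forall>v :: nat \<Rightarrow> site.
        filterlim (\<lambda>n. norm (to_dir (v n))) at_top sequentially \<longrightarrow>
        (\<lambda>n. to_dir (v n) /\<^sub>R real n) \<longlonglongrightarrow> \<xi> \<longrightarrow>
        (\<forall>\<sigma> x y. (\<lambda>n. lpp (W \<omega>) x (v n) - lpp (W \<omega>) y (v n)) \<longlonglongrightarrow> B \<omega> \<xi> \<sigma> x y)"

end

theory Submission
  imports Defs
begin

text \<open>
  Fix a realization. For directions \<open>\<zeta> \<prec> \<xi> \<prec> \<eta>\<close> the Busemann geodesics from a site are ordered, and the increments
  of \<open>B\<close> between \<open>x\<close> and \<open>y\<close> are monotone along edges, so \<open>\<xi>\<close> lies off the support of \<open>\<mu>\<close> iff \<open>B\<close> between \<open>x\<close> and \<open>y\<close> is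
  constant near \<open>\<xi>\<close>. If both crossed pairs of geodesics in (ii) meet, all four meet at one site, through which then
  every geodesic in a nearby direction passes; thus \<open>B\<close> is a difference of two passage times and locally constant.
  Conversely, for rational \<open>\<zeta>, \<eta>\<close> near \<open>\<xi>\<close> the geodesics of each direction coalesce, and equality of the
  two values of \<open>B\<close> is a linear relation between finitely many weights. The weights being continuous and independent, almost surely
  it is trivial, i.e. the sites on the four geodesics agree as multisets, and this forces a common site.

  Coalescence in a fixed direction: if two antidiagonal neighbours were separated forever with positive probability, stationarity would
  make each separated pair have exactly one separated pair as predecessor one level below. Between two of these lines of
  separated pairs the independent weights below can be chosen, with positive probability, so that \<open>B\<close> becomes much smaller inside than at
  the border; then the strip narrows at every step until it disappears, which is impossible.

  For (iii), a limit direction of a Busemann geodesic is a point where \<open>g\<close> touches its tangent at \<open>\<xi>\<close>. Under the regularity condition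
  uniqueness of finite geodesics squeezes every geodesic directed into the linear segment of \<open>\<xi>\<close> between the two Busemann geodesics of \<open>\<xi>\<close>,
  so two such geodesics from \<open>x\<close> and \<open>y\<close> meet whenever both crossed pairs in (ii) do.
\<close>

section \<open>Flow lines of up-right steps\<close>

text \<open>The support concerns all directions at once, including random exceptional ones where
  \<open>B\<close> jumps, whereas absence of ties, coalescence and the shape theorem for
  \<open>B\<close> hold almost surely only for a direction fixed in advance. They are therefore used
  at rational directions, on one event of full probability, and reach other directions through
  monotonicity: rationals from below reproduce the \<open>Minus\<close> rule on any finite stretch,
  rationals from above the \<open>Plus\<close> rule, and everything between is squeezed.

  The geodesics behind an equality of two values of \<open>B\<close> may overlap in an unknown way.
  Multisets of sites avoid case distinctions: a site carries its level, so one identity of multisets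
  splits into an identity of pairs at each level.

  In the coalescence proof, the place where separated lines cross the next lower level is decided by
  the values above it, not by the new weights. This lets independence fix the strip first and choose
  the weights afterwards. The strip may widen at first, but every level gains the same depth, so
  after boundedly many levels the signs at both borders are forced.\<close>

definition up_right_step :: "(site \<Rightarrow> site) \<Rightarrow> bool" where
  "up_right_step s \<longleftrightarrow> (\<forall>z. s z = z + e1 \<or> s z = z + e2)"

text \<open>The iteration of \<open>busemann_geodesic\<close> for an arbitrary step rule: arguments
  about order and meeting use only that every step is \<open>e1\<close> or
  \<open>e2\<close>.\<close>

definition flow :: "(site \<Rightarrow> site) \<Rightarrow> site \<Rightarrow> int \<Rightarrow> site" where
  "flow s x k = (s ^^ nat (k - level x)) x"

lemma level_add_e [simp]: "level (z + e1) = level z + (1::int)" "level (z + e2) = level z + (1::int)"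
  by (auto simp: level_def)

lemma site_eqI: "level x = level y \<Longrightarrow> fst x = fst y \<Longrightarrow> x = (y::site)"
  by (auto simp: level_def prod_eq_iff)

lemma up_right_stepD: "up_right_step s \<Longrightarrow> s z = z + e1 \<or> s z = z + e2"
  unfolding up_right_step_def by blast

lemma level_step: "up_right_step s \<Longrightarrow> level (s z) = level z + 1"
  using up_right_stepD[of s z] by auto

lemma fst_step: "up_right_step s \<Longrightarrow> fst z \<le> fst (s z) \<and> fst (s z) \<le> fst z + 1"
  using up_right_stepD[of s z] by auto

lemma flow_start [simp]: "flow s x (level x) = x"
  by (simp add: flow_def)

lemma flow_Suc: "level x \<le> k \<Longrightarrow> flow s x (k + 1) = s (flow s x k)"
proof -
  assume "level x \<le> k"
  then have "nat (k + 1 - level x) = Suc (nat (k - level x))" by linarith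
  then show ?thesis by (simp add: flow_def)
qed

lemma level_flow:
  assumes "up_right_step s" "level x \<le> k"
  shows "level (flow s x k) = k"
  using assms(2,1) by (induction k rule: int_ge_induct) (auto simp: flow_Suc level_step)

lemma flow_flow:
  assumes "up_right_step s" "level x \<le> k" "k \<le> l"
  shows "flow s (flow s x k) l = flow s x l"
  using assms(3)
proof (induction l rule: int_ge_induct)
  case base
  show ?case using flow_start[of s "flow s x k"] level_flow[OF assms(1,2)] by simp
next
  case (step i)
  then show ?case using level_flow[OF assms(1,2)] assms by (simp add: flow_Suc)
qed

lemma flow_ge:
  assumes "up_right_step s" "level x \<le> k"
  shows "x \<le> flow s x k"
  using assms(2,1)
proof (induction k rule: int_ge_induct)
  case (step i)
  then have "flow s x i \<le> s (flow s x i)"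
    using up_right_stepD[of s "flow s x i"] by (auto simp: less_eq_prod_def)
  with step show ?case by (simp add: flow_Suc)
qed auto

lemma flow_meet:
  assumes "up_right_step s" "level x \<le> k" "level y \<le> k" "k \<le> l" "flow s x k = flow s y k"
  shows "flow s x l = flow s y l"
  using assms by (metis flow_flow)

text \<open>Planarity of lattice paths: at equal levels the first coordinates grow by 0 or 1 per
  step, so a strict gap can shrink to 0 but cannot change sign, and at a common site the hypothesis
  \<open>le\<close> decides.\<close>

lemma flow_mono:
  assumes s: "up_right_step s" and s': "up_right_step s'"
    and le: "\<And>z. fst (s z) \<le> fst (s' z)"
    and k: "level x \<le> k" "level y \<le> k" and kl: "k \<le> l"
    and start: "fst (flow s x k) \<le> fst (flow s' y k)"
  shows "fst (flow s x l) \<le> fst (flow s' y l)"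
  using kl
proof (induction l rule: int_ge_induct)
  case base
  show ?case by (rule start)
next
  case (step i)
  let ?u = "flow s x i" and ?v = "flow s' y i"
  have *: "flow s x (i + 1) = s ?u" "flow s' y (i + 1) = s' ?v"
    using step k by (auto simp: flow_Suc)
  show ?case
  proof (cases "fst ?u = fst ?v")
    case True
    then have "?u = ?v"
      using site_eqI level_flow[OF s] level_flow[OF s'] k step by (metis order_trans)
    then show ?thesis using * le by simp
  next
    case False
    then show ?thesis using * step fst_step[OF s, of ?u] fst_step[OF s', of ?v] by auto
  qed
qed

lemma flow_mono_start:
  assumes "up_right_step s" "up_right_step s'" "\<And>z. fst (s z) \<le> fst (s' z)" "level x \<le> l"
  shows "fst (flow s x l) \<le> fst (flow s' x l)"
  using flow_mono[OF assms(1-3), of x "level x" x l] assms(4) by simp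

text \<open>The level of a site is the index at which a flow line visits it, so two lines can share
  a site only at equal indices.\<close>

lemma flow_points_disjoint_iff:
  assumes "up_right_step s" "up_right_step s'"
  shows "points_from x (flow s x) \<inter> points_from y (flow s' y) = {} \<longleftrightarrow>
    (\<forall>k. level x \<le> k \<longrightarrow> level y \<le> k \<longrightarrow> flow s x k \<noteq> flow s' y k)"
proof -
  have "k = l" if "level x \<le> k" "level y \<le> l" "flow s x k = flow s' y l" for k l
    using that level_flow[OF assms(1), of x k] level_flow[OF assms(2), of y l] by simp
  then show ?thesis unfolding points_from_def disjoint_iff by fastforce
qed

lemma flow_pinch:
  assumes "up_right_step s" "up_right_step s'" "level x \<le> k" "level y \<le> k"
    "fst (flow s x k) \<le> fst m" "fst m \<le> fst (flow s x k)" "level m = k"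
  shows "flow s x k = m"
  using assms by (intro site_eqI) (auto simp: level_flow)

text \<open>The common site is the later one of the two meeting points.\<close>

lemma flow_four_meet:
  assumes s: "up_right_step s" and s': "up_right_step s'"
    and le: "\<And>z. fst (s z) \<le> fst (s' z)"
    and k: "level x \<le> k" "level y \<le> k" "flow s x k = flow s' y k"
    and l: "level x \<le> l" "level y \<le> l" "flow s' x l = flow s y l"
  shows "\<exists>n q. level x \<le> n \<and> level y \<le> n \<and> flow s x n = q \<and> flow s' x n = q \<and> flow s y n = q \<and> flow s' y n = q"
proof -
  have main: "\<exists>n q. level x \<le> n \<and> level y \<le> n \<and> flow s x n = q \<and> flow s' x n = q \<and> flow s y n = q \<and> flow s' y n = q"
    if k: "level x \<le> k" "level y \<le> k" "flow s x k = flow s' y k"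
    and l: "level x \<le> l" "level y \<le> l" "flow s' x l = flow s y l" and "k \<le> l" for x y k l
  proof -
    \<comment> \<open>At level \<open>l\<close> the order closes into a cycle,
      \<open>flow s y\<close> \<le> \<open>flow s x\<close> \<le> \<open>flow s' y\<close> \<le>
      \<open>flow s' x\<close> = \<open>flow s y\<close>, so all four lines coincide there.\<close>
    have "fst (flow s x l) \<le> fst (flow s' y l)"
      using flow_mono[OF s s' le k(1,2) \<open>k \<le> l\<close>] k(3) by simp
    moreover have "fst (flow s y k) \<le> fst (flow s x k)"
      using flow_mono_start[OF s s' le k(2)] k(3) by simp
    then have "fst (flow s y l) \<le> fst (flow s x l)"
      using flow_mono[OF s s _ k(2,1) \<open>k \<le> l\<close>] by simp
    moreover have "fst (flow s' y k) \<le> fst (flow s' x k)"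
      using flow_mono_start[OF s s' le k(1)] k(3) by simp
    then have "fst (flow s' y l) \<le> fst (flow s' x l)"
      using flow_mono[OF s' s' _ k(2,1) \<open>k \<le> l\<close>] by simp
    ultimately have "fst (flow s x l) = fst (flow s y l)" "fst (flow s' y l) = fst (flow s y l)"
      using l(3) by auto
    then have "flow s x l = flow s y l" "flow s' y l = flow s y l"
      using l level_flow[OF s] level_flow[OF s'] by (metis site_eqI)+
    then show ?thesis using l by blast
  qed
  show ?thesis
  proof (cases "k \<le> l")
    case True
    then show ?thesis using main[OF k l] by simp
  next
    case False
    then show ?thesis using main[of y l x k] k l by fastforce
  qed
qed

text \<open>Before the first meeting within either flow, the multisets at a level can only agree because the two
  flows agree along both lines; hence the first meeting of one flow is also one of the other.\<close>

lemma flow_four_meet_of_multisets: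
  assumes s: "up_right_step s" and s': "up_right_step s'"
    and le: "\<And>z. fst (s z) \<le> fst (s' z)"
    and xy: "level x \<le> level y"
    and low: "flow s x (level y) = flow s' x (level y)"
    and ms: "\<And>k. level y \<le> k \<Longrightarrow> k \<le> L \<Longrightarrow>
      {#flow s x k, flow s' y k#} = {#flow s' x k, flow s y k#}"
    and L: "level y \<le> L" "flow s x L = flow s y L" "flow s' x L = flow s' y L"
  shows "\<exists>n q. level x \<le> n \<and> level y \<le> n \<and> flow s x n = q \<and> flow s' x n = q \<and> flow s y n = q \<and> flow s' y n = q"
proof -
  \<comment> \<open>\<open>j\<close> counts levels above \<open>y\<close>. At \<open>j = 0\<close>
    both lines from \<open>y\<close> are still at \<open>y\<close>, and \<open>low\<close> makes the
    two lines from \<open>x\<close> agree.\<close>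
  define P where "P j \<longleftrightarrow> flow s x (level y + int j) = flow s y (level y + int j) \<or>
    flow s' x (level y + int j) = flow s' y (level y + int j)" for j
  define j where "j = (LEAST j. P j)"
  have PL: "P (nat (L - level y))" using L by (simp add: P_def)
  then have Pj: "P j" unfolding j_def by (rule LeastI)
  have jL: "j \<le> nat (L - level y)" unfolding j_def using PL by (rule Least_le)
  define k where "k = level y + int j"
  have k: "level y \<le> k" "k \<le> L" using jL L by (auto simp: k_def)
  show ?thesis
  proof (cases j)
    case 0
    then show ?thesis using Pj low xy by (intro exI[of _ "level y"]) (auto simp: P_def)
  next
    case (Suc i)
    have "\<not> P i" using not_less_Least[of i P] Suc by (simp add: j_def)
    define h where "h = level y + int i"
    have h: "level y \<le> h" "h \<le> L" "k = h + 1" using k Suc by (auto simp: h_def k_def)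
    have ne: "flow s x h \<noteq> flow s y h" "flow s' x h \<noteq> flow s' y h"
      using \<open>\<not> P i\<close> by (auto simp: P_def h_def)
    \<comment> \<open>The other matching of the two multisets would identify the two lines of one
      rule, which are still apart at this level.\<close>
    have eq: "flow s x h = flow s' x h" "flow s y h = flow s' y h"
      using ms[OF h(1,2)] ne by (auto simp: add_eq_conv_ex add_mset_eq_single)
    define a c where "a = flow s x h" and "c = flow s y h"
    have fl: "flow s x k = s a" "flow s' x k = s' a" "flow s y k = s c" "flow s' y k = s' c"
      using h xy eq by (auto simp: flow_Suc a_def c_def)
    have ac: "a \<noteq> c" using ne by (simp add: a_def c_def)
    have lac: "level a = level c" using h xy s by (simp add: a_def c_def level_flow)
    have P: "s a = s c \<or> s' a = s' c" using Pj fl by (simp add: P_def k_def)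
    have ms': "{#s a, s' c#} = {#s' a, s c#}" using ms[OF k] fl by simp
    then have "s a = s' a \<and> s' c = s c \<or> s a = s c \<and> s' c = s' a"
      by (auto simp: add_eq_conv_ex add_mset_eq_single)
    then have "s a = s' a \<and> s c = s' c \<and> s a = s c \<or> s a = s c \<and> s' a = s' c"
      using P by auto
    \<comment> \<open>Two different sites of one antidiagonal step to a common site only if the left
      one takes \<open>e1\<close>. This applies to both rules, so both move the left site to the
      same place.\<close>
    moreover have "s a = s' a" if "s a = s c" "s' a = s' c"
    proof -
      have "\<exists>u v. {u, v} = {a, c} \<and> fst u < fst v"
        using ac lac site_eqI by (metis insert_commute linorder_neqE)
      then obtain u v where uv: "{u, v} = {a, c}" "fst u < fst v" by blast
      have eq: "s u = s v" "s' u = s' v" using uv that by (auto simp: doubleton_eq_iff)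
      have "level u = level v" using uv lac by (auto simp: doubleton_eq_iff)
      have "s u = u + e1" "s' u = u + e1"
        using eq uv(2) s s' unfolding up_right_step_def
        by (metis add.commute add_0 fst_add fst_conv fst_step s s' linorder_not_less)+
      then have "s u = s' u" by simp
      then show ?thesis using uv eq by (auto simp: doubleton_eq_iff)
    qed
    ultimately have "s a = s' a \<and> s c = s a \<and> s' c = s a" by metis
    then show ?thesis using fl k xy by (intro exI[of _ k]) auto
  qed
qed

section \<open>Signed measures on intervals of directions\<close>

abbreviation dir_of :: "real \<Rightarrow> dir" where "dir_of t \<equiv> (t, 1 - t)"

lemma U_iff: "\<xi> \<in> U \<longleftrightarrow> (\<exists>t. 0 \<le> t \<and> t \<le> 1 \<and> \<xi> = dir_of t)"
  unfolding U_def by auto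

lemma riU_iff: "\<xi> \<in> riU \<longleftrightarrow> (\<exists>t. 0 < t \<and> t < 1 \<and> \<xi> = dir_of t)"
  unfolding riU_def U_def by (auto; smt (verit))

lemma dir_less_dir_of [simp]: "dir_of s \<prec> dir_of t \<longleftrightarrow> s < t"
  by (simp add: dir_less_def level_def)

lemma dir_le_dir_of [simp]: "dir_of s \<preceq> dir_of t \<longleftrightarrow> s \<le> t"
  by (simp add: dir_le_def level_def)

lemma dir_Icc_dir_of: "0 \<le> s \<Longrightarrow> t \<le> 1 \<Longrightarrow> dir_Icc (dir_of s) (dir_of t) = dir_of ` {s..t}"
  unfolding dir_Icc_def U_iff by auto

lemma dir_Ioc_dir_of: "0 \<le> s \<Longrightarrow> t \<le> 1 \<Longrightarrow> dir_Ioc (dir_of s) (dir_of t) = dir_of ` {s<..t}"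
  unfolding dir_Ioc_def U_iff by auto

lemma dir_Ico_dir_of: "0 \<le> s \<Longrightarrow> t \<le> 1 \<Longrightarrow> dir_Ico (dir_of s) (dir_of t) = dir_of ` {s..<t}"
  unfolding dir_Ico_def U_iff by auto

lemma vimage_dir_of_borel: "A \<in> sets borel \<Longrightarrow> {t. dir_of t \<in> A} \<in> sets borel"
proof -
  assume "A \<in> sets borel"
  have "dir_of \<in> borel_measurable borel"
    by (intro borel_measurable_continuous_onI continuous_intros)
  from measurable_sets[OF this \<open>A \<in> sets borel\<close>] show ?thesis by (simp add: vimage_def)
qed

lemma image_dir_of_borel: "A \<in> sets borel \<Longrightarrow> dir_of ` A \<in> sets borel"
proof -
  assume A: "A \<in> sets borel"
  have "fst -` A \<inter> space (borel :: dir measure) \<in> sets borel"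
    by (intro measurable_sets[OF _ A] borel_measurable_continuous_onI continuous_intros)
  moreover have "closed {x :: dir. snd x = 1 - fst x}"
    by (intro closed_Collect_eq continuous_intros)
  moreover have "dir_of ` A = (fst -` A \<inter> space borel) \<inter> {x :: dir. snd x = 1 - fst x}"
    by (auto simp: image_iff)
  ultimately show ?thesis by auto
qed

lemma sets_borel_on_dir:
  assumes "0 \<le> s" "t \<le> 1"
  shows "sets (borel_on (dir_Icc (dir_of s) (dir_of t))) = (\<lambda>A. dir_of ` A) ` {A. A \<in> sets borel \<and> A \<subseteq> {s..t}}"
    and "space (borel_on (dir_Icc (dir_of s) (dir_of t))) = dir_of ` {s..t}"
proof -
  have sp: "dir_of ` {s..t} \<in> sets borel" by (intro image_dir_of_borel) auto
  then have "sets (borel_on (dir_Icc (dir_of s) (dir_of t))) = {A. A \<subseteq> dir_of ` {s..t} \<and> A \<in> sets borel}"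
    unfolding borel_on_def dir_Icc_dir_of[OF assms] by (subst sets_restrict_space_iff[symmetric, of _ borel, THEN Collect_cong, simplified]) auto
  also have "\<dots> = (\<lambda>A. dir_of ` A) ` {A. A \<in> sets borel \<and> A \<subseteq> {s..t}}"
  proof safe
    fix A assume A: "A \<subseteq> dir_of ` {s..t}" "A \<in> sets borel"
    then have "A = dir_of ` {t. dir_of t \<in> A}" by auto
    then show "A \<in> (\<lambda>A. dir_of ` A) ` {A. A \<in> sets borel \<and> A \<subseteq> {s..t}}"
      using vimage_dir_of_borel[OF A(2)] A(1) by (intro image_eqI[of _ _ "{t. dir_of t \<in> A}"]) auto
  qed (auto intro: image_dir_of_borel)
  finally show "sets (borel_on (dir_Icc (dir_of s) (dir_of t))) = (\<lambda>A. dir_of ` A) ` {A. A \<in> sets borel \<and> A \<subseteq> {s..t}}" .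
  show "space (borel_on (dir_Icc (dir_of s) (dir_of t))) = dir_of ` {s..t}"
    unfolding borel_on_def dir_Icc_dir_of[OF assms] by (simp add: space_restrict_space)
qed

text \<open>Countable additivity transported to the parameter line, for bare set functions, so that
  it also covers the difference of two candidate measures.\<close>

definition interval_additive :: "real \<Rightarrow> real \<Rightarrow> (real set \<Rightarrow> real) \<Rightarrow> bool" where
  "interval_additive s t N \<longleftrightarrow> (\<forall>A :: nat \<Rightarrow> real set. range A \<subseteq> {A. A \<in> sets borel \<and> A \<subseteq> {s..t}} \<longrightarrow>
     disjoint_family A \<longrightarrow> (\<lambda>i. N (A i)) sums N (\<Union>i. A i))"

lemma signed_measure_interval_additive:
  assumes "0 \<le> s" "t \<le> 1"
    and "signed_measure (borel_on (dir_Icc (dir_of s) (dir_of t))) \<mu>"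
  shows "interval_additive s t (\<lambda>A. \<mu> (dir_of ` A))"
  unfolding interval_additive_def
proof safe
  fix A :: "nat \<Rightarrow> real set"
  assume A: "range A \<subseteq> {A. A \<in> sets borel \<and> A \<subseteq> {s..t}}" "disjoint_family A"
  have "range (\<lambda>i. dir_of ` A i) \<subseteq> sets (borel_on (dir_Icc (dir_of s) (dir_of t)))"
    unfolding sets_borel_on_dir[OF assms(1,2)] using A(1) by blast
  moreover have "disjoint_family (\<lambda>i. dir_of ` A i)"
    using A(2) unfolding disjoint_family_on_def by auto
  ultimately have "(\<lambda>i. \<mu> (dir_of ` A i)) sums \<mu> (\<Union>i. dir_of ` A i)"
    using assms(3) unfolding signed_measure_def by blast
  then show "(\<lambda>i. \<mu> (dir_of ` A i)) sums \<mu> (dir_of ` (\<Union>i. A i))" by (simp add: image_UN)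
qed

lemma interval_additive_empty:
  assumes "interval_additive s t N"
  shows "N {} = 0"
proof -
  have "(\<lambda>i. N {}) sums N (\<Union>i::nat. {})"
    using assms[unfolded interval_additive_def, rule_format, of "\<lambda>_. {}"] by (simp add: disjoint_family_on_def)
  then have "(\<lambda>i::nat. N {}) \<longlonglongrightarrow> 0" using summable_LIMSEQ_zero sums_summable by blast
  then show ?thesis using LIMSEQ_const_iff by blast
qed

lemma interval_additive_Un:
  assumes "interval_additive s t N" "A \<in> sets borel" "A \<subseteq> {s..t}" "C \<in> sets borel" "C \<subseteq> {s..t}" "A \<inter> C = {}"
  shows "N (A \<union> C) = N A + N C"
proof -
  let ?A = "binaryset A C"
  have "(\<lambda>i. N (?A i)) sums N (\<Union>i. ?A i)"
    using assms by (intro assms(1)[unfolded interval_additive_def, rule_format])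
      (auto simp: range_binaryset_eq disjoint_family_on_def binaryset_def split: if_splits)
  moreover have "(\<lambda>i. N (?A i)) sums (N A + N C)"
    using binaryset_sums[of N A C] interval_additive_empty[OF assms(1)] by simp
  ultimately show ?thesis using sums_unique2 by (auto simp: UN_binaryset_eq)
qed

text \<open>The values on half-open intervals leave the point mass at the left endpoint undetermined; it is
  recovered by countable additivity from intervals shrinking to that endpoint.\<close>

lemma interval_additive_zero:
  assumes N: "interval_additive s t N" and st: "s \<le> s'" "s' < t'" "t' \<le> t"
    and Ioc: "\<And>a c. s' \<le> a \<Longrightarrow> a < c \<Longrightarrow> c \<le> t' \<Longrightarrow> N {a<..c} = 0"
    and Ico: "\<And>a c. s' \<le> a \<Longrightarrow> a < c \<Longrightarrow> c \<le> t' \<Longrightarrow> N {a..<c} = 0"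
    and A: "A \<in> sets borel" "A \<subseteq> {s'..t'}"
  shows "N A = 0"
proof -
  have empty: "N {} = 0" using interval_additive_empty[OF N] .
  \<comment> \<open>As \<open>u 0 = t'\<close> and \<open>u\<close> decreases to \<open>s'\<close>,
    the intervals \<open>{u (Suc n)..<u n}\<close> tile the open interval from \<open>s'\<close> to
    \<open>t'\<close>. The mass of \<open>{s'}\<close> is what \<open>{s'..<t'}\<close> has in
    addition.\<close>
  define u where "u n = s' + (t' - s') / real (n + 1)" for n
  have u: "s' < u n" "u n \<le> t'" "u (Suc n) < u n" for n
  proof -
    have "s' * real n \<le> t' * real n" using st by (intro mult_right_mono) auto
    then show "s' < u n" "u n \<le> t'" "u (Suc n) < u n" using st by (auto simp: u_def field_simps)
  qed
  have u_lim: "u \<longlonglongrightarrow> s'"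
    unfolding u_def using tendsto_add[OF tendsto_const tendsto_mult[OF tendsto_const LIMSEQ_inverse_real_of_nat], of s' "t' - s'"]
    by (simp add: divide_inverse add.commute)
  have dec: "u m \<le> u n" if "n \<le> m" for m n
    by (rule lift_Suc_antimono_le[of u, OF less_imp_le[OF u(3)] that])
  have pt: "N {s'} = 0"
  proof -
    let ?A = "\<lambda>n. {u (Suc n)..<u n}"
    have "disjoint_family ?A"
      unfolding disjoint_family_on_def
    proof safe
      fix m n x assume "m \<noteq> n" "x \<in> ?A m" "x \<in> ?A n"
      then show "x \<in> {}" using dec[of "Suc m" n] dec[of "Suc n" m] by (cases "m < n") auto
    qed
    moreover have "range ?A \<subseteq> {A. A \<in> sets borel \<and> A \<subseteq> {s..t}}"
      using u st by (auto; smt (verit) u)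
    ultimately have "(\<lambda>n. N (?A n)) sums N (\<Union>n. ?A n)"
      using N unfolding interval_additive_def by blast
    moreover have "N (?A n) = 0" for n using u by (intro Ico) (auto simp: less_imp_le)
    ultimately have "N (\<Union>n. ?A n) = 0" using sums_unique2[OF _ sums_zero] by simp
    moreover have "(\<Union>n. ?A n) = {s'<..<t'}"
    proof safe
      fix x n assume "x \<in> ?A n"
      then show "x \<in> {s'<..<t'}" using u[of n] u[of "Suc n"] by auto
    next
      fix x assume x: "x \<in> {s'<..<t'}"
      have "\<exists>n. u n \<le> x"
        using order_tendstoD(2)[OF u_lim, of x] x by (auto simp: eventually_sequentially intro: less_imp_le)
      define n where "n = (LEAST n. u n \<le> x)"
      have n: "u n \<le> x" unfolding n_def using \<open>\<exists>n. u n \<le> x\<close> by (rule LeastI_ex)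
      have "u 0 = t'" by (simp add: u_def)
      then have "n \<noteq> 0" using n x by (metis greaterThanLessThan_iff linorder_not_less)
      then obtain m where m: "n = Suc m" using not0_implies_Suc by blast
      have "\<not> u m \<le> x" using not_less_Least[of m "\<lambda>n. u n \<le> x"] m by (simp add: n_def)
      then show "x \<in> (\<Union>n. ?A n)" using n m by (auto intro!: exI[of _ m])
    qed
    ultimately have "N {s'<..<t'} = 0" by simp
    moreover have "N {s'..<t'} = N {s'} + N {s'<..<t'}"
    proof -
      have "{s'..<t'} = {s'} \<union> {s'<..<t'}" using st by auto
      then show ?thesis using st interval_additive_Un[OF N, of "{s'}" "{s'<..<t'}"] by force
    qed
    ultimately show ?thesis using Ico[of s' t'] st by simp
  qed
  have Icc: "N {s'..c} = 0" if "s' \<le> c" "c \<le> t'" for c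
  proof (cases "s' = c")
    case False
    have "{s'..c} = {s'} \<union> {s'<..c}" using that by auto
    then show ?thesis using False Ioc[of s' c] pt that st interval_additive_Un[OF N, of "{s'}" "{s'<..c}"] by force
  qed (use pt in simp)
  \<comment> \<open>Induction over the Borel sets from the half-lines \<open>{..a}\<close>, which
    are stable under intersection; it asks only for complements and disjoint unions, which a signed
    function respects.\<close>
  have "N (A \<inter> {s'..t'}) = 0"
  proof (rule sigma_sets_induct_disjoint[where P = "\<lambda>A. N (A \<inter> {s'..t'}) = 0"])
    show "Int_stable (range (\<lambda>a::real. {..a}))" by (auto simp: Int_stable_def)
    show "range (\<lambda>a::real. {..a}) \<subseteq> Pow UNIV" by simp
    show "A \<in> sigma_sets UNIV (range (\<lambda>a::real. {..a}))"
      using A(1) by (simp add: borel_eq_atMost[where 'a=real])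
  next
    fix A assume "A \<in> range (\<lambda>a::real. {..a})"
    then obtain a where a: "A = {..a}" by blast
    consider "a < s'" | "s' \<le> a" "a \<le> t'" | "t' < a" by linarith
    then show "N (A \<inter> {s'..t'}) = 0"
    proof cases
      case 1
      then have "A \<inter> {s'..t'} = {}" using a by auto
      then show ?thesis using empty by simp
    next
      case 2
      then have "A \<inter> {s'..t'} = {s'..a}" using a by auto
      then show ?thesis using Icc 2 by simp
    next
      case 3
      then have "A \<inter> {s'..t'} = {s'..t'}" using a by auto
      then show ?thesis using Icc[of t'] st by simp
    qed
  next
    show "N ({} \<inter> {s'..t'}) = 0" using empty by simp
  next
    fix A assume A: "A \<in> sigma_sets UNIV (range (\<lambda>a::real. {..a}))" "N (A \<inter> {s'..t'}) = 0"
    then have A': "A \<in> sets borel" by (simp add: borel_eq_atMost[where 'a=real])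
    have "{s'..t'} = A \<inter> {s'..t'} \<union> (UNIV - A) \<inter> {s'..t'}" by auto
    then have "N {s'..t'} = N (A \<inter> {s'..t'}) + N ((UNIV - A) \<inter> {s'..t'})"
      using interval_additive_Un[OF N, of "A \<inter> {s'..t'}" "(UNIV - A) \<inter> {s'..t'}"] A' st by fastforce
    then show "N ((UNIV - A) \<inter> {s'..t'}) = 0" using A(2) Icc[of t'] st by simp
  next
    fix A :: "nat \<Rightarrow> real set"
    assume A: "disjoint_family A" "range A \<subseteq> sigma_sets UNIV (range (\<lambda>a::real. {..a}))"
      "\<And>i. N (A i \<inter> {s'..t'}) = 0"
    have "range A \<subseteq> sets borel" using A(2) by (simp add: borel_eq_atMost[where 'a=real])
    then have "range (\<lambda>i. A i \<inter> {s'..t'}) \<subseteq> {A. A \<in> sets borel \<and> A \<subseteq> {s..t}}" using st by auto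
    moreover have "disjoint_family (\<lambda>i. A i \<inter> {s'..t'})"
      using A(1) unfolding disjoint_family_on_def by blast
    ultimately have "(\<lambda>i. N (A i \<inter> {s'..t'})) sums N (\<Union>i. A i \<inter> {s'..t'})"
      using N unfolding interval_additive_def by blast
    moreover have "(\<Union>i. A i \<inter> {s'..t'}) = (\<Union>i. A i) \<inter> {s'..t'}" by auto
    ultimately show "N ((\<Union>i. A i) \<inter> {s'..t'}) = 0" using A(3) sums_unique2[OF _ sums_zero] by simp
  qed
  then show ?thesis using A(2) by (simp add: Int_absorb2)
qed

lemma total_variation_eq_0:
  assumes "\<And>E. E \<in> sets N \<Longrightarrow> E \<subseteq> A \<Longrightarrow> \<mu> E = 0"
  shows "total_variation N \<mu> A = 0"
proof -
  have "(\<Sum>E\<in>P. ennreal \<bar>\<mu> E\<bar>) = 0" if "P \<in> {P. finite P \<and> P \<subseteq> sets N \<and> partition_on A P}" for P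
  proof -
    have "\<mu> E = 0" if "E \<in> P" for E
      using assms \<open>P \<in> _\<close> that by (auto dest!: partition_onD1)
    then show ?thesis by simp
  qed
  then have "total_variation N \<mu> A \<le> 0" unfolding total_variation_def by (intro SUP_least) auto
  then show ?thesis by simp
qed

lemma total_variation_0_imp:
  assumes "total_variation N \<mu> A = 0" "E \<in> sets N" "A \<in> sets N" "E \<subseteq> A" "\<mu> {} = 0"
  shows "\<mu> E = 0"
proof -
  \<comment> \<open>Blocks of a partition are nonempty, hence the removal of the empty set.\<close>
  define P where "P = {E, A - E} - {{}}"
  have "partition_on A P"
    using assms(4) unfolding P_def by (intro partition_onI) (auto simp: disjnt_def)
  moreover have "finite P" "P \<subseteq> sets N" using assms by (auto simp: P_def)
  ultimately have "(\<Sum>E\<in>P. ennreal \<bar>\<mu> E\<bar>) \<le> total_variation N \<mu> A"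
    unfolding total_variation_def by (intro SUP_upper) auto
  then have "(\<Sum>E\<in>P. ennreal \<bar>\<mu> E\<bar>) = 0" using assms(1) by simp
  moreover have "E \<in> P" if "E \<noteq> {}" using that by (simp add: P_def)
  ultimately show ?thesis using assms(5) \<open>finite P\<close> by (cases "E = {}") (auto simp: sum_nonneg_eq_0_iff)
qed

section \<open>Busemann geodesics of one realization\<close>

text \<open>Lexicographic order on signed directions with \<open>Minus\<close> before
  \<open>Plus\<close>: every direction splits into two neighbours.\<close>

definition before :: "real \<Rightarrow> sign \<Rightarrow> real \<Rightarrow> sign \<Rightarrow> bool" where
  "before s \<sigma> t \<tau> \<longleftrightarrow> s < t \<or> s = t \<and> (\<sigma> = Minus \<or> \<tau> = Plus)"

text \<open>Paths are functions on all integers, so infinitely many of them join two given sites. A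
  weight, however, reads only the index window, where the values lie in the box
  \<open>{x..y}\<close>. Finiteness is what gives the \<open>Max\<close> in \<open>lpp\<close> its
  meaning.\<close>

lemma finite_path_weights: "finite (path_weight w x y ` {\<pi>. path_between x y \<pi>})"
proof -
  let ?I = "{level x..<level y}"
  have box: "\<pi> k \<in> {x..y}" if "path_between x y \<pi>" "k \<in> {level x..level y}" for \<pi> k
  proof -
    have step: "\<pi> j \<le> \<pi> (j + 1)" if "j \<in> ?I" for j
    proof -
      have "\<pi> (j + 1) - \<pi> j \<in> {e1, e2}"
        using \<open>path_between x y \<pi>\<close> that by (auto simp: path_between_def)
      then have "\<pi> (j + 1) = \<pi> j + e1 \<or> \<pi> (j + 1) = \<pi> j + e2"
        by (metis add.commute diff_add_cancel insert_iff singletonD)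
      then show ?thesis by (auto simp: less_eq_prod_def)
    qed
    have mono: "\<pi> i \<le> \<pi> j" if "i \<le> j" "level x \<le> i" "j \<le> level y" for i j
      using that
    proof (induction j rule: int_ge_induct)
      case (step j)
      then show ?case using \<open>\<And>j. j \<in> ?I \<Longrightarrow> \<pi> j \<le> \<pi> (j + 1)\<close>[of j] by auto
    qed auto
    show ?thesis
      using mono[of "level x" k] mono[of k "level y"] that by (auto simp: path_between_def)
  qed
  have "finite {x..y}"
  proof -
    have "{x..y} \<subseteq> {fst x..fst y} \<times> {snd x..snd y}" by (auto simp: less_eq_prod_def)
    then show ?thesis by (rule finite_subset) auto
  qed
  then have fin: "finite (PiE ?I (\<lambda>_. {x..y}))" by (intro finite_PiE) auto
  have "path_weight w x y ` {\<pi>. path_between x y \<pi>}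
      \<subseteq> (\<lambda>f. \<Sum>k\<in>?I. w (f k)) ` PiE ?I (\<lambda>_. {x..y})"
  proof safe
    fix \<pi> assume \<pi>: "path_between x y \<pi>"
    show "path_weight w x y \<pi> \<in> (\<lambda>f. \<Sum>k\<in>?I. w (f k)) ` PiE ?I (\<lambda>_. {x..y})"
      by (rule image_eqI[of _ _ "restrict \<pi> ?I"])
        (use box[OF \<pi>] in \<open>auto simp: path_weight_def\<close>)
  qed
  then show ?thesis using fin finite_subset by blast
qed

lemma path_between_flow:
  "up_right_step s \<Longrightarrow> level x \<le> k \<Longrightarrow> path_between x (flow s x k) (flow s x)"
proof -
  assume s: "up_right_step s" and k: "level x \<le> k"
  have "flow s x (i + 1) - flow s x i \<in> {e1, e2}" if "level x \<le> i" for i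
    using flow_Suc[OF that, of s] up_right_stepD[OF s, of "flow s x i"] by auto
  then show ?thesis using s k by (auto simp: path_between_def level_flow)
qed

text \<open>What the deterministic arguments use of a typical realization. Ties are excluded at
  rational directions only, as far as countably many almost sure statements reach;
  \<open>generic\<close> turns an equality of weight sums into an equality of multisets of
  sites.\<close>

locale busemann_realization =
  fixes w :: "site \<Rightarrow> real" and b :: "dir \<Rightarrow> sign \<Rightarrow> site \<Rightarrow> site \<Rightarrow> real"
  assumes cocycle: "\<And>t \<sigma> x y z. 0 < t \<Longrightarrow> t < 1 \<Longrightarrow>
      b (dir_of t) \<sigma> x y + b (dir_of t) \<sigma> y z = b (dir_of t) \<sigma> x z"
    and recovery: "\<And>t \<sigma> z. 0 < t \<Longrightarrow> t < 1 \<Longrightarrow>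
      min (b (dir_of t) \<sigma> z (z + e1)) (b (dir_of t) \<sigma> z (z + e2)) = w z"
    and mono_e1: "\<And>s \<sigma> t \<tau> z. 0 < s \<Longrightarrow> t < 1 \<Longrightarrow> before s \<sigma> t \<tau> \<Longrightarrow>
      b (dir_of t) \<tau> z (z + e1) \<le> b (dir_of s) \<sigma> z (z + e1)"
    and mono_e2: "\<And>s \<sigma> t \<tau> z. 0 < s \<Longrightarrow> t < 1 \<Longrightarrow> before s \<sigma> t \<tau> \<Longrightarrow>
      b (dir_of s) \<sigma> z (z + e2) \<le> b (dir_of t) \<tau> z (z + e2)"
    and lim_left: "\<And>t \<sigma> x y. 0 < t \<Longrightarrow> t < 1 \<Longrightarrow>
      ((\<lambda>s. b (dir_of s) \<sigma> x y) \<longlongrightarrow> b (dir_of t) Minus x y) (at_left t)"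
    and lim_right: "\<And>t \<sigma> x y. 0 < t \<Longrightarrow> t < 1 \<Longrightarrow>
      ((\<lambda>s. b (dir_of s) \<sigma> x y) \<longlongrightarrow> b (dir_of t) Plus x y) (at_right t)"
    and no_ties: "\<And>q z. q \<in> \<rat> \<Longrightarrow> 0 < q \<Longrightarrow> q < 1 \<Longrightarrow>
      b (dir_of q) Plus z (z + e1) \<noteq> b (dir_of q) Plus z (z + e2)"
    and generic: "\<And>A B. (\<Sum>v\<in>#A. w v) = (\<Sum>v\<in>#B. w v) \<Longrightarrow> A = B"
begin

abbreviation st :: "real \<Rightarrow> sign \<Rightarrow> site \<Rightarrow> site" where
  "st t \<sigma> \<equiv> busemann_step (b (dir_of t) \<sigma>) \<sigma>"

lemma st [simp]: "up_right_step (st t \<sigma>)"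
  unfolding up_right_step_def busemann_step_def by (cases \<sigma>) auto

lemma step_weight: "0 < t \<Longrightarrow> t < 1 \<Longrightarrow> b (dir_of t) \<sigma> z (st t \<sigma> z) = w z"
  using recovery[of t \<sigma> z] unfolding busemann_step_def by (cases \<sigma>) (auto simp: min_def split: if_splits)

text \<open>If the smaller direction stepped right and the larger one up, monotonicity would make
  the increments at \<open>z\<close> equal and so produce ties at every direction strictly between;
  a rational one among them has none. For equal directions the tie-breaking rule excludes the
  case.\<close>

lemma step_mono:
  assumes "0 < s" "t < 1" "before s \<sigma> t \<tau>"
  shows "fst (st s \<sigma> z) \<le> fst (st t \<tau> z)"
proof (rule ccontr)
  assume "\<not> ?thesis"
  then have 1: "st s \<sigma> z = z + e1" "st t \<tau> z = z + e2"
    using up_right_stepD[OF st, of s \<sigma> z] up_right_stepD[OF st, of t \<tau> z] by auto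
  have a: "b (dir_of s) \<sigma> z (z + e1) < b (dir_of s) \<sigma> z (z + e2) \<or>
      b (dir_of s) \<sigma> z (z + e1) = b (dir_of s) \<sigma> z (z + e2) \<and> \<sigma> = Plus"
    using 1(1) by (cases \<sigma>) (auto simp: busemann_step_def split: if_splits)
  have c: "b (dir_of t) \<tau> z (z + e1) > b (dir_of t) \<tau> z (z + e2) \<or>
      b (dir_of t) \<tau> z (z + e1) = b (dir_of t) \<tau> z (z + e2) \<and> \<tau> = Minus"
    using 1(2) by (cases \<tau>) (auto simp: busemann_step_def split: if_splits)
  note mono = mono_e1[OF assms, of z] mono_e2[OF assms, of z]
  have eq: "b (dir_of s) \<sigma> z (z + e1) = b (dir_of s) \<sigma> z (z + e2)" "\<sigma> = Plus"
    "b (dir_of t) \<tau> z (z + e1) = b (dir_of t) \<tau> z (z + e2)" "\<tau> = Minus"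
    "b (dir_of s) \<sigma> z (z + e1) = b (dir_of t) \<tau> z (z + e1)"
    using a c mono by auto
  then have "s < t" using assms(3) by (auto simp: before_def)
  then obtain q where q: "q \<in> \<rat>" "s < q" "q < t" using Rats_dense_in_real by blast
  have "b (dir_of q) Plus z (z + e1) = b (dir_of q) Plus z (z + e2)"
    using mono_e1[of s q \<sigma> Plus z] mono_e1[of q t Plus \<tau> z]
      mono_e2[of s q \<sigma> Plus z] mono_e2[of q t Plus \<tau> z] eq q assms by (auto simp: before_def)
  then show False using no_ties[of q z] q assms by auto
qed

text \<open>A strict preference for \<open>e1\<close> survives nearby by convergence. Otherwise the
  \<open>Minus\<close> rule takes \<open>e2\<close>, and monotonicity gives the same weak preference
  to the left of \<open>t\<close>, which is strict at rational directions because they have no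
  ties.\<close>

lemma step_eventually_left:
  assumes "0 < t" "t < 1"
  shows "\<forall>\<^sub>F s in at_left t. s \<in> \<rat> \<longrightarrow> st s Plus z = st t Minus z"
proof -
  let ?b = "\<lambda>s \<sigma> e. b (dir_of s) \<sigma> z (z + e)"
  have pos: "\<forall>\<^sub>F s in at_left t. 0 < s \<and> s < t"
    using assms(1) by (auto simp: eventually_at_left[of 0])
  show ?thesis
  proof (cases "?b t Minus e1 < ?b t Minus e2")
    case True
    have "((\<lambda>s. ?b s Plus e2 - ?b s Plus e1) \<longlongrightarrow> ?b t Minus e2 - ?b t Minus e1) (at_left t)"
      by (intro tendsto_diff lim_left assms)
    then have "\<forall>\<^sub>F s in at_left t. ?b s Plus e2 - ?b s Plus e1 > 0"
      using True by (intro order_tendstoD) auto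
    then show ?thesis by eventually_elim (use True in \<open>auto simp: busemann_step_def\<close>)
  next
    case False
    from pos show ?thesis
    proof eventually_elim
      case (elim s)
      show ?case
      proof
        assume "s \<in> \<rat>"
        moreover have "?b s Plus e1 \<ge> ?b s Plus e2"
          using mono_e1[of s t Plus Minus z] mono_e2[of s t Plus Minus z] False elim assms
          by (auto simp: before_def)
        ultimately have "?b s Plus e1 > ?b s Plus e2" using no_ties[of s z] elim assms by auto
        then show "st s Plus z = st t Minus z" using False by (auto simp: busemann_step_def)
      qed
    qed
  qed
qed

lemma step_eventually_right:
  assumes "0 < t" "t < 1"
  shows "\<forall>\<^sub>F s in at_right t. s \<in> \<rat> \<longrightarrow> st s Plus z = st t Plus z"
proof -
  let ?b = "\<lambda>s \<sigma> e. b (dir_of s) \<sigma> z (z + e)"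
  have pos: "\<forall>\<^sub>F s in at_right t. t < s \<and> s < 1"
    using assms(2) by (auto simp: eventually_at_right[of _ 1])
  show ?thesis
  proof (cases "?b t Plus e1 > ?b t Plus e2")
    case True
    have "((\<lambda>s. ?b s Plus e1 - ?b s Plus e2) \<longlongrightarrow> ?b t Plus e1 - ?b t Plus e2) (at_right t)"
      by (intro tendsto_diff lim_right assms)
    then have "\<forall>\<^sub>F s in at_right t. ?b s Plus e1 - ?b s Plus e2 > 0"
      using True by (intro order_tendstoD) auto
    then show ?thesis by eventually_elim (use True in \<open>auto simp: busemann_step_def\<close>)
  next
    case False
    from pos show ?thesis
    proof eventually_elim
      case (elim s)
      show ?case
      proof
        assume "s \<in> \<rat>"
        moreover have "?b s Plus e1 \<le> ?b s Plus e2"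
          using mono_e1[of t s Plus Plus z] mono_e2[of t s Plus Plus z] False elim assms
          by (auto simp: before_def)
        ultimately have "?b s Plus e1 < ?b s Plus e2" using no_ties[of s z] elim assms by auto
        then show "st s Plus z = st t Plus z" using False by (auto simp: busemann_step_def)
      qed
    qed
  qed
qed

text \<open>Up to level \<open>k\<close> only the finitely many sites on the limiting line matter,
  so agreement near \<open>t\<close> for each single site is enough; it is not uniform over
  sites.\<close>

lemma flow_eventually:
  assumes step: "\<And>z. \<forall>\<^sub>F s in F. s \<in> \<rat> \<longrightarrow> st s Plus z = st t \<sigma> z" and k: "level x \<le> k"
  shows "\<forall>\<^sub>F s in F. s \<in> \<rat> \<longrightarrow> flow (st s Plus) x k = flow (st t \<sigma>) x k"
  using k
proof (induction k rule: int_ge_induct)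
  case (step k)
  from step.IH assms(1)[of "flow (st t \<sigma>) x k"] show ?case
    by eventually_elim (use step in \<open>auto simp: flow_Suc\<close>)
qed simp

lemma rational_left:
  fixes t :: real
  assumes "0 < t" "t < 1" "\<forall>\<^sub>F s in at_left t. s \<in> \<rat> \<longrightarrow> P s"
  obtains q where "q \<in> \<rat>" "0 < q" "q < t" "P q"
proof -
  obtain r where r: "r < t" "\<And>s. r < s \<Longrightarrow> s < t \<Longrightarrow> s \<in> \<rat> \<longrightarrow> P s"
    using assms by (auto simp: eventually_at_left[of 0 t])
  then obtain q where "q \<in> \<rat>" "max 0 r < q" "q < t"
    using Rats_dense_in_real[of "max 0 r" t] assms by auto
  then show ?thesis using r that by auto
qed

lemma rational_right:
  fixes t :: real
  assumes "0 < t" "t < 1" "\<forall>\<^sub>F s in at_right t. s \<in> \<rat> \<longrightarrow> P s"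
  obtains q where "q \<in> \<rat>" "t < q" "q < 1" "P q"
proof -
  obtain r where r: "t < r" "\<And>s. t < s \<Longrightarrow> s < r \<Longrightarrow> s \<in> \<rat> \<longrightarrow> P s"
    using assms by (auto simp: eventually_at_right[of t 1])
  then obtain q where "q \<in> \<rat>" "t < q" "q < min 1 r"
    using Rats_dense_in_real[of t "min 1 r"] assms by auto
  then show ?thesis using r that by auto
qed

lemma flow_weight:
  assumes "0 < t" "t < 1" "level x \<le> k"
  shows "b (dir_of t) \<sigma> x (flow (st t \<sigma>) x k) = (\<Sum>i\<in>{level x..<k}. w (flow (st t \<sigma>) x i))"
  using assms(3)
proof (induction k rule: int_ge_induct)
  case base
  show ?case using cocycle[OF assms(1,2), of \<sigma> x x x] by simp
next
  case (step k)
  have "{level x..<k + 1} = insert k {level x..<k}" using step by auto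
  then show ?case
    using step cocycle[OF assms(1,2), of \<sigma> x "flow (st t \<sigma>) x k" "flow (st t \<sigma>) x (k + 1)"]
      step_weight[OF assms(1,2), of \<sigma> "flow (st t \<sigma>) x k"]
    by (simp add: flow_Suc)
qed

text \<open>Recovery bounds the weight at a site by both increments of \<open>b\<close> there, and
  the cocycle property telescopes these bounds. Busemann steps attain equality, which makes Busemann
  geodesics maximizers.\<close>

lemma path_weight_le:
  assumes "0 < t" "t < 1" "path_between x y \<pi>"
  shows "path_weight w x y \<pi> \<le> b (dir_of t) \<sigma> x y"
proof -
  have "(\<Sum>i\<in>{level x..<k}. w (\<pi> i)) \<le> b (dir_of t) \<sigma> x (\<pi> k)"
    if "level x \<le> k" "k \<le> level y" for k
    using that
  proof (induction k rule: int_ge_induct)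
    case base
    show ?case using assms cocycle[OF assms(1,2), of \<sigma> x x x] by (simp add: path_between_def)
  next
    case (step k)
    have "\<pi> (k + 1) - \<pi> k \<in> {e1, e2}" using assms(3) step by (auto simp: path_between_def)
    then have "\<pi> (k + 1) = \<pi> k + e1 \<or> \<pi> (k + 1) = \<pi> k + e2"
      by (metis add.commute diff_add_cancel insert_iff singletonD)
    then have "w (\<pi> k) \<le> b (dir_of t) \<sigma> (\<pi> k) (\<pi> (k + 1))"
      using recovery[OF assms(1,2), of \<sigma> "\<pi> k"] by (auto simp: min_def split: if_splits)
    moreover have "{level x..<k + 1} = insert k {level x..<k}" using step by auto
    ultimately show ?case
      using step cocycle[OF assms(1,2), of \<sigma> x "\<pi> k" "\<pi> (k + 1)"] by simp
  qed
  from this[of "level y"] assms(3) show ?thesis by (simp add: path_between_def path_weight_def)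
qed

lemma lpp_flow:
  assumes "0 < t" "t < 1" "level x \<le> k"
  shows "lpp w x (flow (st t \<sigma>) x k) = b (dir_of t) \<sigma> x (flow (st t \<sigma>) x k)"
    and "geodesic_between w x (flow (st t \<sigma>) x k) (flow (st t \<sigma>) x)"
proof -
  let ?y = "flow (st t \<sigma>) x k"
  have p: "path_between x ?y (flow (st t \<sigma>) x)" using path_between_flow assms(3) by auto
  have pw: "path_weight w x ?y (flow (st t \<sigma>) x) = b (dir_of t) \<sigma> x ?y"
    using flow_weight[OF assms, of \<sigma>] level_flow[OF st assms(3)] by (simp add: path_weight_def)
  show 1: "lpp w x ?y = b (dir_of t) \<sigma> x ?y"
    unfolding lpp_def
  proof (rule Max_eqI[OF finite_path_weights])
    show "v \<le> b (dir_of t) \<sigma> x ?y" if "v \<in> path_weight w x ?y ` {\<pi>. path_between x ?y \<pi>}" for v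
      using that path_weight_le[OF assms(1,2), of x ?y _ \<sigma>] by blast
    show "b (dir_of t) \<sigma> x ?y \<in> path_weight w x ?y ` {\<pi>. path_between x ?y \<pi>}"
      using pw p by (metis image_eqI mem_Collect_eq)
  qed
  show "geodesic_between w x ?y (flow (st t \<sigma>) x)"
    unfolding geodesic_between_def using p pw 1 by simp
qed

lemma geodesic_from_flow:
  assumes "0 < t" "t < 1"
  shows "geodesic_from w x (flow (st t \<sigma>) x)"
proof -
  let ?f = "flow (st t \<sigma>) x"
  have "?f (k + 1) - ?f k \<in> {e1, e2}" if "level x \<le> k" for k
    using path_between_flow[OF st, of x "k + 1" t \<sigma>] that level_flow[OF st, of x "k + 1" t \<sigma>]
    by (auto simp: path_between_def)
  moreover have "geodesic_between w (?f k) (?f l) ?f" if kl: "level x \<le> k" "k \<le> l" for k l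
  proof -
    have lev: "level (?f k) = k" "level (?f l) = l" using kl level_flow[OF st] by auto
    have g: "geodesic_between w (?f k) (flow (st t \<sigma>) (?f k) l) (flow (st t \<sigma>) (?f k))"
      using lpp_flow(2)[OF assms, of "?f k" l \<sigma>] lev kl by simp
    have eq: "flow (st t \<sigma>) (?f k) i = ?f i" if "k \<le> i" for i
      using flow_flow[OF st kl(1) that] .
    have "path_between (?f k) (?f l) ?f"
      using g eq kl lev by (auto simp: geodesic_between_def path_between_def)
    moreover have "path_weight w (?f k) (?f l) ?f = path_weight w (?f k) (?f l) (flow (st t \<sigma>) (?f k))"
      unfolding path_weight_def using eq lev by (intro sum.cong) auto
    ultimately show ?thesis using g eq kl by (auto simp: geodesic_between_def)
  qed
  ultimately show ?thesis by (auto simp: geodesic_from_def path_from_def)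
qed

lemma crossed_meetings_imp_locally_constant:
  assumes t: "0 < t" "t < 1"
    and k: "level x \<le> k" "level y \<le> k" "flow (st t Minus) x k = flow (st t Plus) y k"
    and l: "level x \<le> l" "level y \<le> l" "flow (st t Plus) x l = flow (st t Minus) y l"
  shows "\<exists>s u c. 0 < s \<and> s < t \<and> t < u \<and> u < 1 \<and>
    (\<forall>r \<sigma>. s < r \<longrightarrow> r < u \<longrightarrow> b (dir_of r) \<sigma> x y = c)"
proof -
  have "fst (st t Minus z) \<le> fst (st t Plus z)" for z
    by (rule step_mono[OF t]) (simp add: before_def)
  from flow_four_meet[OF st st this k l] obtain n m where n: "level x \<le> n" "level y \<le> n"
    and m: "flow (st t Minus) x n = m" "flow (st t Plus) x n = m"
      "flow (st t Minus) y n = m" "flow (st t Plus) y n = m" by blast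
  have "\<forall>\<^sub>F s in at_left t. s \<in> \<rat> \<longrightarrow>
      flow (st s Plus) x n = m \<and> flow (st s Plus) y n = m"
    using flow_eventually[OF step_eventually_left[OF t] n(1)]
      flow_eventually[OF step_eventually_left[OF t] n(2)] by eventually_elim (use m in auto)
  then obtain s where s: "s \<in> \<rat>" "0 < s" "s < t" "flow (st s Plus) x n = m" "flow (st s Plus) y n = m"
    by (rule rational_left[OF t]) blast
  have "\<forall>\<^sub>F s in at_right t. s \<in> \<rat> \<longrightarrow>
      flow (st s Plus) x n = m \<and> flow (st s Plus) y n = m"
    using flow_eventually[OF step_eventually_right[OF t] n(1)]
      flow_eventually[OF step_eventually_right[OF t] n(2)] by eventually_elim (use m in auto)
  then obtain u where u: "u \<in> \<rat>" "t < u" "u < 1" "flow (st u Plus) x n = m" "flow (st u Plus) y n = m"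
    by (rule rational_right[OF t]) blast
  have lm: "level m = n" using level_flow[OF st n(1)] m by blast
  \<comment> \<open>The rational lines on either side of \<open>r\<close> pass through
    \<open>m\<close> at level \<open>n\<close> and enclose the line of \<open>r\<close>. Hence
    \<open>b\<close> up to \<open>m\<close> is a passage time, and passage times do not involve
    \<open>r\<close>.\<close>
  have "b (dir_of r) \<sigma> x y = lpp w x m - lpp w y m" if r: "s < r" "r < u" for r \<sigma>
  proof -
    have r01: "0 < r" "r < 1" using r s u by auto
    have "flow (st r \<sigma>) z n = m" if "level z \<le> n" "flow (st s Plus) z n = m" "flow (st u Plus) z n = m" for z
    proof -
      have "fst (flow (st s Plus) z n) \<le> fst (flow (st r \<sigma>) z n)"
        using r s r01 that by (intro flow_mono_start step_mono st) (auto simp: before_def)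
      moreover have "fst (flow (st r \<sigma>) z n) \<le> fst (flow (st u Plus) z n)"
        using r u r01 that by (intro flow_mono_start step_mono st) (auto simp: before_def)
      ultimately show ?thesis using that lm by (intro flow_pinch[of _ "st u Plus" z n z]) auto
    qed
    then have "flow (st r \<sigma>) x n = m" "flow (st r \<sigma>) y n = m" using n s u by auto
    then have "lpp w x m = b (dir_of r) \<sigma> x m" "lpp w y m = b (dir_of r) \<sigma> y m"
      using lpp_flow(1)[OF r01, of _ n \<sigma>] n by metis+
    then show ?thesis using cocycle[OF r01, of \<sigma> x y m] by simp
  qed
  then have "\<forall>r \<sigma>. s < r \<longrightarrow> r < u \<longrightarrow> b (dir_of r) \<sigma> x y = lpp w x m - lpp w y m"
    by blast
  then show ?thesis using s(2,3) u(2,3) by blast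
qed

lemma flow_multiset_level:
  assumes "up_right_step s" "level x \<le> k"  "k < L"
  shows "filter_mset (\<lambda>v. level v = k) (image_mset (flow s x) (mset_set {level x..<L})) = {#flow s x k#}"
proof -
  have "{i \<in> {level x..<L}. level (flow s x i) = k} = {k}"
    using assms(2,3) by (auto simp: level_flow[OF assms(1)])
  then show ?thesis by (simp add: filter_mset_image_mset filter_mset_mset_set comp_def)
qed

lemma constant_imp_crossed_meetings:
  assumes coal: "\<And>q x y. q \<in> {s, u} \<Longrightarrow>
      \<exists>k. level x \<le> k \<and> level y \<le> k \<and> flow (st q Plus) x k = flow (st q Plus) y k"
    and su: "0 < s" "s < t" "t < u" "u < 1"
    and const: "b (dir_of s) Plus x y = b (dir_of u) Plus x y"
  shows "\<exists>n. level x \<le> n \<and> level y \<le> n \<and> flow (st t Minus) x n = flow (st t Plus) y n \<and>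
      flow (st t Plus) x n = flow (st t Minus) y n"
proof -
  have main: "\<exists>n. level x \<le> n \<and> level y \<le> n \<and> flow (st t Minus) x n = flow (st t Plus) y n \<and>
      flow (st t Plus) x n = flow (st t Minus) y n"
    if const: "b (dir_of s) Plus x y = b (dir_of u) Plus x y" and xy: "level x \<le> level y" for x y
  proof -
    let ?s = "st s Plus" and ?u = "st u Plus"
    have le: "fst (?s z) \<le> fst (?u z)" for z
      using su by (intro step_mono) (auto simp: before_def)
    obtain k where k: "level x \<le> k" "level y \<le> k" "flow ?s x k = flow ?s y k"
      using coal[of s] by blast
    obtain l where l: "level x \<le> l" "level y \<le> l" "flow ?u x l = flow ?u y l"
      using coal[of u] by blast
    define N where "N = max k l"
    \<comment> \<open>The weight sums omit their last level, so \<open>L\<close> is placed one level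
      above the meeting level \<open>N\<close>; the multisets then include the sites at level
      \<open>N\<close>.\<close>
    define L where "L = N + 1"
    have N: "level x \<le> N" "level y \<le> N" "flow ?s x N = flow ?s y N" "flow ?u x N = flow ?u y N"
      using k l flow_meet[OF st k(1,2) _ k(3), of N] flow_meet[OF st l(1,2) _ l(3), of N] by (auto simp: N_def)
    have L: "level x \<le> L" "level y \<le> L" "flow ?s x L = flow ?s y L" "flow ?u x L = flow ?u y L"
      using N by (auto simp: L_def flow_Suc)
    let ?A = "\<lambda>f z. image_mset (flow f z) (mset_set {level z..<L})"
    have wsum: "(\<Sum>v\<in>#?A (st q Plus) z. w v) = b (dir_of q) Plus z (flow (st q Plus) z L)"
      if "0 < q" "q < 1" "level z \<le> L" for q z
      using flow_weight[OF that, of Plus] by (simp add: sum_unfold_sum_mset image_mset.compositionality comp_def)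
    have bq: "b (dir_of q) Plus x y = (\<Sum>v\<in>#?A (st q Plus) x. w v) - (\<Sum>v\<in>#?A (st q Plus) y. w v)"
      if "0 < q" "q < 1" "q \<in> {s, u}" for q
    proof -
      have "flow (st q Plus) x L = flow (st q Plus) y L" using L that(3) by auto
      then show ?thesis
        using wsum[OF that(1,2) L(1)] wsum[OF that(1,2) L(2)]
          cocycle[OF that(1,2), of Plus x y "flow (st q Plus) y L"] by simp
    qed
    \<comment> \<open>Moving the negative terms of the two equal differences across leaves plain
      sums, the form to which \<open>generic\<close> applies.\<close>
    then have "(\<Sum>v\<in>#?A ?s x + ?A ?u y. w v) = (\<Sum>v\<in>#?A ?u x + ?A ?s y. w v)"
      using const su bq[of s] bq[of u] by simp
    then have A: "?A ?s x + ?A ?u y = ?A ?u x + ?A ?s y" by (rule generic)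
    have ms: "{#flow ?s x k, flow ?u y k#} = {#flow ?u x k, flow ?s y k#}" if "level y \<le> k" "k \<le> N" for k
    proof -
      have "filter_mset (\<lambda>v. level v = k) (?A ?s x + ?A ?u y) = filter_mset (\<lambda>v. level v = k) (?A ?u x + ?A ?s y)"
        using A by simp
      then show ?thesis
        using that xy by (simp add: flow_multiset_level[OF st] L_def add_mset_commute)
    qed
    \<comment> \<open>Both lines from \<open>y\<close> start at \<open>y\<close>; cancelling this
      site identifies the two lines from \<open>x\<close>.\<close>
    have low: "flow ?s x (level y) = flow ?u x (level y)"
      using ms[of "level y"] N by (auto simp: add_eq_conv_ex add_mset_eq_single)
    obtain n m where n: "level x \<le> n" "level y \<le> n" and
      m: "flow ?s x n = m" "flow ?u x n = m" "flow ?s y n = m" "flow ?u y n = m"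
      using flow_four_meet_of_multisets[OF st st le xy low ms N(2-4)] by blast
    have lm: "level m = n" using level_flow[OF st n(1)] m by blast
    have meet: "flow (st t \<sigma>) z n = m" if "level z \<le> n" "flow ?s z n = m" "flow ?u z n = m" for z \<sigma>
    proof -
      have "fst (flow ?s z n) \<le> fst (flow (st t \<sigma>) z n)"
        using su that by (intro flow_mono_start step_mono st) (auto simp: before_def)
      moreover have "fst (flow (st t \<sigma>) z n) \<le> fst (flow ?u z n)"
        using su that by (intro flow_mono_start step_mono st) (auto simp: before_def)
      ultimately show ?thesis using that lm by (intro flow_pinch[of _ "st u Plus" z n z]) auto
    qed
    show ?thesis
      using n meet[OF n(1) m(1,2)] meet[OF n(2) m(3,4)] by (intro exI[of _ n]) simp
  qed
  show ?thesis
  proof (cases "level x \<le> level y")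
    case True
    then show ?thesis using main const by blast
  next
    case False
    have "b (dir_of q) Plus y x = - b (dir_of q) Plus x y" if "0 < q" "q < 1" for q
      using cocycle[OF that, of Plus x y x] cocycle[OF that, of Plus x x x] by simp
    then have "b (dir_of s) Plus y x = b (dir_of u) Plus y x" using const su by simp
    then show ?thesis using main[of y x] False by fastforce
  qed
qed

end

section \<open>Support and crossed meetings\<close>

text \<open>A distribution function recorded with both one-sided values: along either sign, its
  limits at \<open>t\<close> from the left and from the right are \<open>F t Minus\<close> and
  \<open>F t Plus\<close>.\<close>

definition monotone_process :: "(real \<Rightarrow> sign \<Rightarrow> real) \<Rightarrow> bool" where
  "monotone_process F \<longleftrightarrow>
    (\<forall>s \<sigma> t \<tau>. 0 < s \<longrightarrow> t < 1 \<longrightarrow> before s \<sigma> t \<tau> \<longrightarrow> F s \<sigma> \<le> F t \<tau>) \<and>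
    (\<forall>t \<sigma>. 0 < t \<longrightarrow> t < 1 \<longrightarrow> ((\<lambda>s. F s \<sigma>) \<longlongrightarrow> F t Minus) (at_left t)) \<and>
    (\<forall>t \<sigma>. 0 < t \<longrightarrow> t < 1 \<longrightarrow> ((\<lambda>s. F s \<sigma>) \<longlongrightarrow> F t Plus) (at_right t))"

lemma monotone_process_0: "monotone_process (\<lambda>_ _. 0)"
  by (simp add: monotone_process_def)

lemma monotone_process_add:
  "monotone_process F \<Longrightarrow> monotone_process G \<Longrightarrow> monotone_process (\<lambda>t \<sigma>. F t \<sigma> + G t \<sigma>)"
  unfolding monotone_process_def by (auto intro!: tendsto_add add_mono)

text \<open>The jump at the left end \<open>s\<close> is kept: \<open>F s Minus\<close> is the value of the distribution
  function to the left of \<open>s\<close>.\<close>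

lemma monotone_process_measure:
  assumes F: "monotone_process F" and st: "0 < s" "s < t" "t < 1"
  obtains N :: "real measure" where "sets N = sets borel" "emeasure N {s..t} < \<infinity>"
    "\<And>a c. s \<le> a \<Longrightarrow> a < c \<Longrightarrow> c \<le> t \<Longrightarrow> measure N {a<..c} = F c Plus - F a Plus"
    "\<And>a c. s \<le> a \<Longrightarrow> a < c \<Longrightarrow> c \<le> t \<Longrightarrow> measure N {a..<c} = F c Minus - F a Minus"
proof -
  define G where "G r = (if r < s then F s Minus else if r \<le> t then F r Plus else F t Plus)" for r
  have Fmono: "F a \<sigma> \<le> F c \<tau>" if "0 < a" "c < 1" "before a \<sigma> c \<tau>" for a \<sigma> c \<tau>
    using F that unfolding monotone_process_def by blast
  have mono: "G a \<le> G c" if "a \<le> c" for a c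
  proof -
    have *: "F s Minus \<le> F r Plus" "F r Plus \<le> F t Plus" if "s \<le> r" "r \<le> t" for r
      using that st Fmono[of s r Minus Plus] Fmono[of r t Plus Plus] by (auto simp: before_def le_less)
    have "F a Plus \<le> F c Plus" if "s \<le> a" "c \<le> t"
      using that \<open>a \<le> c\<close> st Fmono[of a c Plus Plus] by (auto simp: before_def le_less)
    then show ?thesis
      using \<open>a \<le> c\<close> st *(1)[of c] *(2)[of a] *(1)[of t] unfolding G_def by (smt (verit))
  qed
  have right: "continuous (at_right a) G" for a
    unfolding continuous_within
  proof -
    consider "a < s" | "s \<le> a" "a < t" | "t \<le> a" by linarith
    then show "(G \<longlongrightarrow> G a) (at_right a)"
    proof cases
      case 1
      have "\<forall>\<^sub>F r in at_right a. G r = G a"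
        unfolding eventually_at_right[OF 1] using 1 by (intro exI[of _ s]) (auto simp: G_def)
      then show ?thesis by (simp add: tendsto_eventually)
    next
      case 2
      have "\<forall>\<^sub>F r in at_right a. F r Plus = G r"
        unfolding eventually_at_right[OF 2(2)] using 2 by (intro exI[of _ t]) (auto simp: G_def)
      moreover have "((\<lambda>r. F r Plus) \<longlongrightarrow> F a Plus) (at_right a)"
        using F 2 st unfolding monotone_process_def by auto
      ultimately show ?thesis using 2 by (auto simp: G_def intro: Lim_transform_eventually)
    next
      case 3
      have "\<forall>\<^sub>F r in at_right a. G r = G a"
        using st 3 by (auto simp: G_def eventually_at_right[of a "a + 1"] intro!: exI[of _ "a + 1"])
      then show ?thesis by (simp add: tendsto_eventually)
    qed
  qed
  define N where "N = interval_measure G"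
  have setsN: "sets N = sets borel" by (simp add: N_def)
  have Ioc: "emeasure N {a<..c} = ennreal (G c - G a)" if "a \<le> c" for a c
    unfolding N_def using that mono right by (intro emeasure_interval_measure_Ioc) auto
  have mIoc: "measure N {a<..c} = G c - G a" if "a \<le> c" for a c
    using Ioc[OF that] mono[OF that] by (simp add: measure_def)
  have fin: "emeasure N A < \<infinity>" if "A \<subseteq> {s..t}" for A
  proof -
    have "emeasure N A \<le> emeasure N {s-1<..t}" using that setsN by (intro emeasure_mono) auto
    also have "\<dots> < \<infinity>" using Ioc[of "s-1" t] st by simp
    finally show ?thesis .
  qed
  have left: "((\<lambda>r. G r) \<longlongrightarrow> F a Minus) (at_left a)" if "s \<le> a" "a \<le> t" for a
  proof (cases "a = s")
    case True
    have "\<forall>\<^sub>F r in at_left a. G r = F a Minus"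
      using True by (auto simp: G_def eventually_at_left[of "s - 1"] intro!: exI[of _ "s - 1"])
    then show ?thesis by (simp add: tendsto_eventually)
  next
    case False
    then have "s < a" using that by simp
    have "\<forall>\<^sub>F r in at_left a. F r Plus = G r"
      unfolding eventually_at_left[OF \<open>s < a\<close>] using \<open>s < a\<close> that by (intro exI[of _ s]) (auto simp: G_def)
    moreover have "((\<lambda>r. F r Plus) \<longlongrightarrow> F a Minus) (at_left a)"
      using F st that unfolding monotone_process_def by auto
    ultimately show ?thesis by (auto intro: Lim_transform_eventually)
  qed
  have pt: "measure N {a} = G a - F a Minus" if a: "s \<le> a" "a \<le> t" for a
  proof -
    \<comment> \<open>The atom at \<open>a\<close> is the limit of the masses of
      \<open>{v n<..a}\<close> as \<open>v n\<close> increases to \<open>a\<close>.\<close>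
    define v where "v n = a - inverse (real (Suc n))" for n
    have "v \<longlonglongrightarrow> a - 0" unfolding v_def by (intro tendsto_diff tendsto_const LIMSEQ_inverse_real_of_nat)
    then have "filterlim v (at_left a) sequentially"
      by (auto simp: filterlim_at v_def eventually_sequentially)
    then have "(\<lambda>n. G (v n)) \<longlonglongrightarrow> F a Minus" using left[OF a] filterlim_compose by blast
    then have "(\<lambda>n. G a - G (v n)) \<longlonglongrightarrow> G a - F a Minus" by (intro tendsto_diff tendsto_const)
    moreover have "measure N {v n<..a} = G a - G (v n)" for n
      by (rule mIoc) (simp add: v_def)
    ultimately have "(\<lambda>n. measure N {v n<..a}) \<longlonglongrightarrow> G a - F a Minus" by simp
    moreover have "(\<lambda>n. measure N {v n<..a}) \<longlonglongrightarrow> measure N (\<Inter>n. {v n<..a})"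
    proof (rule Lim_measure_decseq)
      show "range (\<lambda>n. {v n<..a}) \<subseteq> sets N"
        unfolding setsN image_subset_iff by (intro ballI greaterThanAtMost_borel)
      show "decseq (\<lambda>n. {v n<..a})"
        unfolding decseq_def
      proof (intro allI impI)
        fix m n :: nat assume "m \<le> n"
        then have "v m \<le> v n" unfolding v_def by (simp add: le_imp_inverse_le)
        then show "{v n<..a} \<subseteq> {v m<..a}" by auto
      qed
      show "emeasure N {v n<..a} \<noteq> \<infinity>" for n using Ioc[of "v n" a] by (simp add: v_def)
    qed
    moreover have "(\<Inter>n. {v n<..a}) = {a}"
    proof -
      have "x = a" if "\<And>n. v n < x" "x \<le> a" for x
      proof -
        have "a \<le> x" using \<open>v \<longlonglongrightarrow> a - 0\<close> that by (intro LIMSEQ_le_const2[of v]) (auto intro: less_imp_le)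
        then show ?thesis using that by simp
      qed
      then show ?thesis by (auto simp: v_def)
    qed
    ultimately show ?thesis using LIMSEQ_unique by metis
  qed
  have "measure N {a<..c} = F c Plus - F a Plus" if "s \<le> a" "a < c" "c \<le> t" for a c
    using mIoc[of a c] that by (simp add: G_def)
  moreover have "measure N {a..<c} = F c Minus - F a Minus" if ac: "s \<le> a" "a < c" "c \<le> t" for a c
  proof -
    have *: "emeasure N A \<noteq> \<infinity>" if "A \<subseteq> {s..t}" for A using fin[OF that] by simp
    \<comment> \<open>\<open>{a..<c}\<close> arises from \<open>{a<..c}\<close> by exchanging the
      atom at \<open>c\<close> for the atom at \<open>a\<close>.\<close>
    have "measure N ({a} \<union> {a<..c}) = measure N {a} + measure N {a<..c}"
      using ac setsN by (intro measure_Union *) auto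
    moreover have "measure N ({c} \<union> {a..<c}) = measure N {c} + measure N {a..<c}"
      using ac setsN by (intro measure_Union *) auto
    moreover have "{a} \<union> {a<..c} = {c} \<union> {a..<c}" using ac by auto
    ultimately show ?thesis using pt[of a] pt[of c] mIoc[of a c] ac by simp
  qed
  ultimately show ?thesis using that setsN fin[of "{s..t}"] by blast
qed

section \<open>Bounded variation in the direction; existence and uniqueness of the Busemann
  measures\<close>

context busemann_realization
begin

text \<open>Only the increments along edges are monotone in the direction, with opposite signs for
  \<open>e1\<close> and \<open>e2\<close>. Differences of monotone processes are stable under the
  cocycle sum and under exchanging the sites, so a lattice path carries the property to every
  pair.\<close>

definition bounded_variation_between :: "site \<Rightarrow> site \<Rightarrow> bool" where
  "bounded_variation_between x y \<longleftrightarrow> (\<exists>F G. monotone_process F \<and> monotone_process G \<and>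
    (\<forall>t \<sigma>. 0 < t \<longrightarrow> t < 1 \<longrightarrow> b (dir_of t) \<sigma> x y = F t \<sigma> - G t \<sigma>))"

lemma b_refl: "0 < t \<Longrightarrow> t < 1 \<Longrightarrow> b (dir_of t) \<sigma> x x = 0"
  using cocycle[of t \<sigma> x x x] by simp

lemma b_swap: "0 < t \<Longrightarrow> t < 1 \<Longrightarrow> b (dir_of t) \<sigma> y x = - b (dir_of t) \<sigma> x y"
  using cocycle[of t \<sigma> x y x] b_refl[of t \<sigma> x] by simp

lemma bounded_variation_trans:
  assumes "bounded_variation_between x y" "bounded_variation_between y z"
  shows "bounded_variation_between x z"
proof -
  obtain F G where 1: "monotone_process F" "monotone_process G"
    "\<forall>t \<sigma>. 0 < t \<longrightarrow> t < 1 \<longrightarrow> b (dir_of t) \<sigma> x y = F t \<sigma> - G t \<sigma>"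
    using assms(1) unfolding bounded_variation_between_def by blast
  obtain F' G' where 2: "monotone_process F'" "monotone_process G'"
    "\<forall>t \<sigma>. 0 < t \<longrightarrow> t < 1 \<longrightarrow> b (dir_of t) \<sigma> y z = F' t \<sigma> - G' t \<sigma>"
    using assms(2) unfolding bounded_variation_between_def by blast
  have "b (dir_of t) \<sigma> x z = (F t \<sigma> + F' t \<sigma>) - (G t \<sigma> + G' t \<sigma>)" if "0 < t" "t < 1" for t \<sigma>
    using 1(3) 2(3) cocycle[OF that, of \<sigma> x y z] that by auto
  then show ?thesis
    unfolding bounded_variation_between_def
    using monotone_process_add[OF 1(1) 2(1)] monotone_process_add[OF 1(2) 2(2)]
    by (intro exI[of _ "\<lambda>t \<sigma>. F t \<sigma> + F' t \<sigma>"] exI[of _ "\<lambda>t \<sigma>. G t \<sigma> + G' t \<sigma>"]) auto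
qed

lemma bounded_variation_swap:
  assumes "bounded_variation_between x y"
  shows "bounded_variation_between y x"
proof -
  obtain F G where 1: "monotone_process F" "monotone_process G"
    "\<forall>t \<sigma>. 0 < t \<longrightarrow> t < 1 \<longrightarrow> b (dir_of t) \<sigma> x y = F t \<sigma> - G t \<sigma>"
    using assms(1) unfolding bounded_variation_between_def by blast
  then have "b (dir_of t) \<sigma> y x = G t \<sigma> - F t \<sigma>" if "0 < t" "t < 1" for t \<sigma>
    using b_swap[OF that, of \<sigma> y x] that by auto
  then show ?thesis unfolding bounded_variation_between_def using 1(1,2) by blast
qed

lemma bounded_variation_e1: "bounded_variation_between x (x + e1)"
proof -
  have "monotone_process (\<lambda>t \<sigma>. - b (dir_of t) \<sigma> x (x + e1))"
    unfolding monotone_process_def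
    by (intro conjI allI impI tendsto_minus lim_left lim_right le_imp_neg_le mono_e1)
  then show ?thesis unfolding bounded_variation_between_def
    by (intro exI[of _ "\<lambda>_ _. 0"] exI[of _ "\<lambda>t \<sigma>. - b (dir_of t) \<sigma> x (x + e1)"])
      (simp add: monotone_process_0)
qed

lemma bounded_variation_e2: "bounded_variation_between x (x + e2)"
proof -
  have "monotone_process (\<lambda>t \<sigma>. b (dir_of t) \<sigma> x (x + e2))"
    unfolding monotone_process_def
    by (intro conjI allI impI lim_left lim_right mono_e2)
  then show ?thesis unfolding bounded_variation_between_def
    by (intro exI[of _ "\<lambda>t \<sigma>. b (dir_of t) \<sigma> x (x + e2)"] exI[of _ "\<lambda>_ _. 0"])
      (simp add: monotone_process_0)
qed

lemma bounded_variation: "bounded_variation_between x y"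
proof -
  have refl: "bounded_variation_between x x" for x
    using bounded_variation_trans[OF bounded_variation_e1 bounded_variation_swap[OF bounded_variation_e1]] .
  have 1: "bounded_variation_between x (x + (i, 0))" for x i
  proof (induction i rule: int_induct[of _ 0])
    case base
    show ?case using refl[of x] by (simp add: zero_prod_def[symmetric])
  next
    case (step1 i)
    have eq: "x + (i, 0) + e1 = x + (i + 1, 0)" by simp
    show ?case
      using bounded_variation_trans[OF step1(2) bounded_variation_e1] by (simp only: eq)
  next
    case (step2 i)
    have eq: "x + (i - 1, 0) + e1 = x + (i, 0)" by simp
    show ?case
      using bounded_variation_trans[OF step2(2)
          bounded_variation_swap[OF bounded_variation_e1[of "x + (i - 1, 0)", unfolded eq]]] .
  qed
  have 2: "bounded_variation_between x (x + (0, i))" for x i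
  proof (induction i rule: int_induct[of _ 0])
    case base
    show ?case using refl[of x] by (simp add: zero_prod_def[symmetric])
  next
    case (step1 i)
    have eq: "x + (0, i) + e2 = x + (0, i + 1)" by simp
    show ?case
      using bounded_variation_trans[OF step1(2) bounded_variation_e2] by (simp only: eq)
  next
    case (step2 i)
    have eq: "x + (0, i - 1) + e2 = x + (0, i)" by simp
    show ?case
      using bounded_variation_trans[OF step2(2)
          bounded_variation_swap[OF bounded_variation_e2[of "x + (0, i - 1)", unfolded eq]]] .
  qed
  have "x + (fst (y - x), 0) + (0, snd (y - x)) = y" by (simp add: prod_eq_iff)
  then show ?thesis using bounded_variation_trans[OF 1 2] by metis
qed

definition increments :: "site \<Rightarrow> site \<Rightarrow> real \<Rightarrow> real \<Rightarrow> (dir set \<Rightarrow> real) \<Rightarrow> bool" where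
  "increments x y s t \<mu> \<longleftrightarrow> (\<forall>a c. s \<le> a \<longrightarrow> a < c \<longrightarrow> c \<le> t \<longrightarrow>
      \<mu> (dir_of ` {a<..c}) = b (dir_of c) Plus x y - b (dir_of a) Plus x y \<and>
      \<mu> (dir_of ` {a..<c}) = b (dir_of c) Minus x y - b (dir_of a) Minus x y)"

lemma ex_signed_measure:
  assumes st: "0 < s" "s < t" "t < 1"
  shows "\<exists>\<mu>. signed_measure (borel_on (dir_Icc (dir_of s) (dir_of t))) \<mu> \<and> increments x y s t \<mu>"
proof -
  let ?K = "borel_on (dir_Icc (dir_of s) (dir_of t))"
  note sets = sets_borel_on_dir[OF less_imp_le[OF st(1)] less_imp_le[OF st(3)]]
  obtain F G where FG: "monotone_process F" "monotone_process G"
    "\<forall>t \<sigma>. 0 < t \<longrightarrow> t < 1 \<longrightarrow> b (dir_of t) \<sigma> x y = F t \<sigma> - G t \<sigma>"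
    using bounded_variation[of x y] unfolding bounded_variation_between_def by blast
  obtain M1 where M1: "sets M1 = sets borel" "emeasure M1 {s..t} < \<infinity>"
    "\<And>a c. s \<le> a \<Longrightarrow> a < c \<Longrightarrow> c \<le> t \<Longrightarrow> measure M1 {a<..c} = F c Plus - F a Plus"
    "\<And>a c. s \<le> a \<Longrightarrow> a < c \<Longrightarrow> c \<le> t \<Longrightarrow> measure M1 {a..<c} = F c Minus - F a Minus"
    using monotone_process_measure[OF FG(1) st] by metis
  obtain M2 where M2: "sets M2 = sets borel" "emeasure M2 {s..t} < \<infinity>"
    "\<And>a c. s \<le> a \<Longrightarrow> a < c \<Longrightarrow> c \<le> t \<Longrightarrow> measure M2 {a<..c} = G c Plus - G a Plus"
    "\<And>a c. s \<le> a \<Longrightarrow> a < c \<Longrightarrow> c \<le> t \<Longrightarrow> measure M2 {a..<c} = G c Minus - G a Minus"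
    using monotone_process_measure[OF FG(2) st] by metis
  \<comment> \<open>\<open>restrict\<close> supplies the extensionality on which uniqueness of the
    signed measure rests.\<close>
  define \<mu> where "\<mu> = restrict (\<lambda>A. measure M1 {r. dir_of r \<in> A} - measure M2 {r. dir_of r \<in> A}) (sets ?K)"
  have \<mu>: "\<mu> (dir_of ` A) = measure M1 A - measure M2 A" if "A \<in> sets borel" "A \<subseteq> {s..t}" for A
  proof -
    have "{r. dir_of r \<in> dir_of ` A} = A" by auto
    moreover have "dir_of ` A \<in> sets ?K" unfolding sets(1) using that by blast
    ultimately show ?thesis by (simp add: \<mu>_def)
  qed
  have sums: "(\<lambda>i. measure N (A i)) sums measure N (\<Union>i. A i)"
    if N: "sets N = sets borel" "emeasure N {s..t} < \<infinity>" and
      A: "range A \<subseteq> {A. A \<in> sets borel \<and> A \<subseteq> {s..t}}" "disjoint_family A" for N and A :: "nat \<Rightarrow> real set"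
  proof (rule measure_UNION)
    have "emeasure N (\<Union>i. A i) \<le> emeasure N {s..t}"
      using A N by (intro emeasure_mono) auto
    then show "emeasure N (\<Union>i. A i) \<noteq> \<infinity>" using N(2) by auto
  qed (use A N in auto)
  have "signed_measure ?K \<mu>"
    unfolding signed_measure_def
  proof (intro conjI allI impI)
    show "\<mu> \<in> extensional (sets ?K)" by (simp add: \<mu>_def)
    fix A :: "nat \<Rightarrow> dir set" assume A: "range A \<subseteq> sets ?K" "disjoint_family A"
    define A' where "A' i = {r. dir_of r \<in> A i}" for i
    have "\<exists>C. C \<in> sets borel \<and> C \<subseteq> {s..t} \<and> A i = dir_of ` C" for i
    proof -
      have "A i \<in> sets ?K" using A(1) by blast
      then show ?thesis unfolding sets(1) by blast
    qed
    have A': "A' i \<in> sets borel" "A' i \<subseteq> {s..t}" "A i = dir_of ` A' i" for i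
    proof -
      obtain C where C: "C \<in> sets borel" "C \<subseteq> {s..t}" "A i = dir_of ` C"
        using \<open>\<And>i. \<exists>C. C \<in> sets borel \<and> C \<subseteq> {s..t} \<and> A i = dir_of ` C\<close> by blast
      then have "A' i = C" unfolding A'_def by auto
      then show "A' i \<in> sets borel" "A' i \<subseteq> {s..t}" "A i = dir_of ` A' i" using C by auto
    qed
    have "disjoint_family A'" using A(2) unfolding disjoint_family_on_def A'_def by blast
    moreover have "range A' \<subseteq> {A. A \<in> sets borel \<and> A \<subseteq> {s..t}}" using A' by auto
    ultimately have "(\<lambda>i. measure M1 (A' i) - measure M2 (A' i)) sums
        (measure M1 (\<Union>i. A' i) - measure M2 (\<Union>i. A' i))"
      using M1 M2 by (intro sums_diff sums) auto
    moreover have "\<mu> (A i) = measure M1 (A' i) - measure M2 (A' i)" for i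
      using A' \<mu>[of "A' i"] by metis
    moreover have "(\<Union>i. A i) = dir_of ` (\<Union>i. A' i)" using A'(3) by auto
    then have "\<mu> (\<Union>i. A i) = measure M1 (\<Union>i. A' i) - measure M2 (\<Union>i. A' i)"
      using A' \<mu>[of "\<Union>i. A' i"] by (metis (no_types, lifting) UN_least sets.countable_UN image_subset_iff)
    ultimately show "(\<lambda>i. \<mu> (A i)) sums \<mu> (\<Union>i. A i)" by simp
  qed
  moreover have "increments x y s t \<mu>"
    unfolding increments_def
  proof (intro allI impI conjI)
    fix a c assume ac: "s \<le> a" "a < c" "c \<le> t"
    then show "\<mu> (dir_of ` {a<..c}) = b (dir_of c) Plus x y - b (dir_of a) Plus x y"
      using \<mu>[of "{a<..c}"] M1(3) M2(3) FG(3) st by force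
    show "\<mu> (dir_of ` {a..<c}) = b (dir_of c) Minus x y - b (dir_of a) Minus x y"
      using \<mu>[of "{a..<c}"] M1(4) M2(4) FG(3) st ac by force
  qed
  ultimately show ?thesis by blast
qed

lemma signed_measure_unique:
  assumes st: "0 < s" "s < t" "t < 1"
    and \<mu>: "signed_measure (borel_on (dir_Icc (dir_of s) (dir_of t))) \<mu>" "increments x y s t \<mu>"
    and \<nu>: "signed_measure (borel_on (dir_Icc (dir_of s) (dir_of t))) \<nu>" "increments x y s t \<nu>"
  shows "\<mu> = \<nu>"
proof -
  let ?K = "borel_on (dir_Icc (dir_of s) (dir_of t))"
  let ?N = "\<lambda>A. \<mu> (dir_of ` A) - \<nu> (dir_of ` A)"
  have *: "interval_additive s t (\<lambda>A. \<mu> (dir_of ` A))" "interval_additive s t (\<lambda>A. \<nu> (dir_of ` A))"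
    using st by (intro signed_measure_interval_additive \<mu> \<nu>; simp)+
  have N: "interval_additive s t ?N"
    unfolding interval_additive_def
  proof (intro allI impI)
    fix A :: "nat \<Rightarrow> real set"
    assume A: "range A \<subseteq> {A. A \<in> sets borel \<and> A \<subseteq> {s..t}}" "disjoint_family A"
    show "(\<lambda>i. ?N (A i)) sums ?N (\<Union>i. A i)"
      using *[unfolded interval_additive_def] A by (intro sums_diff) blast+
  qed
  have 0: "?N A = 0" if "A \<in> sets borel" "A \<subseteq> {s..t}" for A
  proof (rule interval_additive_zero[OF N order_refl st(2) order_refl _ _ that])
    fix a c assume "s \<le> a" "a < c" "c \<le> t"
    then show "?N {a<..c} = 0" "?N {a..<c} = 0" using \<mu>(2) \<nu>(2) unfolding increments_def by simp_all
  qed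
  have "\<mu> A = \<nu> A" if "A \<in> sets ?K" for A
  proof -
    have "A \<in> (\<lambda>A. dir_of ` A) ` {A. A \<in> sets borel \<and> A \<subseteq> {s..t}}"
      using that sets_borel_on_dir(1)[of s t] st by simp
    then obtain C where "A = dir_of ` C" "C \<in> sets borel" "C \<subseteq> {s..t}" by blast
    then show ?thesis using 0[of C] by simp
  qed
  then show ?thesis using \<mu>(1) \<nu>(1) unfolding signed_measure_def by (intro extensionalityI) auto
qed

text \<open>\<open>busemann_measure\<close> is a definite description, so its defining properties
  become available only through existence together with uniqueness.\<close>

lemma busemann_measure:
  assumes st: "0 < s" "s < t" "t < 1"
  shows "signed_measure (borel_on (dir_Icc (dir_of s) (dir_of t)))
      (busemann_measure b x y (dir_Icc (dir_of s) (dir_of t)))" (is "signed_measure ?K ?\<mu>")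
    and "increments x y s t (busemann_measure b x y (dir_Icc (dir_of s) (dir_of t)))"
proof -
  let ?I = "dir_Icc (dir_of s) (dir_of t)"
  have I: "?I = dir_of ` {s..t}" using dir_Icc_dir_of[of s t] st by simp
  have eq: "(\<forall>\<zeta> \<eta>. \<zeta> \<prec> \<eta> \<and> \<zeta> \<in> ?I \<and> \<eta> \<in> ?I \<and> dir_Icc \<zeta> \<eta> \<subseteq> ?I \<longrightarrow>
      \<mu> (dir_Ioc \<zeta> \<eta>) = b \<eta> Plus x y - b \<zeta> Plus x y \<and>
      \<mu> (dir_Ico \<zeta> \<eta>) = b \<eta> Minus x y - b \<zeta> Minus x y) \<longleftrightarrow> increments x y s t \<mu>" (is "?L \<mu> \<longleftrightarrow> _") for \<mu>
  proof
    assume L: "?L \<mu>"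
    show "increments x y s t \<mu>"
      unfolding increments_def
    proof (intro allI impI)
      fix a c assume ac: "s \<le> a" "a < c" "c \<le> t"
      have "dir_of a \<prec> dir_of c" "dir_of a \<in> ?I" "dir_of c \<in> ?I" "dir_Icc (dir_of a) (dir_of c) \<subseteq> ?I"
        using ac st dir_Icc_dir_of[of a c] by (auto simp: I)
      then have "\<mu> (dir_Ioc (dir_of a) (dir_of c)) = b (dir_of c) Plus x y - b (dir_of a) Plus x y \<and>
        \<mu> (dir_Ico (dir_of a) (dir_of c)) = b (dir_of c) Minus x y - b (dir_of a) Minus x y"
        using L by blast
      then show "\<mu> (dir_of ` {a<..c}) = b (dir_of c) Plus x y - b (dir_of a) Plus x y \<and>
        \<mu> (dir_of ` {a..<c}) = b (dir_of c) Minus x y - b (dir_of a) Minus x y"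
        using dir_Ioc_dir_of[of a c] dir_Ico_dir_of[of a c] ac st by simp
    qed
  next
    assume R: "increments x y s t \<mu>"
    show "?L \<mu>"
    proof (intro allI impI)
      fix \<zeta> \<eta> assume *: "\<zeta> \<prec> \<eta> \<and> \<zeta> \<in> ?I \<and> \<eta> \<in> ?I \<and> dir_Icc \<zeta> \<eta> \<subseteq> ?I"
      then obtain a c where ac: "\<zeta> = dir_of a" "\<eta> = dir_of c" "s \<le> a" "a < c" "c \<le> t"
        unfolding I by auto
      then show "\<mu> (dir_Ioc \<zeta> \<eta>) = b \<eta> Plus x y - b \<zeta> Plus x y \<and>
        \<mu> (dir_Ico \<zeta> \<eta>) = b \<eta> Minus x y - b \<zeta> Minus x y"
        using R dir_Ioc_dir_of[of a c] dir_Ico_dir_of[of a c] st unfolding increments_def by simp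
    qed
  qed
  have "?\<mu> = (THE \<mu>. signed_measure ?K \<mu> \<and> increments x y s t \<mu>)"
    unfolding busemann_measure_def eq ..
  moreover have "\<exists>!\<mu>. signed_measure ?K \<mu> \<and> increments x y s t \<mu>"
    using ex_signed_measure[OF st, of x y] signed_measure_unique[OF st, of _ x y] by blast
  ultimately have "signed_measure ?K ?\<mu> \<and> increments x y s t ?\<mu>" by (metis (no_types, lifting) theI')
  then show "signed_measure ?K ?\<mu>" "increments x y s t ?\<mu>" by auto
qed

section \<open>The support as the set of directions where \<open>b\<close> varies\<close>

lemma not_in_support_of_locally_constant:
  assumes const: "\<And>r \<sigma>. s < r \<Longrightarrow> r < u \<Longrightarrow> b (dir_of r) \<sigma> x y = c" and t: "s < t" "t < u"
  shows "dir_of t \<notin> busemann_support b x y"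
proof
  assume "dir_of t \<in> busemann_support b x y"
  then obtain \<zeta> \<eta> where z: "\<zeta> \<in> riU" "\<eta> \<in> riU" "dir_less \<zeta> \<eta>"
    and mem: "dir_of t \<in> signed_support (borel_on (dir_Icc \<zeta> \<eta>)) (busemann_measure b x y (dir_Icc \<zeta> \<eta>))"
    unfolding busemann_support_def by auto
  obtain p q where pq: "\<zeta> = dir_of p" "\<eta> = dir_of q" "0 < p" "p < q" "q < 1"
    using z by (auto simp: riU_iff)
  define K where "K = dir_Icc (dir_of p) (dir_of q)"
  define \<mu> where "\<mu> = busemann_measure b x y K"
  note \<mu> = busemann_measure[OF pq(3-5), of x y, folded K_def, folded \<mu>_def]
  have K: "K = dir_of ` {p..q}" unfolding K_def using dir_Icc_dir_of[of p q] pq by simp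
  have sp: "space (borel_on K) = dir_of ` {p..q}"
    unfolding K_def using sets_borel_on_dir(2)[of p q] pq by simp
  \<comment> \<open>Shrinking to a compact interval inside the open interval from \<open>s\<close>
    to \<open>u\<close> is necessary because the increments involve the ends of the intervals as
    well.\<close>
  define s' where "s' = (s + t) / 2"
  define u' where "u' = (t + u) / 2"
  have su: "s < s'" "s' < t" "t < u'" "u' < u" using t by (auto simp: s'_def u'_def)
  have N: "interval_additive p q (\<lambda>A. \<mu> (dir_of ` A))"
    using signed_measure_interval_additive[of p q \<mu>] \<mu> pq by (simp add: K_def)
  have zero: "\<mu> (dir_of ` A) = 0" if A: "A \<in> sets borel" "A \<subseteq> {p..q} \<inter> {s'..u'}" for A
  proof (cases "max p s' < min q u'")
    case True
    show ?thesis
    proof (rule interval_additive_zero[OF N _ True])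
      fix a c' assume "max p s' \<le> a" "a < c'" "c' \<le> min q u'"
      then show "\<mu> (dir_of ` {a<..c'}) = 0" "\<mu> (dir_of ` {a..<c'}) = 0"
        using \<mu>(2) const su unfolding increments_def by auto
    qed (use A in auto)
  next
    case False
    have "dir_of t \<notin> K \<or> A = {}"
    proof (rule ccontr)
      assume "\<not> ?thesis"
      then show False using False su pq by (auto simp: K)
    qed
    moreover have "dir_of t \<in> K"
    proof -
      \<comment> \<open>The whole window is one of the closed sets intersected in the definition of
        the support, so the support lies inside the window.\<close>
      have "closedin (top_of_set (space (borel_on K))) (space (borel_on K))" by simp
      moreover have "total_variation (borel_on K) \<mu> (space (borel_on K) - space (borel_on K)) = 0"
        by (rule total_variation_eq_0) (use interval_additive_empty[OF N] in auto)
      ultimately have "dir_of t \<in> space (borel_on K)"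
        using mem unfolding signed_support_def \<mu>_def K_def pq by blast
      then show ?thesis using sp K by simp
    qed
    ultimately show ?thesis using interval_additive_empty[OF N] by auto
  qed
  \<comment> \<open>Removing the open interval from \<open>s'\<close> to \<open>u'\<close> leaves a
    closed set with null complement that misses \<open>t\<close>.\<close>
  define F where "F = K \<inter> {z. fst z \<le> s' \<or> u' \<le> fst z}"
  have "closed {z :: dir. fst z \<le> s' \<or> u' \<le> fst z}"
    by (intro closed_Collect_disj closed_Collect_le continuous_intros)
  then have "closedin (top_of_set (space (borel_on K))) F"
    unfolding sp K[symmetric] F_def by (metis closedin_closed_Int)
  moreover have "total_variation (borel_on K) \<mu> (space (borel_on K) - F) = 0"
  proof (rule total_variation_eq_0)
    fix E assume E: "E \<in> sets (borel_on K)" "E \<subseteq> space (borel_on K) - F"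
    then obtain A where A: "E = dir_of ` A" "A \<in> sets borel" "A \<subseteq> {p..q}"
      using sets_borel_on_dir(1)[of p q] pq by (auto simp: K_def)
    have "r \<in> {s'..u'}" if "r \<in> A" for r
    proof (rule ccontr)
      assume "r \<notin> {s'..u'}"
      then have "dir_of r \<in> F" using that A(3) by (auto simp: F_def K)
      moreover have "dir_of r \<in> E" using that A(1) by blast
      ultimately show False using E(2) by blast
    qed
    then have "A \<subseteq> {p..q} \<inter> {s'..u'}" using A(3) by blast
    then show "\<mu> E = 0" using zero A by simp
  qed
  ultimately have "dir_of t \<in> F"
    using mem unfolding signed_support_def \<mu>_def K_def pq by blast
  then show False using su by (simp add: F_def)
qed

lemma locally_constant_of_not_in_support:
  assumes t: "0 < t" "t < 1" and notin: "dir_of t \<notin> busemann_support b x y"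
  obtains s u where "0 < s" "s < t" "t < u" "u < 1"
    "\<And>a c. s < a \<Longrightarrow> a < c \<Longrightarrow> c < u \<Longrightarrow> b (dir_of a) Plus x y = b (dir_of c) Plus x y"
proof -
  \<comment> \<open>Any window inside the open unit interval with \<open>t\<close> strictly between
    its ends would serve.\<close>
  define p where "p = t / 2"
  define q where "q = (1 + t) / 2"
  have pq: "0 < p" "p < q" "q < 1" and ptq: "p < t" "t < q" using t by (auto simp: p_def q_def)
  define K where "K = dir_Icc (dir_of p) (dir_of q)"
  define \<mu> where "\<mu> = busemann_measure b x y K"
  note \<mu> = busemann_measure[OF pq, of x y, folded K_def, folded \<mu>_def]
  have K: "K = dir_of ` {p..q}" unfolding K_def using dir_Icc_dir_of[of p q] pq by simp
  have sp: "space (borel_on K) = dir_of ` {p..q}"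
    unfolding K_def using sets_borel_on_dir(2)[of p q] pq by simp
  have "dir_of t \<notin> signed_support (borel_on K) \<mu>"
  proof
    assume "dir_of t \<in> signed_support (borel_on K) \<mu>"
    moreover have "dir_of p \<in> riU" "dir_of q \<in> riU" "dir_of p \<prec> dir_of q"
      using pq riU_iff[of "dir_of p"] riU_iff[of "dir_of q"] by auto
    ultimately have "dir_of t \<in> busemann_support b x y"
      unfolding busemann_support_def \<mu>_def K_def by blast
    then show False using notin by simp
  qed
  then obtain F where F: "closedin (top_of_set (space (borel_on K))) F"
    "total_variation (borel_on K) \<mu> (space (borel_on K) - F) = 0" "dir_of t \<notin> F"
    unfolding signed_support_def by blast
  obtain C where C: "closed C" "F = K \<inter> C"
    using F(1) unfolding sp K[symmetric] closedin_closed by blast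
  have "dir_of t \<notin> C" using F(3) C(2) ptq K by auto
  have "closed (dir_of -` C)"
    by (intro closed_vimage C continuous_intros)
  then have "open (- (dir_of -` C))" by (simp add: open_Compl)
  moreover have "t \<in> - (dir_of -` C)" using \<open>dir_of t \<notin> C\<close> by simp
  ultimately obtain e where e: "0 < e" "ball t e \<subseteq> - (dir_of -` C)"
    by (meson open_contains_ball)
  define s where "s = max p (t - e)"
  define u where "u = min q (t + e)"
  have su: "p \<le> s" "s < t" "t < u" "u \<le> q" using ptq e by (auto simp: s_def u_def)
  have "b (dir_of a) Plus x y = b (dir_of c) Plus x y" if ac: "s < a" "a < c" "c < u" for a c
  proof -
    have "dir_of r \<notin> C" if "a < r" "r \<le> c" for r
    proof -
      have "r \<in> ball t e" using that ac by (auto simp: s_def u_def dist_real_def)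
      then show ?thesis using e(2) by blast
    qed
    then have "dir_of ` {a<..c} \<subseteq> space (borel_on K) - F"
      using ac su by (auto simp: sp C(2))
    moreover have "dir_of ` {a<..c} \<in> sets (borel_on K)"
      using sets_borel_on_dir(1)[of p q] pq ac su by (auto simp: K_def intro!: image_eqI[of _ _ "{a<..c}"])
    moreover have "space (borel_on K) - F \<in> sets (borel_on K)"
    proof -
      have "F = C \<inter> K" using C by auto
      then have "F \<in> sets (borel_on K)" using C(1) by (auto simp: borel_on_def sets_restrict_space)
      then show ?thesis by auto
    qed
    moreover have "\<mu> {} = 0"
      using interval_additive_empty[OF signed_measure_interval_additive[of p q \<mu>]] \<mu> pq by (simp add: K_def)
    ultimately have "\<mu> (dir_of ` {a<..c}) = 0"
      using total_variation_0_imp[OF F(2)] by blast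
    then show ?thesis using \<mu>(2) ac su unfolding increments_def by auto
  qed
  then show ?thesis using that[of s u] su pq by simp
qed

lemma busemann_geodesic_flow: "busemann_geodesic b x (dir_of t) \<sigma> = flow (st t \<sigma>) x"
  unfolding busemann_geodesic_def flow_def by auto

theorem support_iff_disjoint:
  assumes coal: "\<And>q x y. q \<in> \<rat> \<Longrightarrow> 0 < q \<Longrightarrow> q < 1 \<Longrightarrow>
      \<exists>k. level x \<le> k \<and> level y \<le> k \<and> flow (st q Plus) x k = flow (st q Plus) y k"
    and t: "0 < t" "t < 1"
  shows "dir_of t \<in> busemann_support b x y \<longleftrightarrow>
      busemann_points b x (dir_of t) Minus \<inter> busemann_points b y (dir_of t) Plus = {} \<or>
      busemann_points b x (dir_of t) Plus \<inter> busemann_points b y (dir_of t) Minus = {}"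
    (is "_ \<longleftrightarrow> ?R")
proof
  assume "dir_of t \<in> busemann_support b x y"
  show ?R
  proof (rule ccontr)
    assume "\<not> ?R"
    then obtain k l where k: "level x \<le> k" "level y \<le> k" "flow (st t Minus) x k = flow (st t Plus) y k"
      and l: "level x \<le> l" "level y \<le> l" "flow (st t Plus) x l = flow (st t Minus) y l"
      unfolding busemann_points_def busemann_geodesic_flow flow_points_disjoint_iff[OF st st] by blast
    then obtain s u c where "s < t" "t < u" "\<And>r \<sigma>. s < r \<Longrightarrow> r < u \<Longrightarrow> b (dir_of r) \<sigma> x y = c"
      using crossed_meetings_imp_locally_constant[OF t k l] by blast
    then show False
      using not_in_support_of_locally_constant[of s u x y c t] \<open>dir_of t \<in> busemann_support b x y\<close> by blast
  qed
next
  assume R: ?R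
  show "dir_of t \<in> busemann_support b x y"
  proof (rule ccontr)
    assume "dir_of t \<notin> busemann_support b x y"
    from locally_constant_of_not_in_support[OF t this] obtain s u where su: "0 < s" "s < t" "t < u" "u < 1"
      and const: "\<And>a c. s < a \<Longrightarrow> a < c \<Longrightarrow> c < u \<Longrightarrow> b (dir_of a) Plus x y = b (dir_of c) Plus x y"
      by metis
    obtain p where p: "p \<in> \<rat>" "s < p" "p < t" using Rats_dense_in_real su by blast
    obtain q where q: "q \<in> \<rat>" "t < q" "q < u" using Rats_dense_in_real su by blast
    have "\<exists>k. level x \<le> k \<and> level y \<le> k \<and> flow (st r Plus) x k = flow (st r Plus) y k" if "r \<in> {p, q}" for r x y
      using coal[of r x y] that p q su by auto
    from constant_imp_crossed_meetings[OF this _ p(3) q(2), of x y] obtain n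
      where "level x \<le> n" "level y \<le> n" "flow (st t Minus) x n = flow (st t Plus) y n"
      "flow (st t Plus) x n = flow (st t Minus) y n"
      using const[of p q] p q su by auto
    then show False
      using R unfolding busemann_points_def busemann_geodesic_flow flow_points_disjoint_iff[OF st st] by blast
  qed
qed

end

section \<open>Weights in general position\<close>

text \<open>By Fubini: for each value \<open>y\<close> of the second variable, the exceptional set
  of the first is the single point \<open>- y\<close>, which carries no mass.\<close>

lemma (in prob_space) AE_sum_nonzero:
  fixes X Y :: "'a \<Rightarrow> real"
  assumes ind: "indep_var borel X borel Y" and atom: "\<And>a. prob {\<omega> \<in> space M. X \<omega> = a} = 0"
  shows "AE \<omega> in M. X \<omega> + Y \<omega> \<noteq> 0"
proof -
  have X: "X \<in> borel_measurable M" and Y: "Y \<in> borel_measurable M"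
    and eq: "distr M borel X \<Otimes>\<^sub>M distr M borel Y = distr M (borel \<Otimes>\<^sub>M borel) (\<lambda>\<omega>. (X \<omega>, Y \<omega>))"
    using ind unfolding indep_var_distribution_eq by auto
  interpret DX: prob_space "distr M borel X" by (rule prob_space_distr[OF X])
  interpret DY: prob_space "distr M borel Y" by (rule prob_space_distr[OF Y])
  interpret P: pair_sigma_finite "distr M borel X" "distr M borel Y" ..
  let ?S = "{z :: real \<times> real. fst z + snd z = 0}"
  have S: "?S \<in> sets (borel \<Otimes>\<^sub>M borel)"
    unfolding borel_prod by (intro borel_closed closed_Collect_eq continuous_intros)
  have "emeasure (distr M borel X \<Otimes>\<^sub>M distr M borel Y) ?S =
      (\<integral>\<^sup>+y. emeasure (distr M borel X) ((\<lambda>x. (x, y)) -` ?S) \<partial>distr M borel Y)"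
    using S by (intro P.emeasure_pair_measure_alt2) (simp cong: sets_pair_measure_cong)
  also have "\<dots> = (\<integral>\<^sup>+y. 0 \<partial>distr M borel Y)"
  proof (rule nn_integral_cong)
    fix y :: real
    have "(\<lambda>x. (x, y)) -` ?S = {- y}" by auto
    moreover have "emeasure (distr M borel X) {- y} = 0"
      using X atom[of "- y"]
      by (subst emeasure_distr) (auto simp: emeasure_eq_measure vimage_def Int_def conj_commute)
    ultimately show "emeasure (distr M borel X) ((\<lambda>x. (x, y)) -` ?S) = 0" by simp
  qed
  finally have "emeasure M ((\<lambda>\<omega>. (X \<omega>, Y \<omega>)) -` ?S \<inter> space M) = 0"
    unfolding eq using S X Y by (subst (asm) emeasure_distr) auto
  moreover have "(\<lambda>\<omega>. (X \<omega>, Y \<omega>)) -` ?S \<inter> space M \<in> sets M"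
    using S X Y by (intro measurable_sets[of _ M "borel \<Otimes>\<^sub>M borel"]) auto
  ultimately show ?thesis
    by (intro AE_I[of _ _ "(\<lambda>\<omega>. (X \<omega>, Y \<omega>)) -` ?S \<inter> space M"]) auto
qed

lemma sum_mset_eq_sum_count:
  fixes f :: "'a \<Rightarrow> real"
  assumes "finite T" "set_mset D \<subseteq> T"
  shows "(\<Sum>v\<in>#D. f v) = (\<Sum>u\<in>T. real (count D u) * f u)"
  using assms(2)
proof (induction D)
  case (add x D)
  have "(\<Sum>u\<in>T. real (count (add_mset x D) u) * f u) =
      (\<Sum>u\<in>T. real (count D u) * f u + (if u = x then f u else 0))"
    by (intro sum.cong) (auto simp: algebra_simps)
  also have "\<dots> = (\<Sum>u\<in>T. real (count D u) * f u) + f x"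
    using add assms(1) by (simp add: sum.distrib)
  finally show ?case using add by simp
qed simp

context lpp_setting
begin

lemma space_M: "space M = UNIV"
  using sets_eq_imp_space_eq[OF sets_M] by simp

lemma W_measurable [measurable]: "(\<lambda>\<omega>. W \<omega> x) \<in> borel_measurable M"
  using W_indep unfolding indep_vars_def by blast

lemma real_distribution_W: "real_distribution (distr M borel (\<lambda>\<omega>. W \<omega> 0))"
  by (intro real_distribution_distr) auto

lemma prob_W_cong: "A \<in> sets borel \<Longrightarrow> prob {\<omega>. W \<omega> x \<in> A} = measure (distr M borel (\<lambda>\<omega>. W \<omega> 0)) A"
  using measure_distr[of "\<lambda>\<omega>. W \<omega> x" M borel A] W_ident[of x] by (simp add: space_M vimage_def)

lemma W_no_atoms: "prob {\<omega>. W \<omega> x = a} = 0"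
proof -
  interpret D: real_distribution "distr M borel (\<lambda>\<omega>. W \<omega> 0)" by (rule real_distribution_W)
  have "isCont (cdf (distr M borel (\<lambda>\<omega>. W \<omega> 0))) a"
    using W_continuous by (simp add: continuous_on_eq_continuous_at)
  then show ?thesis using D.isCont_cdf prob_W_cong[of "{a}" x] by simp
qed

text \<open>Different multisets disagree in the multiplicity of some site \<open>v\<close>. The
  difference of the sums is then a nonzero multiple of the weight at \<open>v\<close> plus a term
  independent of that weight, and an atomless variable plus an independent one almost surely does
  not vanish.\<close>

lemma AE_generic: "AE \<omega> in M. \<forall>A C. (\<Sum>v\<in>#A. W \<omega> v) = (\<Sum>v\<in>#C. W \<omega> v) \<longrightarrow> A = C"
proof -
  have "AE \<omega> in M. (\<Sum>v\<in>#A. W \<omega> v) = (\<Sum>v\<in>#C. W \<omega> v) \<longrightarrow> A = C" for A C :: "site multiset"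
  proof (cases "A = C")
    case False
    define c where "c v = real (count A v) - real (count C v)" for v
    obtain v where v: "c v \<noteq> 0" using False by (auto simp: c_def multiset_eq_iff)
    define S where "S = (set_mset A \<union> set_mset C) - {v}"
    have S: "finite S" "v \<notin> S" by (auto simp: S_def)
    have "indep_vars (\<lambda>_. borel) (\<lambda>u \<omega>. c u * W \<omega> u) UNIV"
      using W_indep by (rule indep_vars_compose2) auto
    then have ind: "indep_vars (\<lambda>_. borel) (\<lambda>u \<omega>. c u * W \<omega> u) (insert v S)"
      by (rule indep_vars_subset) auto
    have "prob {\<omega> \<in> space M. c v * W \<omega> v = a} = 0" for a
    proof -
      have "{\<omega> \<in> space M. c v * W \<omega> v = a} = {\<omega>. W \<omega> v = a / c v}"
        using v by (auto simp: space_M field_simps)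
      then show ?thesis using W_no_atoms by simp
    qed
    from AE_sum_nonzero[OF indep_vars_sum[OF S ind] this]
    have "AE \<omega> in M. c v * W \<omega> v + (\<Sum>u\<in>S. c u * W \<omega> u) \<noteq> 0" .
    then show ?thesis
    proof eventually_elim
      case (elim \<omega>)
      have sum: "(\<Sum>v\<in>#D. W \<omega> v) = (\<Sum>u\<in>insert v S. real (count D u) * W \<omega> u)"
        if "set_mset D \<subseteq> insert v S" for D
        by (rule sum_mset_eq_sum_count[OF _ that]) (use S in simp)
      have "(\<Sum>v\<in>#A. W \<omega> v) - (\<Sum>v\<in>#C. W \<omega> v) = (\<Sum>u\<in>insert v S. c u * W \<omega> u)"
        by (subst (1 2) sum) (auto simp: S_def c_def sum_subtractf left_diff_distrib simp del: sum.insert)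
      then show ?case using elim S by simp
    qed
  qed simp
  \<comment> \<open>Lists represent the multisets by a countable type, so the null events can be
    united.\<close>
  then have "AE \<omega> in M. \<forall>xs ys :: site list. (\<Sum>v\<in>#mset xs. W \<omega> v) = (\<Sum>v\<in>#mset ys. W \<omega> v) \<longrightarrow> mset xs = mset ys"
    by (simp add: AE_all_countable)
  then show ?thesis
    by eventually_elim (metis ex_mset)
qed

text \<open>Continuity of the distribution function supplies a median \<open>a\<close>, and slightly
  to the right of \<open>a\<close> the function is still below 1. The thresholds \<open>a\<close>
  and \<open>a + \<delta>\<close> will separate low weights inside a strip from high ones at its
  border.\<close>

lemma W_spread: "\<exists>a \<delta>. 0 < \<delta> \<and> prob {\<omega>. W \<omega> 0 \<le> a} > 0 \<and> prob {\<omega>. a + \<delta> \<le> W \<omega> 0} > 0"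
proof -
  let ?D = "distr M borel (\<lambda>\<omega>. W \<omega> 0)"
  interpret D: real_distribution ?D by (rule real_distribution_W)
  have cont: "isCont (cdf ?D) a" for a
    using W_continuous by (simp add: continuous_on_eq_continuous_at)
  obtain l where l: "cdf ?D l < 1/2"
    using order_tendstoD(2)[OF D.cdf_lim_at_bot, of "1/2"] by (auto simp: eventually_at_bot_linorder)
  obtain u where u: "1/2 < cdf ?D u"
    using order_tendstoD(1)[OF D.cdf_lim_at_top_prob, of "1/2"] by (auto simp: eventually_at_top_linorder)
  have "l \<le> u" using l u D.cdf_nondecreasing[of u l] by linarith
  then obtain a where a: "cdf ?D a = 1/2"
    using IVT[of "cdf ?D" l "1/2" u] l u cont by auto
  have "(cdf ?D \<longlongrightarrow> cdf ?D a) (at_right a)"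
    using cont[of a] unfolding isCont_def by (rule filterlim_mono) (auto simp: at_le)
  then have "\<forall>\<^sub>F y in at_right a. cdf ?D y < 1" using a by (intro order_tendstoD) auto
  then obtain y where y: "a < y" "cdf ?D y < 1"
    by (metis (mono_tags, lifting) eventually_at_right_field dense gt_ex)
  have W_le: "{\<omega> \<in> space M. W \<omega> 0 \<le> y} \<in> events" by measurable
  have "{\<omega>. W \<omega> 0 \<in> {y<..}} = space M - {\<omega> \<in> space M. W \<omega> 0 \<le> y}" by (auto simp: space_M)
  then have "prob {\<omega>. W \<omega> 0 \<in> {y<..}} = 1 - prob {\<omega>. W \<omega> 0 \<in> {..y}}"
    using prob_compl[OF W_le] by (simp add: space_M)
  then have "0 < prob {\<omega>. W \<omega> 0 \<in> {y<..}}" using y(2) prob_W_cong[of "{..y}" 0] by (simp add: cdf_def)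
  also have "\<dots> \<le> prob {\<omega>. a + (y - a) \<le> W \<omega> 0}"
  proof (rule finite_measure_mono)
    have "{\<omega> \<in> space M. a + (y - a) \<le> W \<omega> 0} \<in> sets M" by measurable
    then show "{\<omega>. a + (y - a) \<le> W \<omega> 0} \<in> sets M" by (simp add: space_M)
  qed auto
  finally have "0 < prob {\<omega>. a + (y - a) \<le> W \<omega> 0}" .
  moreover have "prob {\<omega>. W \<omega> 0 \<le> a} > 0"
    using prob_W_cong[of "{..a}" 0] a by (simp add: cdf_def)
  ultimately show ?thesis using y(1) by (intro exI[of _ a] exI[of _ "y - a"]) auto
qed

end

section \<open>Pairs of antidiagonal neighbours that never meet\<close>

definition separated :: "(site \<Rightarrow> site) \<Rightarrow> site \<Rightarrow> bool" where
  "separated s z \<longleftrightarrow> (\<forall>n. (s ^^ n) z \<noteq> (s ^^ n) (z + (1, -1)))"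

text \<open>Sites on one level are joined by a chain of antidiagonal neighbours, each meeting the
  next; sites on different levels are first brought to the higher level.\<close>

lemma coalescence_of_not_separated:
  assumes s: "up_right_step s" and ns: "\<And>z. \<not> separated s z"
  shows "\<exists>k. level x \<le> k \<and> level y \<le> k \<and> flow s x k = flow s y k"
proof -
  have fl: "(s ^^ n) z = flow s z (level z + int n)" for n z by (simp add: flow_def)
  have adj: "\<exists>k\<ge>level x. flow s x k = flow s (x + (int n, - int n)) k" for x n
  proof (induction n)
    case 0
    then show ?case by (auto simp: zero_prod_def[symmetric])
  next
    case (Suc n)
    define y where "y = x + (int n, - int n)"
    have ly: "level y = level x" "level (y + (1, -1)) = level x" by (auto simp: y_def level_def)
    obtain k where k: "k \<ge> level x" "flow s x k = flow s y k" using Suc by (auto simp: y_def)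
    obtain m where "(s ^^ m) y = (s ^^ m) (y + (1, -1))" using ns[of y] by (auto simp: separated_def)
    then have m: "flow s y (level x + int m) = flow s (y + (1, -1)) (level x + int m)"
      using fl[of m y] fl[of m "y + (1, -1)"] ly by simp
    define L where "L = max k (level x + int m)"
    have "flow s x L = flow s y L"
      using flow_meet[OF s _ _ _ k(2), of L] k ly by (simp add: L_def)
    moreover have "flow s y L = flow s (y + (1, -1)) L"
      using flow_meet[OF s _ _ _ m, of L] ly by (simp add: L_def)
    moreover have "y + (1, -1) = x + (int (Suc n), - int (Suc n))" by (simp add: y_def)
    ultimately show ?case using k by (intro exI[of _ L]) (auto simp: L_def)
  qed
  have same: "\<exists>k\<ge>level x. flow s x k = flow s y k" if "level x = level y" for x y
  proof (cases "fst x \<le> fst y")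
    case True
    have "y = x + (int (nat (fst y - fst x)), - int (nat (fst y - fst x)))"
      using that True by (auto simp: prod_eq_iff level_def)
    then show ?thesis using adj[of x "nat (fst y - fst x)"] by simp
  next
    case False
    have "x = y + (int (nat (fst x - fst y)), - int (nat (fst x - fst y)))"
      using that False by (auto simp: prod_eq_iff level_def)
    then show ?thesis using adj[of y "nat (fst x - fst y)"] that by (auto intro: sym)
  qed
  define m where "m = max (level x) (level y)"
  have m: "level x \<le> m" "level y \<le> m" by (auto simp: m_def)
  have "level (flow s x m) = level (flow s y m)" using level_flow[OF s] m by simp
  from same[OF this] obtain k where "k \<ge> m" "flow s (flow s x m) k = flow s (flow s y m) k"
    using level_flow[OF s m(1)] by auto
  then show ?thesis using flow_flow[OF s m(1)] flow_flow[OF s m(2)] m by (intro exI[of _ k]) auto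
qed

text \<open>Above the pair lie three consecutive sites, the middle one being \<open>v + e1\<close>.
  If one line uses the middle site, the lines occupy neighbouring sites and remain separated. If
  both avoid it, the line of the middle site cannot meet both of them, so it is separated from
  one.\<close>

lemma separated_step:
  assumes s: "up_right_step s" and sep: "separated s v"
  shows "separated s (v + e2) \<and> s v = v + e2 \<or>
    separated s (v + e1) \<and> s (v + (1, -1)) = v + (1, -1) + e1"
proof -
  define c where "c = v + (1, -1)"
  have mid: "c + e2 = v + e1" and ve: "v + e2 + (1, -1) = v + e1" "v + e1 + (1, -1) = c + e1"
    by (auto simp: c_def prod_eq_iff)
  have ne: "(s ^^ n) (s v) \<noteq> (s ^^ n) (s c)" for n
    using sep[unfolded separated_def, rule_format, of "Suc n"] by (simp add: funpow_swap1 c_def)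
  have tr: "(s ^^ (m + n)) p = (s ^^ (m + n)) q" if "(s ^^ n) p = (s ^^ n) q" for m n p q
    using that by (simp add: funpow_add)
  consider "s v = v + e2" "s c = v + e1" | "s v = v + e1" "s c = c + e1" | "s v = v + e2" "s c = c + e1"
    using up_right_stepD[OF s, of v] up_right_stepD[OF s, of c] ne[of 0] mid by auto
  then show ?thesis
  proof cases
    case 1
    then have "separated s (v + e2)" unfolding separated_def ve using ne by metis
    then show ?thesis using 1 by blast
  next
    case 2
    then have "separated s (v + e1)" unfolding separated_def ve using ne by metis
    then show ?thesis using 2 by (simp add: c_def)
  next
    case 3
    have "separated s (v + e2) \<or> separated s (v + e1)"
    proof (rule ccontr)
      assume "\<not> ?thesis"
      then obtain m n where "(s ^^ m) (v + e2) = (s ^^ m) (v + e1)" "(s ^^ n) (v + e1) = (s ^^ n) (c + e1)"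
        unfolding separated_def ve by blast
      then have "(s ^^ (n + m)) (v + e2) = (s ^^ (n + m)) (v + e1)"
        "(s ^^ (m + n)) (v + e1) = (s ^^ (m + n)) (c + e1)" using tr by blast+
      then show False using ne[of "m + n"] 3 by (simp add: add.commute)
    qed
    then show ?thesis using 3 by (auto simp: c_def)
  qed
qed

text \<open>\<open>N\<close> is left general because it will stand for the information in the
  increments based at level \<open>k\<close> or above: a geodesic started there never looks
  below.\<close>

lemma measurable_busemann_flow:
  assumes b: "\<And>x y. k \<le> level x \<Longrightarrow> x \<le> y \<Longrightarrow> (\<lambda>\<omega>. b \<omega> x y) \<in> borel_measurable N"
    and z: "k \<le> level z"
  shows "(\<lambda>\<omega>. (busemann_step (b \<omega>) \<sigma> ^^ n) z) \<in> measurable N (count_space UNIV)"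
  using z
proof (induction n arbitrary: z)
  case (Suc n)
  have [measurable]: "(\<lambda>\<omega>. b \<omega> z (z + e1)) \<in> borel_measurable N" "(\<lambda>\<omega>. b \<omega> z (z + e2)) \<in> borel_measurable N"
    using b[OF Suc.prems] by (auto simp: less_eq_prod_def)
  have [measurable]: "(\<lambda>\<omega>. (busemann_step (b \<omega>) \<sigma> ^^ n) (z + e1)) \<in> measurable N (count_space UNIV)"
    "(\<lambda>\<omega>. (busemann_step (b \<omega>) \<sigma> ^^ n) (z + e2)) \<in> measurable N (count_space UNIV)"
    using Suc.prems by (intro Suc.IH; simp)+
  define E where "E \<omega> \<longleftrightarrow> b \<omega> z (z + e1) < b \<omega> z (z + e2) \<or>
      b \<omega> z (z + e1) = b \<omega> z (z + e2) \<and> \<sigma> = Plus" for \<omega>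
  have [measurable]: "Measurable.pred N E" unfolding E_def by measurable
  have "(busemann_step (b \<omega>) \<sigma> ^^ Suc n) z =
      (if E \<omega> then (busemann_step (b \<omega>) \<sigma> ^^ n) (z + e1) else (busemann_step (b \<omega>) \<sigma> ^^ n) (z + e2))" for \<omega>
  proof -
    have "busemann_step (b \<omega>) \<sigma> z = (if E \<omega> then z + e1 else z + e2)"
      by (cases \<sigma>) (auto simp: busemann_step_def E_def)
    then show ?thesis by (simp add: funpow_swap1)
  qed
  then show ?case by simp
qed simp

lemma measurable_separated:
  assumes b: "\<And>x y. k \<le> level x \<Longrightarrow> x \<le> y \<Longrightarrow> (\<lambda>\<omega>. b \<omega> x y) \<in> borel_measurable N"
    and z: "k \<le> level z"
  shows "Measurable.pred N (\<lambda>\<omega>. separated (busemann_step (b \<omega>) \<sigma>) z)"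
proof -
  have [measurable]: "(\<lambda>\<omega>. (busemann_step (b \<omega>) \<sigma> ^^ n) z) \<in> measurable N (count_space UNIV)" for n
    by (rule measurable_busemann_flow[OF b z])
  have z': "k \<le> level (z + (1, -1))" using z by (simp add: level_def)
  have [measurable]: "(\<lambda>\<omega>. (busemann_step (b \<omega>) \<sigma> ^^ n) (z + (1, -1))) \<in> measurable N (count_space UNIV)" for n
    by (rule measurable_busemann_flow[OF b z'])
  have "separated (busemann_step (b \<omega>) \<sigma>) z \<longleftrightarrow> (\<forall>n. \<forall>c. \<not> ((busemann_step (b \<omega>) \<sigma> ^^ n) z = c \<and>
      (busemann_step (b \<omega>) \<sigma> ^^ n) (z + (1, -1)) = c))" for \<omega>
    unfolding separated_def by metis
  then show ?thesis by simp
qed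

section \<open>Coalescence\<close>

text \<open>Realizes a generated \<sigma>-algebra as the one of a measure, so that measurability
  with respect to it can be expressed and derived as usual.\<close>

lemma gen_events_measure:
  fixes M :: "'w measure"
  obtains N where "sets N = gen_events M F" "space N = space M" "\<And>f. f \<in> F \<Longrightarrow> f \<in> borel_measurable N"
proof -
  let ?G = "{f -` A \<inter> space M | f A. f \<in> F \<and> A \<in> sets borel}"
  define N where "N = sigma (space M) ?G"
  have N: "sets N = gen_events M F" "space N = space M"
    unfolding N_def gen_events_def by (subst sets_measure_of space_measure_of; blast)+
  moreover have "f \<in> borel_measurable N" if "f \<in> F" for f
  proof (rule measurableI)
    fix A :: "real set" assume "A \<in> sets borel"
    then show "f -` A \<inter> space N \<in> sets N"
      unfolding N gen_events_def using that by (intro sigma_sets.Basic) blast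
  qed simp
  ultimately show ?thesis using that by blast
qed

abbreviation ad :: "int \<Rightarrow> site" where "ad i \<equiv> (i, - i)"

text \<open>The coalescence proof is by contradiction. A stretch of an antidiagonal between two consecutive separated
  pairs is a \<open>valley\<close> of depth \<open>- c\<close> if the values of \<open>b\<close> inside are at most \<open>c\<close> above those at the two sites
  bordering it. Independent weights one level below can deepen every valley by a fixed amount.\<close>

locale stationary_cocycle = lpp_setting M T W g
  for M :: "'w::polish_space measure" and T W g +
  fixes b :: "'w \<Rightarrow> site \<Rightarrow> site \<Rightarrow> real" and \<Omega>\<^sub>0 :: "'w set"
  assumes b_measurable [measurable]: "\<And>x y. (\<lambda>\<omega>. b \<omega> x y) \<in> borel_measurable M"
    and AE_\<Omega>\<^sub>0: "AE \<omega> in M. \<omega> \<in> \<Omega>\<^sub>0"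
    and \<Omega>\<^sub>0_shift: "\<And>z \<omega>. \<omega> \<in> \<Omega>\<^sub>0 \<Longrightarrow> T z \<omega> \<in> \<Omega>\<^sub>0"
    and shift: "\<And>\<omega> x y z. \<omega> \<in> \<Omega>\<^sub>0 \<Longrightarrow> b \<omega> (x + z) (y + z) = b (T z \<omega>) x y"
    and cocycle: "\<And>\<omega> x y z. \<omega> \<in> \<Omega>\<^sub>0 \<Longrightarrow> b \<omega> x y + b \<omega> y z = b \<omega> x z"
    and recovery: "\<And>\<omega> z. \<omega> \<in> \<Omega>\<^sub>0 \<Longrightarrow> min (b \<omega> z (z + e1)) (b \<omega> z (z + e2)) = W \<omega> z"
    and indep_levels: "indep_set (gen_events M {(\<lambda>\<omega>. b \<omega> x y) | x y. 0 \<le> level x \<and> x \<le> y})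
      (gen_events M {(\<lambda>\<omega>. W \<omega> x) | x. level x < 0})"
begin

definition s :: "'w \<Rightarrow> site \<Rightarrow> site" where "s \<omega> = busemann_step (b \<omega>) Plus"

abbreviation sep :: "'w \<Rightarrow> site \<Rightarrow> bool" where "sep \<omega> \<equiv> separated (s \<omega>)"

text \<open>Equals \<open>b \<omega> x y\<close>, but is visibly a function of the increments from \<open>x\<close> and \<open>y\<close> upwards, which is what
  the independence of the levels is about.\<close>

definition h :: "'w \<Rightarrow> site \<Rightarrow> site \<Rightarrow> real" where
  "h \<omega> x y = (let q = (max (fst x) (fst y), max (snd x) (snd y)) in b \<omega> x q - b \<omega> y q)"

text \<open>\<open>p\<close> and \<open>p + ad m\<close> are the left members of separated pairs.
  The inside therefore consists of the \<open>m\<close> sites from \<open>p + ad 1\<close> to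
  \<open>p + ad m\<close>, and the border sites are \<open>p\<close> and
  \<open>p + ad (m + 1)\<close>. Further separated pairs in between are permitted.\<close>

definition valley :: "'w \<Rightarrow> site \<Rightarrow> int \<Rightarrow> real \<Rightarrow> bool" where
  "valley \<omega> p m c \<longleftrightarrow> sep \<omega> p \<and> sep \<omega> (p + ad m) \<and>
    (\<forall>i\<in>{1..m}. h \<omega> (p + ad i) p \<le> c \<and> h \<omega> (p + ad i) (p + ad (m + 1)) \<le> c)"

lemma step_s: "up_right_step (s \<omega>)"
  unfolding up_right_step_def s_def busemann_step_def by auto

lemma s_eq: "s \<omega> z = (if b \<omega> z (z + e1) \<le> b \<omega> z (z + e2) then z + e1 else z + e2)"
  by (auto simp: s_def busemann_step_def)

lemma h_eq: "\<omega> \<in> \<Omega>\<^sub>0 \<Longrightarrow> h \<omega> x y = b \<omega> x y"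
  unfolding h_def Let_def using cocycle[of \<omega> x y] by (smt (verit))

lemma b_refl: "\<omega> \<in> \<Omega>\<^sub>0 \<Longrightarrow> b \<omega> x x = 0"
  using cocycle[of \<omega> x x x] by simp

lemma measurable_h:
  assumes "\<And>x y. k \<le> level x \<Longrightarrow> x \<le> y \<Longrightarrow> (\<lambda>\<omega>. b \<omega> x y) \<in> borel_measurable N"
    and "k \<le> level x" "k \<le> level y"
  shows "(\<lambda>\<omega>. h \<omega> x y) \<in> borel_measurable N"
  unfolding h_def Let_def using assms by (intro borel_measurable_diff) (auto simp: less_eq_prod_def)

lemma measurable_valley:
  assumes b: "\<And>x y. k \<le> level x \<Longrightarrow> x \<le> y \<Longrightarrow> (\<lambda>\<omega>. b \<omega> x y) \<in> borel_measurable N"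
    and p: "k \<le> level p"
  shows "Measurable.pred N (\<lambda>\<omega>. valley \<omega> p m c)"
proof -
  have lev: "k \<le> level (p + ad i)" for i using p by (simp add: level_def)
  have [measurable]: "Measurable.pred N (\<lambda>\<omega>. sep \<omega> p)" "Measurable.pred N (\<lambda>\<omega>. sep \<omega> (p + ad m))"
    unfolding s_def by (rule measurable_separated[where b = b and k = k]; simp add: b p lev)+
  have [measurable]: "(\<lambda>\<omega>. h \<omega> (p + ad i) p) \<in> borel_measurable N"
    "(\<lambda>\<omega>. h \<omega> (p + ad i) (p + ad (m + 1))) \<in> borel_measurable N" for i
    by (rule measurable_h[where k = k]; (rule b p lev)?; assumption?)+
  show ?thesis unfolding valley_def by measurable
qed

lemma pred_sep [measurable]: "Measurable.pred M (\<lambda>\<omega>. sep \<omega> z)"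
  unfolding s_def by (rule measurable_separated[of "level z"]) auto

lemma pred_s [measurable]: "Measurable.pred M (\<lambda>\<omega>. s \<omega> z = v)"
proof -
  have "(\<lambda>\<omega>. s \<omega> z) \<in> measurable M (count_space UNIV)"
    using measurable_busemann_flow[where k = "level z" and b = b and N = M and z = z and n = 1 and \<sigma> = Plus] by (simp add: s_def)
  then show ?thesis by measurable
qed

lemma pred_valley [measurable]: "Measurable.pred M (\<lambda>\<omega>. valley \<omega> p m c)"
  by (rule measurable_valley[of "level p"]) auto

lemma s_shift: "\<omega> \<in> \<Omega>\<^sub>0 \<Longrightarrow> s \<omega> (x + z) = s (T z \<omega>) x + z"
proof -
  assume "\<omega> \<in> \<Omega>\<^sub>0"
  moreover have eq: "x + e1 + z = x + z + e1" "x + e2 + z = x + z + e2"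
    by (simp_all only: ac_simps)
  ultimately show ?thesis
    unfolding s_eq
    using shift[of \<omega> x z "x + e1", unfolded eq] shift[of \<omega> x z "x + e2", unfolded eq]
    by (auto simp: eq)
qed

lemma sep_shift:
  assumes "\<omega> \<in> \<Omega>\<^sub>0"
  shows "sep \<omega> (x + z) \<longleftrightarrow> sep (T z \<omega>) x"
proof -
  have *: "(s \<omega> ^^ n) (y + z) = (s (T z \<omega>) ^^ n) y + z" for n y
    by (induction n) (simp_all add: s_shift[OF assms])
  have "x + z + (1, - 1) = x + (1, - 1) + z" by (simp add: add.commute add.left_commute)
  then show ?thesis unfolding separated_def by (simp only: * add_right_cancel)
qed

lemma valley_shift:
  assumes "\<omega> \<in> \<Omega>\<^sub>0"
  shows "valley \<omega> (x + z) m c \<longleftrightarrow> valley (T z \<omega>) x m c"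
proof -
  have "h \<omega> (p + z) (q + z) = h (T z \<omega>) p q" for p q
    using h_eq[OF assms] h_eq[OF \<Omega>\<^sub>0_shift[OF assms]] shift[OF assms] by simp
  moreover have "x + z + ad i = x + ad i + z" for i by (simp add: add.commute add.left_commute)
  ultimately show ?thesis unfolding valley_def by (simp only: sep_shift[OF assms])
qed

lemma AE_shift: "AE \<omega> in M. P \<omega> \<Longrightarrow> AE \<omega> in M. P (T z \<omega>)"
  by (rule AE_distrD[OF T_measurable]) (subst T_preserving)

lemma prob_shift:
  assumes P: "Measurable.pred M P" and Q: "Measurable.pred M Q"
    and eq: "\<And>\<omega>. \<omega> \<in> \<Omega>\<^sub>0 \<Longrightarrow> Q \<omega> \<longleftrightarrow> P (T z \<omega>)"
  shows "prob {\<omega>. Q \<omega>} = prob {\<omega>. P \<omega>}"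
proof -
  have [measurable]: "T z \<in> measurable M M" by (rule T_measurable)
  have P': "{\<omega>. P \<omega>} \<in> events" using P by (simp add: pred_def space_M)
  have Q': "{\<omega>. Q \<omega>} \<in> events" using Q by (simp add: pred_def space_M)
  have PT: "{\<omega>. P (T z \<omega>)} \<in> events"
    using measurable_sets[OF T_measurable P'] by (simp add: space_M vimage_def)
  have "prob {\<omega>. Q \<omega>} = prob {\<omega>. P (T z \<omega>)}"
    using AE_\<Omega>\<^sub>0 by (intro finite_measure_eq_AE Q' PT) (auto simp: eq)
  also have "\<dots> = measure (distr M M (T z)) {\<omega>. P \<omega>}"
    using P' by (subst measure_distr) (auto simp: T_measurable space_M vimage_def)
  finally show ?thesis by (simp add: T_preserving)
qed

text \<open>Lines of separated pairs then neither branch upwards nor end downwards: the site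
  directly below the left member of a pair steps to one of the two members, and in either case a
  separated pair is found one level below.\<close>

definition tidy :: "'w \<Rightarrow> bool" where
  "tidy \<omega> \<longleftrightarrow> (\<forall>v.
    \<not> ((sep \<omega> (v + e2) \<and> s \<omega> v = v + e2) \<and> (sep \<omega> (v + e1) \<and> s \<omega> (v + (1, -1)) = v + (1, -1) + e1)) \<and>
    (sep \<omega> (v + e2) \<and> s \<omega> v = v + e2 \<or> sep \<omega> (v + e1) \<and> s \<omega> (v + (1, -1)) = v + (1, -1) + e1
      \<longrightarrow> sep \<omega> v))"

text \<open>A separated pair has a separated pair on the level above it, via one of two cases whose
  probabilities add up to that of a single separated pair, because a fixed site takes exactly one step.
  Hence the two cases exclude each other and each of them is also sufficient, almost surely.\<close>

lemma AE_tidy: "AE \<omega> in M. tidy \<omega>"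
proof -
  have "AE \<omega> in M. \<not> ((sep \<omega> (v + e2) \<and> s \<omega> v = v + e2) \<and> (sep \<omega> (v + e1) \<and> s \<omega> (v + (1, -1)) = v + (1, -1) + e1)) \<and>
    (sep \<omega> (v + e2) \<and> s \<omega> v = v + e2 \<or> sep \<omega> (v + e1) \<and> s \<omega> (v + (1, -1)) = v + (1, -1) + e1
      \<longrightarrow> sep \<omega> v)" for v
  proof -
    define A where "A = {\<omega>. sep \<omega> (v + e2) \<and> s \<omega> v = v + e2}"
    define C where "C = {\<omega>. sep \<omega> (v + e1) \<and> s \<omega> (v + (1, -1)) = v + (1, -1) + e1}"
    define D where "D = {\<omega>. sep \<omega> v}"
    \<comment> \<open>Translated so that the upper pair sits at 0, both cases are statements about
      the step of the same site \<open>(0, -1)\<close>.\<close>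
    define A0 where "A0 = {\<omega>. sep \<omega> 0 \<and> s \<omega> (0, -1) = (0, -1) + e2}"
    define C0 where "C0 = {\<omega>. sep \<omega> 0 \<and> s \<omega> (0, -1) = (0, -1) + e1}"
    have ev: "{\<omega>. P \<omega>} \<in> events" if "Measurable.pred M P" for P
      using that by (simp add: pred_def space_M)
    have meas: "A \<in> events" "C \<in> events" "D \<in> events" "A0 \<in> events" "C0 \<in> events"
      unfolding A_def C_def D_def A0_def C0_def by (intro ev; measurable)+
    have "prob A = prob A0"
      unfolding A_def A0_def
    proof (rule prob_shift[where z = "v + e2"])
      fix \<omega> assume \<omega>: "\<omega> \<in> \<Omega>\<^sub>0"
      have "v = (0, -1) + (v + e2)" by (simp add: prod_eq_iff)
      then have "s \<omega> v = s (T (v + e2) \<omega>) (0, -1) + (v + e2)" using s_shift[OF \<omega>] by metis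
      moreover have "sep \<omega> (v + e2) = sep (T (v + e2) \<omega>) 0" using sep_shift[OF \<omega>, of 0 "v + e2"] by simp
      ultimately show "(sep \<omega> (v + e2) \<and> s \<omega> v = v + e2) =
          (sep (T (v + e2) \<omega>) 0 \<and> s (T (v + e2) \<omega>) (0, -1) = (0, -1) + e2)"
        by (auto simp: prod_eq_iff)
    qed measurable
    moreover have "prob C = prob C0"
      unfolding C_def C0_def
    proof (rule prob_shift[where z = "v + e1"])
      fix \<omega> assume \<omega>: "\<omega> \<in> \<Omega>\<^sub>0"
      have "v + (1, -1) = (0, -1) + (v + e1)" by (simp add: prod_eq_iff)
      then have "s \<omega> (v + (1, -1)) = s (T (v + e1) \<omega>) (0, -1) + (v + e1)" using s_shift[OF \<omega>] by metis
      moreover have "sep \<omega> (v + e1) = sep (T (v + e1) \<omega>) 0" using sep_shift[OF \<omega>, of 0 "v + e1"] by simp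
      ultimately show "(sep \<omega> (v + e1) \<and> s \<omega> (v + (1, -1)) = v + (1, -1) + e1) =
          (sep (T (v + e1) \<omega>) 0 \<and> s (T (v + e1) \<omega>) (0, -1) = (0, -1) + e1)"
        by (auto simp: prod_eq_iff)
    qed measurable
    moreover have "prob A0 + prob C0 = prob {\<omega>. sep \<omega> 0}"
    proof -
      have "s \<omega> (0, -1) = (0, -1) + e1 \<or> s \<omega> (0, -1) = (0, -1) + e2" for \<omega>
        by (rule up_right_stepD[OF step_s])
      then have "{\<omega>. sep \<omega> 0} = A0 \<union> C0" unfolding A0_def C0_def by auto
      moreover have "A0 \<inter> C0 = {}" unfolding A0_def C0_def by auto
      ultimately show ?thesis using finite_measure_Union[OF meas(4,5)] by simp
    qed
    moreover have "prob D = prob {\<omega>. sep \<omega> 0}"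
      unfolding D_def using sep_shift[of _ 0 v] by (intro prob_shift[where z = v]) auto
    ultimately have sum: "prob A + prob C = prob D" by simp
    have sub: "D \<subseteq> A \<union> C"
      unfolding A_def C_def D_def using separated_step[OF step_s] by blast
    \<comment> \<open>As \<open>prob A + prob C = prob D\<close> and \<open>D\<close> is contained
      in the union, inclusion-exclusion leaves no mass for \<open>A \<inter> C\<close> or for
      \<open>A \<union> C - D\<close>.\<close>
    have "prob (A \<union> C) + prob (A \<inter> C) = prob A + prob C"
    proof -
      have "A \<union> C = A \<union> (C - A)" "A \<inter> (C - A) = {}" by auto
      then have "prob (A \<union> C) = prob A + prob (C - A)"
        using finite_measure_Union[of A "C - A"] meas by auto
      moreover have "prob (C - A) = prob C - prob (A \<inter> C)"
        using finite_measure_Diff'[of C A] meas by (simp add: Int_commute)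
      ultimately show ?thesis by simp
    qed
    moreover have "prob D \<le> prob (A \<union> C)" using sub meas by (intro finite_measure_mono) auto
    moreover have "prob (A \<union> C - D) = prob (A \<union> C) - prob D" using sub meas by (intro finite_measure_Diff) auto
    ultimately have "prob (A \<inter> C) = 0" "prob (A \<union> C - D) = 0"
      using sum measure_nonneg[of M "A \<inter> C"] measure_nonneg[of M "A \<union> C - D"] by linarith+
    then have "AE \<omega> in M. \<omega> \<notin> A \<inter> C" "AE \<omega> in M. \<omega> \<notin> A \<union> C - D"
      using prob_eq_0[of "A \<inter> C"] prob_eq_0[of "A \<union> C - D"] meas by auto
    then show ?thesis by eventually_elim (auto simp: A_def C_def D_def)
  qed
  then show ?thesis unfolding tidy_def by (simp only: AE_all_countable) simp
qed

text \<open>\<open>l\<close> and \<open>r\<close> locate the predecessors of the two border pairs.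
  The site below the left member of a pair steps to the left or to the right member; accordingly the
  lower pair starts at that site or one place further left, and the sign of a single increment on
  the upper level decides. \<open>tidy\<close> keeps the predecessors distinct, so the strip retains
  an inside. If \<open>c < 0\<close>, the signs at both borders are forced and the width
  \<open>r - l\<close> becomes \<open>m - 1\<close>.\<close>

lemma valley_width:
  assumes "\<omega> \<in> \<Omega>\<^sub>0" "tidy \<omega>" "1 \<le> m" and valley: "valley \<omega> 0 m c"
    and l: "l = (if h \<omega> 0 (ad 1) \<le> 0 then -1 else 0)"
    and r: "r = (if h \<omega> (ad m) (ad (m + 1)) \<le> 0 then m - 1 else m)"
  shows "l + 1 \<le> r" and "c < 0 \<Longrightarrow> l = 0 \<and> r = m - 1"
    and "sep \<omega> (ad l - e2)" and "sep \<omega> (ad r - e2)"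
    and "\<And>i. l < i \<Longrightarrow> i \<le> r \<Longrightarrow> s \<omega> (ad i - e2) \<in> ad ` {1..m}"
proof -
  have step: "s \<omega> (ad i - e2) = (if h \<omega> (ad i) (ad (i + 1)) \<le> 0 then ad (i + 1) else ad i)" for i
  proof -
    have "ad i - e2 + e1 = ad (i + 1)" "ad i - e2 + e2 = ad i" by (auto simp: prod_eq_iff)
    moreover have "b \<omega> (ad i - e2) (ad (i + 1)) = b \<omega> (ad i - e2) (ad i) + h \<omega> (ad i) (ad (i + 1))"
      using h_eq[OF assms(1)] cocycle[OF assms(1)] by simp
    ultimately show ?thesis unfolding s_eq by auto
  qed
  have up: "sep \<omega> (ad i - e2)" if "sep \<omega> (ad i)" "s \<omega> (ad i - e2) = ad i" for i
  proof -
    have "ad i - e2 + e2 = ad i" by (auto simp: prod_eq_iff)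
    then show ?thesis using assms(2) that unfolding tidy_def by metis
  qed
  have right: "ad (i - 1) - e2 + e1 = ad i" "ad (i - 1) - e2 + (1, -1) = ad i - e2"
    "ad i - e2 + e1 = ad (i + 1)" for i
    by (auto simp: prod_eq_iff)
  have down: "sep \<omega> (ad (i - 1) - e2)" if "sep \<omega> (ad i)" "s \<omega> (ad i - e2) = ad (i + 1)" for i
    using assms(2)[unfolded tidy_def, rule_format, of "ad (i - 1) - e2"] that
    unfolding right diff_add_cancel by blast
  have both: "\<not> (sep \<omega> (ad i) \<and> s \<omega> (ad i - e2) = ad i \<and> sep \<omega> (ad (i + 1)) \<and> s \<omega> (ad (i + 1) - e2) = ad (i + 2))" for i
  proof -
    have "ad i - e2 + e2 = ad i" "ad i - e2 + (1, -1) = ad (i + 1) - e2" "ad i - e2 + (1, -1) + e1 = ad (i + 2)"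
      by (auto simp: prod_eq_iff)
    then show ?thesis
      using assms(2)[unfolded tidy_def, rule_format, of "ad i - e2"] unfolding right by metis
  qed
  have zero: "ad 0 = 0" by (simp add: zero_prod_def)
  have sep: "sep \<omega> (ad 0)" "sep \<omega> (ad m)" using valley unfolding valley_def zero by simp_all
  show "sep \<omega> (ad l - e2)"
    using up[OF sep(1)] down[OF sep(1)] step[of 0] l zero by (auto split: if_splits)
  show "sep \<omega> (ad r - e2)"
    using up[OF sep(2)] down[OF sep(2)] step[of m] r by (auto split: if_splits)
  show "l + 1 \<le> r"
  proof (rule ccontr)
    assume "\<not> ?thesis"
    then have "m = 1" "l = 0" "r = 0" using l r \<open>1 \<le> m\<close> by (auto split: if_splits)
    then have "s \<omega> (ad 0 - e2) = ad 0" "s \<omega> (ad 1 - e2) = ad 2"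
      using step[of 0] step[of 1] l r zero by (auto split: if_splits)
    then show False using both[of 0] sep \<open>m = 1\<close> by simp
  qed
  show "l = 0 \<and> r = m - 1" if "c < 0"
  proof -
    have "h \<omega> (0 + ad 1) 0 \<le> c" "h \<omega> (0 + ad m) (0 + ad (m + 1)) \<le> c"
      using valley \<open>1 \<le> m\<close> unfolding valley_def by auto
    then have "b \<omega> (ad 1) 0 < 0" "h \<omega> (ad m) (ad (m + 1)) < 0"
      using that h_eq[OF assms(1)] by auto
    moreover have "b \<omega> 0 (ad 1) = - b \<omega> (ad 1) 0"
      using cocycle[OF assms(1), of 0 "ad 1" 0] b_refl[OF assms(1)] by simp
    ultimately show ?thesis using l r h_eq[OF assms(1)] by auto
  qed
  show "s \<omega> (ad i - e2) \<in> ad ` {1..m}" if "l < i" "i \<le> r" for i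
    using that step[of i] l r zero by (cases "i = 0"; cases "i = m") (auto split: if_splits)
qed

text \<open>Measured against the old border, a new inside site has value at most its weight plus
  \<open>c\<close>, hence at most \<open>a + c\<close>, because it steps to an old inside site. A
  new border site has value at least its weight, hence at least \<open>a + \<delta>\<close>. The
  difference is at most \<open>c - \<delta>\<close>.\<close>

lemma valley_deepens:
  assumes \<omega>: "\<omega> \<in> \<Omega>\<^sub>0" "tidy \<omega>" "1 \<le> m" and valley: "valley \<omega> 0 m c"
    and l: "l = (if h \<omega> 0 (ad 1) \<le> 0 then -1 else 0)"
    and r: "r = (if h \<omega> (ad m) (ad (m + 1)) \<le> 0 then m - 1 else m)"
    and low: "\<And>i. l < i \<Longrightarrow> i \<le> r \<Longrightarrow> W \<omega> (ad i - e2) \<le> a"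
    and high: "a + \<delta> \<le> W \<omega> (ad l - e2)" "a + \<delta> \<le> W \<omega> (ad (r + 1) - e2)"
  shows "valley \<omega> (ad l - e2) (r - l) (c - \<delta>)"
proof -
  note width = valley_width[OF \<omega> valley l r]
  have ge: "W \<omega> z \<le> b \<omega> z (z + e1)" "W \<omega> z \<le> b \<omega> z (z + e2)" for z
    using recovery[OF \<omega>(1), of z] by (auto simp: min_def split: if_splits)
  have eq: "ad i - e2 + e1 = ad (i + 1)" "ad i - e2 + e2 = ad i" for i by (auto simp: prod_eq_iff)
  have zero: "ad 0 = 0" by (simp add: zero_prod_def)
  \<comment> \<open>For either value of \<open>l\<close> the new border site is directly below or
    directly left of the old one, so recovery applies to the edge between them.\<close>
  have left: "W \<omega> (ad l - e2) \<le> b \<omega> (ad l - e2) 0"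
    using ge[of "ad l - e2"] l zero unfolding eq by (auto split: if_splits)
  have right: "W \<omega> (ad (r + 1) - e2) \<le> b \<omega> (ad (r + 1) - e2) (ad (m + 1))"
  proof (cases "r + 1 = m")
    case True
    show ?thesis unfolding True using ge(1)[of "ad m - e2"] unfolding eq .
  next
    case False
    then have "r + 1 = m + 1" using r by (auto split: if_splits)
    then show ?thesis using ge(2)[of "ad (m + 1) - e2"] unfolding eq by simp
  qed
  have inner: "b \<omega> (ad i - e2) 0 \<le> W \<omega> (ad i - e2) + c" "b \<omega> (ad i - e2) (ad (m + 1)) \<le> W \<omega> (ad i - e2) + c"
    if i: "l < i" "i \<le> r" for i
  proof -
    obtain j where j: "j \<in> {1..m}" "s \<omega> (ad i - e2) = ad j" using width(5)[OF i] by blast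
    have "h \<omega> (0 + ad j) 0 \<le> c" "h \<omega> (0 + ad j) (0 + ad (m + 1)) \<le> c"
      using valley j(1) unfolding valley_def by blast+
    then have "b \<omega> (ad j) 0 \<le> c" "b \<omega> (ad j) (ad (m + 1)) \<le> c" using h_eq[OF \<omega>(1)] by simp_all
    moreover have "b \<omega> (ad i - e2) (ad j) = W \<omega> (ad i - e2)"
      using recovery[OF \<omega>(1), of "ad i - e2"] j(2) unfolding s_eq by (auto simp: min_def split: if_splits)
    ultimately show "b \<omega> (ad i - e2) 0 \<le> W \<omega> (ad i - e2) + c"
      "b \<omega> (ad i - e2) (ad (m + 1)) \<le> W \<omega> (ad i - e2) + c"
      using cocycle[OF \<omega>(1), of "ad i - e2" "ad j" 0] cocycle[OF \<omega>(1), of "ad i - e2" "ad j" "ad (m + 1)"]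
      by linarith+
  qed
  have shift_ad: "ad l - e2 + ad i = ad (l + i) - e2" for i by (simp add: prod_eq_iff)
  have "h \<omega> (ad (l + i) - e2) (ad l - e2) \<le> c - \<delta> \<and> h \<omega> (ad (l + i) - e2) (ad (r + 1) - e2) \<le> c - \<delta>"
    if "i \<in> {1..r - l}" for i
  proof -
    have i: "l < l + i" "l + i \<le> r" using that by auto
    have "b \<omega> (ad (l + i) - e2) (ad l - e2) + b \<omega> (ad l - e2) 0 = b \<omega> (ad (l + i) - e2) 0"
      "b \<omega> (ad (l + i) - e2) (ad (r + 1) - e2) + b \<omega> (ad (r + 1) - e2) (ad (m + 1)) = b \<omega> (ad (l + i) - e2) (ad (m + 1))"
      by (rule cocycle[OF \<omega>(1)])+
    then show ?thesis
      unfolding h_eq[OF \<omega>(1)] using inner[OF i] low[OF i] left right high by linarith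
  qed
  moreover have "l + (r - l) = r" "l + (r - l + 1) = r + 1" by simp_all
  ultimately show ?thesis
    unfolding valley_def shift_ad using width(3,4) by simp
qed

lemma prob_weights_pos:
  assumes J: "finite J" "J \<noteq> {}" and A: "\<And>x. x \<in> J \<Longrightarrow> A x \<in> sets borel"
    and pos: "\<And>x. x \<in> J \<Longrightarrow> 0 < prob {\<omega>. W \<omega> 0 \<in> A x}"
  shows "0 < prob {\<omega>. \<forall>x\<in>J. W \<omega> x \<in> A x}"
proof -
  have "{\<omega>. \<forall>x\<in>J. W \<omega> x \<in> A x} = (\<Inter>x\<in>J. (\<lambda>\<omega>. W \<omega> x) -` A x \<inter> space M)"
    using J by (auto simp: space_M)
  then have "prob {\<omega>. \<forall>x\<in>J. W \<omega> x \<in> A x} = (\<Prod>x\<in>J. prob ((\<lambda>\<omega>. W \<omega> x) -` A x \<inter> space M))"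
    using indep_varsD[OF W_indep J(2,1), of A] A by simp
  also have "\<dots> = (\<Prod>x\<in>J. prob {\<omega>. W \<omega> 0 \<in> A x})"
  proof (rule prod.cong)
    fix x assume "x \<in> J"
    then show "prob ((\<lambda>\<omega>. W \<omega> x) -` A x \<inter> space M) = prob {\<omega>. W \<omega> 0 \<in> A x}"
      using prob_W_cong[OF A, of x x] prob_W_cong[OF A, of x 0] by (simp add: vimage_def space_M)
  qed simp
  also have "0 < \<dots>" using pos by (intro prod_pos) auto
  finally show ?thesis .
qed

text \<open>For fixed \<open>l\<close> and \<open>r\<close> the event \<open>H\<close> depends only
  on levels from 0 upwards, while the favourable weights \<open>V\<close> lie on level -1 and have
  positive probability. On both events a deeper valley appears one level below, which stationarity
  and the hypothesis exclude; by independence \<open>H\<close> is null.\<close>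

lemma no_valley_step:
  assumes ad: "0 < \<delta>" "prob {\<omega>. W \<omega> 0 \<le> a} > 0" "prob {\<omega>. a + \<delta> \<le> W \<omega> 0} > 0" and m: "1 \<le> m"
    and no: "\<And>l r. l + 1 \<le> r \<Longrightarrow> (c < 0 \<Longrightarrow> l = 0 \<and> r = m - 1) \<Longrightarrow>
      AE \<omega> in M. \<not> valley \<omega> 0 (r - l) (c - \<delta>)"
  shows "AE \<omega> in M. \<not> valley \<omega> 0 m c"
proof -
  define L where "L \<omega> = (if h \<omega> 0 (ad 1) \<le> 0 then -1 else (0::int))" for \<omega>
  define R where "R \<omega> = (if h \<omega> (ad m) (ad (m + 1)) \<le> 0 then m - 1 else m)" for \<omega>
  have "AE \<omega> in M. \<not> (valley \<omega> 0 m c \<and> L \<omega> = l \<and> R \<omega> = r)" for l r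
  proof (cases "l + 1 \<le> r \<and> (c < 0 \<longrightarrow> l = 0 \<and> r = m - 1)")
    case False
    from AE_\<Omega>\<^sub>0 AE_tidy show ?thesis
    proof eventually_elim
      case (elim \<omega>)
      show ?case
      proof
        assume v: "valley \<omega> 0 m c \<and> L \<omega> = l \<and> R \<omega> = r"
        show False
          using False valley_width(1,2)[OF elim m, of c "L \<omega>" "R \<omega>"] v by (auto simp: L_def R_def)
      qed
    qed
  next
    case True
    define J where "J = (\<lambda>i. ad i - e2) ` {l..r + 1}"
    \<comment> \<open>\<open>ad i - e2\<close> has first coordinate \<open>i\<close>: low weights
      are asked for strictly inside, high ones at the new border positions \<open>l\<close> and
      \<open>r + 1\<close>.\<close>
    define A where "A x = (if l < fst x \<and> fst x \<le> r then {..a} else {a + \<delta>..})" for x :: site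
    define H where "H = {\<omega>. valley \<omega> 0 m c \<and> L \<omega> = l \<and> R \<omega> = r}"
    define V where "V = {\<omega>. \<forall>x\<in>J. W \<omega> x \<in> A x}"
    have lev: "level x = -1" if "x \<in> J" for x using that by (auto simp: J_def level_def)
    have V_pos: "0 < prob V"
      unfolding V_def using True ad by (intro prob_weights_pos) (auto simp: J_def A_def)
    have "H \<in> gen_events M {(\<lambda>\<omega>. b \<omega> x y) | x y. 0 \<le> level x \<and> x \<le> y}"
    proof -
      obtain N where N: "sets N = gen_events M {(\<lambda>\<omega>. b \<omega> x y) | x y. 0 \<le> level x \<and> x \<le> y}" "space N = space M"
        "\<And>f. f \<in> {(\<lambda>\<omega>. b \<omega> x y) | x y. 0 \<le> level x \<and> x \<le> y} \<Longrightarrow> f \<in> borel_measurable N"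
        using gen_events_measure by blast
      have b: "(\<lambda>\<omega>. b \<omega> x y) \<in> borel_measurable N" if "0 \<le> level x" "x \<le> y" for x y
        using that by (intro N(3)) blast
      have "0 \<le> level (0::site)" by (simp add: level_def)
      with measurable_valley[of 0 N 0 m c] b have [measurable]: "Measurable.pred N (\<lambda>\<omega>. valley \<omega> 0 m c)" by blast
      have [measurable]: "(\<lambda>\<omega>. h \<omega> 0 (ad 1)) \<in> borel_measurable N"
        "(\<lambda>\<omega>. h \<omega> (ad m) (ad (m + 1))) \<in> borel_measurable N"
        by (rule measurable_h[where k = 0]; simp add: b level_def)+
      have "Measurable.pred N (\<lambda>\<omega>. valley \<omega> 0 m c \<and> L \<omega> = l \<and> R \<omega> = r)"
        unfolding L_def R_def by measurable
      then show ?thesis unfolding H_def N(1)[symmetric] by (simp add: pred_def N(2) space_M)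
    qed
    moreover have "V \<in> gen_events M {(\<lambda>\<omega>. W \<omega> x) | x. level x < 0}"
    proof -
      obtain N where N: "sets N = gen_events M {(\<lambda>\<omega>. W \<omega> x) | x. level x < 0}" "space N = space M"
        "\<And>f. f \<in> {(\<lambda>\<omega>. W \<omega> x) | x. level x < 0} \<Longrightarrow> f \<in> borel_measurable N"
        using gen_events_measure by blast
      have "Measurable.pred N (\<lambda>\<omega>. W \<omega> x \<in> A x)" if "x \<in> J" for x
      proof -
        have [measurable]: "(\<lambda>\<omega>. W \<omega> x) \<in> borel_measurable N"
          by (rule N(3)) (rule CollectI, rule exI[of _ x], use lev[OF that] in simp)
        have [measurable]: "A x \<in> sets borel" by (simp add: A_def)
        show ?thesis by measurable
      qed
      then have "Measurable.pred N (\<lambda>\<omega>. \<forall>x\<in>J. W \<omega> x \<in> A x)"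
        by (intro pred_intros_finite) (auto simp: J_def)
      then show ?thesis unfolding V_def N(1)[symmetric] by (simp add: pred_def N(2) space_M)
    qed
    ultimately have prod: "prob (H \<inter> V) = prob H * prob V"
      using indep_setD[OF indep_levels] by blast
    have ev: "H \<in> events" "V \<in> events"
    proof -
      have [measurable]: "(\<lambda>\<omega>. h \<omega> x y) \<in> borel_measurable M" for x y
        unfolding h_def Let_def by measurable
      have "Measurable.pred M (\<lambda>\<omega>. valley \<omega> 0 m c \<and> L \<omega> = l \<and> R \<omega> = r)"
        unfolding L_def R_def by measurable
      then show "H \<in> events" by (simp add: H_def pred_def space_M)
      have [measurable]: "A x \<in> sets borel" for x by (simp add: A_def)
      have "Measurable.pred M (\<lambda>\<omega>. \<forall>x\<in>J. W \<omega> x \<in> A x)"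
        by (intro pred_intros_finite) (auto simp: J_def)
      then show "V \<in> events" by (simp add: V_def pred_def space_M)
    qed
    have "AE \<omega> in M. \<not> valley (T (ad l - e2) \<omega>) 0 (r - l) (c - \<delta>)"
      using True by (intro AE_shift no) auto
    with AE_\<Omega>\<^sub>0 AE_tidy have "AE \<omega> in M. \<omega> \<notin> H \<inter> V"
    proof eventually_elim
      case (elim \<omega>)
      show ?case
      proof
        assume HV: "\<omega> \<in> H \<inter> V"
        have W: "W \<omega> (ad i - e2) \<in> A (ad i - e2)" if "l \<le> i" "i \<le> r + 1" for i
          using HV that unfolding V_def J_def by auto
        have "valley \<omega> (ad l - e2) (r - l) (c - \<delta>)"
        proof (rule valley_deepens[OF elim(1,2) m])
          show "valley \<omega> 0 m c" "l = (if h \<omega> 0 (ad 1) \<le> 0 then - 1 else 0)"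
            "r = (if h \<omega> (ad m) (ad (m + 1)) \<le> 0 then m - 1 else m)"
            using HV by (auto simp: H_def L_def R_def)
          show "W \<omega> (ad i - e2) \<le> a" if "l < i" "i \<le> r" for i
            using W[of i] that by (auto simp: A_def)
          show "a + \<delta> \<le> W \<omega> (ad l - e2)" "a + \<delta> \<le> W \<omega> (ad (r + 1) - e2)"
            using W[of l] W[of "r + 1"] True by (auto simp: A_def)
        qed
        then show False using elim(3) valley_shift[OF elim(1), of 0 "ad l - e2"] by simp
      qed
    qed
    then have "prob (H \<inter> V) = 0" using ev prob_eq_0[of "H \<inter> V"] by blast
    then have "prob H = 0" using prod V_pos by simp
    then have "AE \<omega> in M. \<omega> \<notin> H" using ev prob_eq_0 by blast
    then show ?thesis by (simp add: H_def)
  qed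
  then have "AE \<omega> in M. \<forall>l r. \<not> (valley \<omega> 0 m c \<and> L \<omega> = l \<and> R \<omega> = r)"
    by (simp only: AE_all_countable) simp
  then show ?thesis by eventually_elim blast
qed

text \<open>Iterating the previous step, a valley can be made as deep as we like; once it is deep, it loses one
  site at every further step, until nothing is left.\<close>

lemma no_valley: "1 \<le> m \<Longrightarrow> AE \<omega> in M. \<not> valley \<omega> 0 m c"
proof -
  obtain a \<delta> where ad: "0 < \<delta>" "prob {\<omega>. W \<omega> 0 \<le> a} > 0" "prob {\<omega>. a + \<delta> \<le> W \<omega> 0} > 0"
    using W_spread by blast
  \<comment> \<open>With negative \<open>c\<close>, width 1 would shrink to width 0, which
    \<open>l + 1 \<le> r\<close> forbids; every larger width drops by one.\<close>
  have neg: "AE \<omega> in M. \<not> valley \<omega> 0 (int m) c" if "c < 0" "1 \<le> m" for m :: nat and c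
    using that(2,1)
  proof (induction m arbitrary: c rule: nat_induct_at_least)
    case base
    show ?case
    proof (rule no_valley_step[OF ad])
      fix l r :: int assume *: "l + 1 \<le> r" "c < 0 \<Longrightarrow> l = 0 \<and> r = int 1 - 1"
      then have False using *(2)[OF base] by simp
      then show "AE \<omega> in M. \<not> valley \<omega> 0 (r - l) (c - \<delta>)" ..
    qed simp
  next
    case (Suc m)
    show ?case
    proof (rule no_valley_step[OF ad])
      fix l r :: int assume *: "l + 1 \<le> r" "c < 0 \<Longrightarrow> l = 0 \<and> r = int (Suc m) - 1"
      have "r - l = int m" using *(2) Suc.prems by simp
      moreover have "AE \<omega> in M. \<not> valley \<omega> 0 (int m) (c - \<delta>)"
        using Suc.IH[of "c - \<delta>"] Suc.prems ad(1) by simp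
      ultimately show "AE \<omega> in M. \<not> valley \<omega> 0 (r - l) (c - \<delta>)" by simp
    qed simp
  qed
  \<comment> \<open>\<open>n\<close> bounds the number of deepenings by \<open>\<delta>\<close>
    before \<open>c\<close> is negative. The width may grow meanwhile, so the induction leaves it
    free.\<close>
  have all: "AE \<omega> in M. \<not> valley \<omega> 0 m c" if "1 \<le> m" "c < real n * \<delta>" for n m c
    using that
  proof (induction n arbitrary: m c)
    case 0
    then show ?case using neg[of c "nat m"] by simp
  next
    case (Suc n)
    show ?case
    proof (rule no_valley_step[OF ad Suc.prems(1)])
      fix l r :: int assume "l + 1 \<le> r"
      then show "AE \<omega> in M. \<not> valley \<omega> 0 (r - l) (c - \<delta>)"
        using Suc.prems(2) by (intro Suc.IH) (auto simp: algebra_simps)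
    qed
  qed
  assume "1 \<le> m"
  obtain n where "c < real n * \<delta>" using reals_Archimedean3[OF ad(1)] by blast
  then show ?thesis using all \<open>1 \<le> m\<close> by blast
qed

text \<open>Two separated pairs on one antidiagonal enclose a valley once \<open>c\<close> exceeds
  finitely many values, so almost surely there is at most one such pair. All positions have the same
  probability \<open>p\<close>, hence \<open>n\<close> of them give \<open>n * p \<le> 1\<close> for
  every \<open>n\<close>.\<close>

lemma AE_not_separated: "AE \<omega> in M. \<forall>z. \<not> sep \<omega> z"
proof -
  let ?S = "\<lambda>i. {\<omega>. sep \<omega> (ad i)}"
  have ev [measurable]: "?S i \<in> events" for i
    using pred_sep[of "ad i"] by (simp add: pred_def space_M)
  have pair: "AE \<omega> in M. \<not> (sep \<omega> (ad 0) \<and> sep \<omega> (ad m))" if "1 \<le> m" for m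
  proof -
    have "AE \<omega> in M. \<forall>k::nat. \<not> valley \<omega> 0 m (real k)"
      using no_valley[OF that] by (simp add: AE_all_countable)
    then show ?thesis
    proof eventually_elim
      case (elim \<omega>)
      define F where "F = (\<lambda>i. h \<omega> (ad i) 0) ` {1..m} \<union> (\<lambda>i. h \<omega> (ad i) (ad (m + 1))) ` {1..m}"
      have fin: "finite F" by (simp add: F_def)
      obtain k :: nat where k: "Max (insert 0 F) \<le> real k" using real_arch_simple by blast
      have "x \<le> real k" if "x \<in> F" for x
        using k Max_ge[of "insert 0 F" x] fin that by auto
      then have "h \<omega> (ad i) 0 \<le> real k \<and> h \<omega> (ad i) (ad (m + 1)) \<le> real k" if "i \<in> {1..m}" for i
        using that unfolding F_def by blast
      then show ?case using elim[rule_format, of k] by (auto simp: valley_def zero_prod_def)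
    qed
  qed
  have pair': "AE \<omega> in M. \<not> (sep \<omega> (ad i) \<and> sep \<omega> (ad j))" if "i < j" for i j
  proof -
    have "AE \<omega> in M. \<not> (sep (T (ad i) \<omega>) (ad 0) \<and> sep (T (ad i) \<omega>) (ad (j - i)))"
      using that by (intro AE_shift pair) simp
    with AE_\<Omega>\<^sub>0 show ?thesis
    proof eventually_elim
      case (elim \<omega>)
      have "ad 0 + ad i = ad i" "ad (j - i) + ad i = ad j" by (auto simp: prod_eq_iff)
      then show ?case using elim sep_shift[OF elim(1)] by metis
    qed
  qed
  have AE_all: "AE \<omega> in M. \<forall>i j. i < j \<longrightarrow> \<not> (sep \<omega> (ad i) \<and> sep \<omega> (ad j))"
    unfolding AE_all_countable
  proof (intro allI)
    fix i j :: int show "AE \<omega> in M. i < j \<longrightarrow> \<not> (sep \<omega> (ad i) \<and> sep \<omega> (ad j))"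
      using pair'[of i j] by (cases "i < j") auto
  qed
  define p where "p = prob {\<omega>. sep \<omega> 0}"
  have p: "prob {\<omega>. sep \<omega> z} = p" for z
    unfolding p_def using sep_shift[of _ 0 z] by (intro prob_shift[where z = z]) auto
  have "real n * p \<le> 1" for n
  proof -
    have "real n * p = (\<Sum>i<n. expectation (indicator (?S (int i))))"
      using p by simp
    also have "\<dots> = expectation (\<lambda>\<omega>. \<Sum>i<n. indicator (?S (int i)) \<omega>)"
      by (subst Bochner_Integration.integral_sum) (auto simp: less_top[symmetric])
    also have "\<dots> \<le> expectation (\<lambda>\<omega>. 1)"
    proof (rule integral_mono_AE)
      show "AE \<omega> in M. (\<Sum>i<n. indicator (?S (int i)) \<omega>) \<le> (1::real)"
        using AE_all
      proof eventually_elim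
        case (elim \<omega>)
        show ?case
        proof (cases "\<exists>i<n. sep \<omega> (ad (int i))")
          case True
          then obtain i where i: "i < n" "sep \<omega> (ad (int i))" by blast
          have "\<not> sep \<omega> (ad (int j))" if "j \<noteq> i" for j
            using elim[rule_format, of "int i" "int j"] elim[rule_format, of "int j" "int i"] i that by linarith
          then have "(\<Sum>j<n. indicator (?S (int j)) \<omega>) = (\<Sum>j<n. if j = i then 1 else (0::real))"
            using i by (intro sum.cong) (auto simp: indicator_def)
          then show ?thesis using i by simp
        next
          case False
          then have "(\<Sum>j<n. indicator (?S (int j)) \<omega>) = (0::real)"
            by (intro sum.neutral) (auto simp: indicator_def)
          then show ?thesis by simp
        qed
      qed
    qed (auto intro!: Bochner_Integration.integrable_sum simp: less_top[symmetric])
    finally show ?thesis by (simp add: prob_space)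
  qed
  moreover have "0 \<le> p" by (simp add: p_def)
  ultimately have "p = 0"
    using reals_Archimedean3[of p] by (metis linorder_not_less order_le_less mult.commute)
  then have "AE \<omega> in M. \<not> sep \<omega> z" for z
    using p[of z] prob_eq_0[of "{\<omega>. sep \<omega> z}"] pred_sep[of z] by (simp add: pred_def space_M)
  then show ?thesis by (simp only: AE_all_countable) simp
qed

theorem AE_coalescence:
  "AE \<omega> in M. \<forall>x y. \<exists>k. level x \<le> k \<and> level y \<le> k \<and>
    flow (busemann_step (b \<omega>) Plus) x k = flow (busemann_step (b \<omega>) Plus) y k"
  using AE_not_separated
proof eventually_elim
  case (elim \<omega>)
  show ?case
    unfolding s_def[symmetric]
    by (intro allI coalescence_of_not_separated step_s) (use elim in blast)
qed

end

section \<open>The shape function along the directions\<close>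

definition affine_between :: "(real \<Rightarrow> real) \<Rightarrow> real \<Rightarrow> real \<Rightarrow> bool" where
  "affine_between f a c \<longleftrightarrow> (\<exists>k d. \<forall>s\<in>{a..c}. f s = k * s + d)"

lemma affine_between_subset: "affine_between f a c \<Longrightarrow> a \<le> a' \<Longrightarrow> c' \<le> c \<Longrightarrow> affine_between f a' c'"
  unfolding affine_between_def by fastforce

lemma affine_between_refl: "affine_between f a a"
  unfolding affine_between_def by (intro exI[of _ 0] exI[of _ "f a"]) auto

fun at_side :: "sign \<Rightarrow> real \<Rightarrow> real filter" where
  "at_side Plus t = at_right t"
| "at_side Minus t = at_left t"

lemma at_side_not_bot [simp]: "at_side \<sigma> t \<noteq> bot"
  by (cases \<sigma>) (auto simp: trivial_limit_at_left_real trivial_limit_at_right_real)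

locale shape_function =
  fixes g :: "dir \<Rightarrow> real"
  assumes concave: "concave_on {x. 0 \<le> x} g"
    and symmetric: "\<And>a b. 0 \<le> a \<Longrightarrow> 0 \<le> b \<Longrightarrow> g (b, a) = g (a, b)"
    and homogeneous: "\<And>c x. 0 \<le> c \<Longrightarrow> 0 \<le> x \<Longrightarrow> g (c *\<^sub>R x) = c * g x"
begin

text \<open>On the segment of directions the shape function is a concave function of one variable,
  from which homogeneity recovers \<open>g\<close>.\<close>

definition f :: "real \<Rightarrow> real" where "f t = g (dir_of t)"

definition slope :: "real \<Rightarrow> real \<Rightarrow> real" where "slope t s = (f s - f t) / (s - t)"

lemma f_concave: "concave_on {0..1} f"
  unfolding concave_on_def convex_on_def
proof (intro conjI ballI allI impI)
  fix x y u v :: real assume *: "x \<in> {0..1}" "y \<in> {0..1}" "0 \<le> u" "0 \<le> v" "u + v = 1"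
  have "dir_of (u *\<^sub>R x + v *\<^sub>R y) = u *\<^sub>R dir_of x + v *\<^sub>R dir_of y"
    using *(5) by (auto simp: algebra_simps)
  moreover have "dir_of x \<in> {x. 0 \<le> x}" "dir_of y \<in> {x. 0 \<le> x}"
    using * by (auto simp: less_eq_prod_def zero_prod_def)
  ultimately show "- f (u *\<^sub>R x + v *\<^sub>R y) \<le> u * - f x + v * - f y"
    using concave * unfolding concave_on_def convex_on_def f_def by fastforce
qed (rule convex_closed_interval)

lemma chord_le:
  assumes "0 \<le> a" "a < s" "s < c" "c \<le> 1"
  shows "(c - s) * f a + (s - a) * f c \<le> (c - a) * f s"
proof -
  define u where "u = (c - s) / (c - a)"
  define v where "v = (s - a) / (c - a)"
  have uv: "0 \<le> u" "0 \<le> v" "u + v = 1"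
    using assms by (auto simp: u_def v_def add_divide_distrib[symmetric])
  have "u * a + v * c = ((c - s) * a + (s - a) * c) / (c - a)"
    by (simp add: u_def v_def add_divide_distrib)
  also have "(c - s) * a + (s - a) * c = s * (c - a)" by (simp add: algebra_simps)
  finally have "u * a + v * c = s" using assms by simp
  moreover have "- f (u *\<^sub>R a + v *\<^sub>R c) \<le> u * - f a + v * - f c"
    using f_concave assms uv unfolding concave_on_def convex_on_def by simp
  ultimately have "u * f a + v * f c \<le> f s" by simp
  then have "(c - a) * (u * f a + v * f c) \<le> (c - a) * f s" using assms by (intro mult_left_mono) auto
  moreover have "(c - a) * u = c - s" "(c - a) * v = s - a" using assms by (simp_all add: u_def v_def)
  then have "(c - a) * (u * f a + v * f c) = (c - s) * f a + (s - a) * f c"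
    by (simp only: distrib_left mult.assoc[symmetric])
  ultimately show ?thesis by simp
qed

lemma slope_eq: "s \<noteq> t \<Longrightarrow> f s = f t + slope t s * (s - t)"
  by (simp add: slope_def)

lemma slope_antimono:
  assumes "0 \<le> a" "a < c" "c \<le> 1" "a \<noteq> t" "c \<noteq> t" "0 \<le> t" "t \<le> 1"
  shows "slope t c \<le> slope t a"
proof -
  consider "t < a" | "a < t" "t < c" | "c < t" using assms by linarith
  then show ?thesis
  proof cases
    case 1
    then have "(c - a) * f t + (a - t) * f c \<le> (c - t) * f a" using chord_le[of t a c] assms by auto
    then show ?thesis using 1 assms by (simp add: slope_def divide_simps) (simp add: algebra_simps)
  next
    case 2
    then have "(c - t) * f a + (t - a) * f c \<le> (c - a) * f t" using chord_le[of a t c] assms by auto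
    then show ?thesis using 2 assms by (simp add: slope_def divide_simps) (simp add: algebra_simps)
  next
    case 3
    then have "(t - c) * f a + (c - a) * f t \<le> (t - a) * f c" using chord_le[of a c t] assms by auto
    then show ?thesis using 3 assms by (simp add: slope_def divide_simps) (simp add: algebra_simps)
  qed
qed

definition D :: "sign \<Rightarrow> real \<Rightarrow> real" where "D \<sigma> t = Lim (at_side \<sigma> t) (slope t)"

text \<open>Slopes from \<open>t\<close> decrease in their other endpoint, even across
  \<open>t\<close>. From the left they therefore converge to their infimum, which the slopes to the
  right of \<open>t\<close> keep finite.\<close>

lemma slope_left:
  assumes "0 < t" "t < 1"
  shows "(slope t \<longlongrightarrow> D Minus t) (at_left t)" "\<And>s. 0 \<le> s \<Longrightarrow> s < t \<Longrightarrow> D Minus t \<le> slope t s"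
    "\<And>s. t < s \<Longrightarrow> s \<le> 1 \<Longrightarrow> slope t s \<le> D Minus t"
proof -
  define L where "L = (INF s\<in>{0..<t}. slope t s)"
  have bdd: "bdd_below (slope t ` {0..<t})"
    using assms by (intro bdd_belowI2[of _ "slope t 1"] slope_antimono) auto
  have ge: "L \<le> slope t s" if "0 \<le> s" "s < t" for s
    unfolding L_def using that by (intro cINF_lower bdd) auto
  have le: "slope t s \<le> L" if "t < s" "s \<le> 1" for s
    unfolding L_def using that assms by (intro cINF_greatest slope_antimono) auto
  have "(slope t \<longlongrightarrow> L) (at_left t)"
  proof (rule order_tendstoI)
    fix a assume "a < L"
    have "\<forall>\<^sub>F s in at_left t. 0 \<le> s \<and> s < t"
      using assms by (auto simp: eventually_at_left[of 0 t] intro!: exI[of _ 0])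
    then show "\<forall>\<^sub>F s in at_left t. a < slope t s"
      by eventually_elim (use ge \<open>a < L\<close> in \<open>auto intro: less_le_trans\<close>)
  next
    fix a assume "L < a"
    then obtain s0 where s0: "0 \<le> s0" "s0 < t" "slope t s0 < a"
      unfolding L_def using cINF_less_iff[OF _ bdd] assms by auto
    have "\<forall>\<^sub>F s in at_left t. s0 < s \<and> s < t"
      using s0 by (auto simp: eventually_at_left[of s0 t] intro!: exI[of _ s0])
    then show "\<forall>\<^sub>F s in at_left t. slope t s < a"
    proof eventually_elim
      case (elim s)
      then show ?case using slope_antimono[of s0 s t] s0 assms by auto
    qed
  qed
  then have "D Minus t = L" unfolding D_def using tendsto_Lim[of "at_side Minus t"] at_side_not_bot by simp
  then show "(slope t \<longlongrightarrow> D Minus t) (at_left t)" "\<And>s. 0 \<le> s \<Longrightarrow> s < t \<Longrightarrow> D Minus t \<le> slope t s"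
    "\<And>s. t < s \<Longrightarrow> s \<le> 1 \<Longrightarrow> slope t s \<le> D Minus t"
    using \<open>(slope t \<longlongrightarrow> L) (at_left t)\<close> ge le by auto
qed

lemma f_reflect: "0 \<le> t \<Longrightarrow> t \<le> 1 \<Longrightarrow> f (1 - t) = f t"
  unfolding f_def using symmetric[of t "1 - t"] by simp

lemma slope_reflect: "0 \<le> t \<Longrightarrow> t \<le> 1 \<Longrightarrow> 0 \<le> s \<Longrightarrow> s \<le> 1 \<Longrightarrow> slope (1 - t) (1 - s) = - slope t s"
  unfolding slope_def by (simp add: f_reflect) (metis minus_diff_eq minus_divide_right)

text \<open>The symmetry of \<open>g\<close> reflects \<open>t\<close> to \<open>1 - t\<close> and
  exchanges the two sides.\<close>

lemma slope_right:
  assumes t: "0 < t" "t < 1"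
  shows "D Plus t = - D Minus (1 - t)" "(slope t \<longlongrightarrow> D Plus t) (at_right t)"
    "\<And>s. t < s \<Longrightarrow> s \<le> 1 \<Longrightarrow> slope t s \<le> D Plus t" "\<And>s. 0 \<le> s \<Longrightarrow> s < t \<Longrightarrow> D Plus t \<le> slope t s"
proof -
  note left = slope_left[of "1 - t"]
  have "filterlim (\<lambda>s. 1 - s) (at_left (1 - t)) (at_right t)"
    unfolding filterlim_at
    by (auto simp: eventually_at_filter intro!: tendsto_eq_intros)
  then have "((\<lambda>s. slope (1 - t) (1 - s)) \<longlongrightarrow> D Minus (1 - t)) (at_right t)"
    using left(1) t filterlim_compose by fastforce
  then have lim: "((\<lambda>s. - slope (1 - t) (1 - s)) \<longlongrightarrow> - D Minus (1 - t)) (at_right t)" by (rule tendsto_minus)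
  have "\<forall>\<^sub>F s in at_right t. - slope (1 - t) (1 - s) = slope t s"
    unfolding eventually_at_right[OF t(2)] using t
    by (intro exI[of _ 1]) (auto simp: slope_reflect)
  then have *: "(slope t \<longlongrightarrow> - D Minus (1 - t)) (at_right t)"
    using lim Lim_transform_eventually by fast
  then show eq: "D Plus t = - D Minus (1 - t)"
    unfolding D_def[of Plus] using tendsto_Lim[of "at_side Plus t"] at_side_not_bot by simp
  then show "(slope t \<longlongrightarrow> D Plus t) (at_right t)" using * by simp
  show "slope t s \<le> D Plus t" if "t < s" "s \<le> 1" for s
    using left(2)[of "1 - s"] slope_reflect[of t s] that t eq by simp
  show "D Plus t \<le> slope t s" if "0 \<le> s" "s < t" for s
    using left(3)[of "1 - s"] slope_reflect[of t s] that t eq by simp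
qed

lemma D_le: "0 < t \<Longrightarrow> t < 1 \<Longrightarrow> D Plus t \<le> D Minus t"
proof -
  assume t: "0 < t" "t < 1"
  have "\<forall>\<^sub>F s in at_left t. D Plus t \<le> slope t s"
    using slope_right(4)[OF t] t by (auto simp: eventually_at_left[of 0 t] intro!: exI[of _ 0])
  then show ?thesis using tendsto_lowerbound[OF slope_left(1)[OF t]] by simp
qed

lemma slope_lim: "0 < t \<Longrightarrow> t < 1 \<Longrightarrow> (slope t \<longlongrightarrow> D \<sigma> t) (at_side \<sigma> t)"
  using slope_left(1) slope_right(2) by (cases \<sigma>) auto

lemma f_lim:
  assumes "0 < t" "t < 1"
  shows "(f \<longlongrightarrow> f t) (at_side \<sigma> t)"
proof -
  have id: "((\<lambda>s. s) \<longlongrightarrow> t) (at_side \<sigma> t)" by (cases \<sigma>) auto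
  have "((\<lambda>s. f t + slope t s * (s - t)) \<longlongrightarrow> f t + D \<sigma> t * (t - t)) (at_side \<sigma> t)"
    by (intro tendsto_intros slope_lim assms id)
  moreover have "\<forall>\<^sub>F s in at_side \<sigma> t. f t + slope t s * (s - t) = f s"
    by (cases \<sigma>) (auto simp: eventually_at_filter slope_def)
  ultimately show ?thesis using Lim_transform_eventually by fastforce
qed

lemma f_affine_D:
  assumes "a < c" "\<And>s. s \<in> {a..c} \<Longrightarrow> f s = k * s + d"
  shows "0 < c \<Longrightarrow> c < 1 \<Longrightarrow> D Minus c = k" "0 < a \<Longrightarrow> a < 1 \<Longrightarrow> D Plus a = k"
proof -
  have *: "slope u s = k" if "u \<in> {a..c}" "s \<in> {a..c}" "s \<noteq> u" for u s
  proof -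
    have "f s - f u = k * (s - u)" using assms(2) that by (simp add: algebra_simps)
    then show ?thesis using that(3) by (simp add: slope_def)
  qed
  show "D Minus c = k" if "0 < c" "c < 1"
  proof -
    have "\<forall>\<^sub>F s in at_left c. slope c s = k"
      unfolding eventually_at_left[OF assms(1)] using * by (intro exI[of _ a]) (use assms(1) in auto)
    then have "(slope c \<longlongrightarrow> k) (at_left c)" by (rule tendsto_eventually)
    then show ?thesis using slope_left(1)[OF that] tendsto_unique[of "at_left c"] by auto
  qed
  show "D Plus a = k" if "0 < a" "a < 1"
  proof -
    have "\<forall>\<^sub>F s in at_right a. slope a s = k"
      unfolding eventually_at_right[OF assms(1)] using * by (intro exI[of _ c]) (use assms(1) in auto)
    then have "(slope a \<longlongrightarrow> k) (at_right a)" by (rule tendsto_eventually)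
    then show ?thesis using slope_right(2)[OF that] tendsto_unique[of "at_right a"] by auto
  qed
qed

text \<open>By homogeneity the partial difference quotients of \<open>g\<close> become difference quotients of \<open>f\<close> at a point
  that approaches \<open>t\<close> from the same side.\<close>

lemma grad_eq:
  assumes t: "0 < t" "t < 1"
  shows "grad g (dir_of t) \<sigma> = (f t + (1 - t) * D \<sigma> t, f t - t * D \<sigma> t)"
proof -
  define c where "c = sgn_val \<sigma>"
  have c: "c = 1 \<or> c = -1" by (cases \<sigma>) (auto simp: c_def)
  have id: "((\<lambda>\<epsilon>. \<epsilon>) \<longlongrightarrow> (0::real)) (at_right 0)" by simp
  have small: "\<forall>\<^sub>F \<epsilon> in at_right (0::real). 0 < \<epsilon> \<and> \<epsilon> < min t (1 - t)"
    unfolding eventually_at_right[OF zero_less_one] using t by (intro exI[of _ "min t (1 - t)"]) auto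
  have side: "filterlim u (at_side \<sigma> t) (at_right 0)"
    if "(u \<longlongrightarrow> t) (at_right (0::real))" "\<forall>\<^sub>F \<epsilon> in at_right 0. 0 < c * (u \<epsilon> - t)" for u
    using that by (cases \<sigma>) (auto simp: filterlim_at c_def elim!: eventually_mono)
  have g_eq: "g (x, y) = (x + y) * f (x / (x + y))" if "0 < x" "0 < y" for x y
  proof -
    have "(x, y) = (x + y) *\<^sub>R dir_of (x / (x + y))" using that by (simp add: field_simps)
    moreover have "0 \<le> dir_of (x / (x + y))" using that by (auto simp: less_eq_prod_def)
    ultimately show ?thesis using homogeneous[of "x + y" "dir_of (x / (x + y))"] that
      unfolding f_def by simp
  qed
  \<comment> \<open>The point shifted along \<open>e1\<close> has coordinate sum
    \<open>1 + c * \<epsilon>\<close>; \<open>u \<epsilon>\<close> is its first coordinate after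
    scaling back to the segment.\<close>
  define u where "u \<epsilon> = (t + c * \<epsilon>) / (1 + c * \<epsilon>)" for \<epsilon>
  have u_diff: "u \<epsilon> - t = c * \<epsilon> * ((1 - t) / (1 + c * \<epsilon>))" if "0 < \<epsilon>" "\<epsilon> < min t (1 - t)" for \<epsilon>
    using c that t by (auto simp: u_def field_simps)
  have cc: "c * (c * x) = x" for x using c by auto
  have u_lim: "(u \<longlongrightarrow> t) (at_right 0)"
    unfolding u_def by (rule tendsto_eq_intros id | simp)+
  have "filterlim u (at_side \<sigma> t) (at_right 0)"
  proof (rule side[OF u_lim])
    show "\<forall>\<^sub>F \<epsilon> in at_right 0. 0 < c * (u \<epsilon> - t)"
      using small
    proof eventually_elim
      case (elim \<epsilon>)
      then have "0 < 1 + c * \<epsilon>" using c t by auto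
      then have "0 < \<epsilon> * ((1 - t) / (1 + c * \<epsilon>))" using elim t by simp
      then show ?case using elim by (simp add: u_diff cc mult.assoc)
    qed
  qed
  note u_side = filterlim_compose[OF f_lim[OF t] this] filterlim_compose[OF slope_lim[OF t] this]
  have "((\<lambda>\<epsilon>. f (u \<epsilon>) + slope t (u \<epsilon>) * ((1 - t) / (1 + c * \<epsilon>))) \<longlongrightarrow> f t + D \<sigma> t * ((1 - t) / (1 + c * 0))) (at_right 0)"
    by (intro tendsto_intros u_side id) simp
  moreover have "\<forall>\<^sub>F \<epsilon> in at_right 0. f (u \<epsilon>) + slope t (u \<epsilon>) * ((1 - t) / (1 + c * \<epsilon>)) =
      (g (dir_of t + (c * \<epsilon>) *\<^sub>R e1) - g (dir_of t)) / (c * \<epsilon>)"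
    using small
  proof eventually_elim
    case (elim \<epsilon>)
    then have pos: "0 < 1 + c * \<epsilon>" "0 < t + c * \<epsilon>" "c * \<epsilon> \<noteq> 0" using c t by auto
    have "g (dir_of t + (c * \<epsilon>) *\<^sub>R e1) = (1 + c * \<epsilon>) * f (u \<epsilon>)"
      using g_eq[of "t + c * \<epsilon>" "1 - t"] pos t by (simp add: u_def algebra_simps)
    moreover have "f (u \<epsilon>) - f t = slope t (u \<epsilon>) * ((1 - t) / (1 + c * \<epsilon>)) * (c * \<epsilon>)"
      using slope_eq[of "u \<epsilon>" t] u_diff[of \<epsilon>] elim pos t by (cases "u \<epsilon> = t") (auto simp: mult_ac)
    ultimately show ?case using pos(3) by (simp add: f_def[symmetric] field_simps)
  qed
  ultimately have 1: "((\<lambda>\<epsilon>. (g (dir_of t + (c * \<epsilon>) *\<^sub>R e1) - g (dir_of t)) / (c * \<epsilon>)) \<longlongrightarrow> f t + (1 - t) * D \<sigma> t) (at_right 0)"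
    using Lim_transform_eventually by (fastforce simp: mult.commute)
  \<comment> \<open>The analogue for the shift along \<open>e2\<close>, where the coordinate sum is
    \<open>1 - c * \<epsilon>\<close>.\<close>
  define v where "v \<epsilon> = t / (1 - c * \<epsilon>)" for \<epsilon>
  have v_diff: "v \<epsilon> - t = c * \<epsilon> * (t / (1 - c * \<epsilon>))" if "0 < \<epsilon>" "\<epsilon> < min t (1 - t)" for \<epsilon>
    using c that t by (auto simp: v_def field_simps)
  have v_lim: "(v \<longlongrightarrow> t) (at_right 0)"
    unfolding v_def by (rule tendsto_eq_intros id | simp)+
  have "filterlim v (at_side \<sigma> t) (at_right 0)"
  proof (rule side[OF v_lim])
    show "\<forall>\<^sub>F \<epsilon> in at_right 0. 0 < c * (v \<epsilon> - t)"
      using small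
    proof eventually_elim
      case (elim \<epsilon>)
      then have "0 < 1 - c * \<epsilon>" using c t by auto
      then have "0 < \<epsilon> * (t / (1 - c * \<epsilon>))" using elim t by simp
      then show ?case using elim by (simp add: v_diff cc mult.assoc)
    qed
  qed
  note v_side = filterlim_compose[OF f_lim[OF t] this] filterlim_compose[OF slope_lim[OF t] this]
  have "((\<lambda>\<epsilon>. f (v \<epsilon>) - slope t (v \<epsilon>) * (t / (1 - c * \<epsilon>))) \<longlongrightarrow> f t - D \<sigma> t * (t / (1 - c * 0))) (at_right 0)"
    by (intro tendsto_intros v_side id) simp
  moreover have "\<forall>\<^sub>F \<epsilon> in at_right 0. f (v \<epsilon>) - slope t (v \<epsilon>) * (t / (1 - c * \<epsilon>)) =
      (g (dir_of t - (c * \<epsilon>) *\<^sub>R e2) - g (dir_of t)) / (- (c * \<epsilon>))"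
    using small
  proof eventually_elim
    case (elim \<epsilon>)
    then have pos: "0 < 1 - c * \<epsilon>" "0 < 1 - t - c * \<epsilon>" "c * \<epsilon> \<noteq> 0" using c t by auto
    have "g (dir_of t - (c * \<epsilon>) *\<^sub>R e2) = (1 - c * \<epsilon>) * f (v \<epsilon>)"
      using g_eq[of t "1 - t - c * \<epsilon>"] pos t by (simp add: v_def algebra_simps)
    moreover have "f (v \<epsilon>) - f t = slope t (v \<epsilon>) * (t / (1 - c * \<epsilon>)) * (c * \<epsilon>)"
      using slope_eq[of "v \<epsilon>" t] v_diff[of \<epsilon>] elim pos t by (cases "v \<epsilon> = t") (auto simp: mult_ac)
    ultimately show ?case using pos(3) by (simp add: f_def[symmetric] field_simps)
  qed
  ultimately have 2: "((\<lambda>\<epsilon>. (g (dir_of t - (c * \<epsilon>) *\<^sub>R e2) - g (dir_of t)) / (- (c * \<epsilon>))) \<longlongrightarrow> f t - t * D \<sigma> t) (at_right 0)"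
    using Lim_transform_eventually by (fastforce simp: mult.commute)
  show ?thesis
    unfolding grad_def c_def[symmetric]
    using tendsto_Lim[OF _ 1] tendsto_Lim[OF _ 2] by (simp add: trivial_limit_at_right_real)
qed

lemma dir_in_U_sided_iff:
  assumes "0 < t" "t < 1"
  shows "\<zeta> \<in> U_sided g (dir_of t) \<sigma> \<longleftrightarrow>
    (\<exists>v. \<zeta> = dir_of v \<and> 0 < v \<and> v < 1 \<and> f v - f t = D \<sigma> t * (v - t))"
proof -
  have "grad g (dir_of t) \<sigma> \<bullet> (dir_of v - dir_of t) = D \<sigma> t * (v - t)" for v
    unfolding grad_eq[OF assms] by (simp add: algebra_simps)
  then show ?thesis unfolding U_sided_def f_def by (auto simp: riU_iff)
qed

text \<open>If a tangent at \<open>t\<close> meets the graph again at \<open>v\<close>, slopes to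
  points between are squeezed between \<open>slope t v\<close> and a one-sided derivative. A contact
  on the side opposite to the sign of the tangent forces the two derivatives to agree, so affinity
  describes both signs together.\<close>

lemma U_at_iff:
  assumes t: "0 < t" "t < 1"
  shows "\<zeta> \<in> U_at g (dir_of t) \<longleftrightarrow>
    (\<exists>v. \<zeta> = dir_of v \<and> 0 < v \<and> v < 1 \<and> affine_between f (min v t) (max v t))"
proof -
  have "f v - f t = D Minus t * (v - t) \<or> f v - f t = D Plus t * (v - t) \<longleftrightarrow>
      affine_between f (min v t) (max v t)" (is "?L \<longleftrightarrow> ?R") if v: "0 < v" "v < 1" for v
  proof
    assume ?L
    then obtain \<sigma> where \<sigma>: "f v - f t = D \<sigma> t * (v - t)" by blast
    have "f s = D \<sigma> t * s + (f t - D \<sigma> t * t)" if s: "s \<in> {min v t..max v t}" for s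
    proof (cases "s = t \<or> s = v")
      case True
      then show ?thesis using \<sigma> by (auto simp: algebra_simps)
    next
      case False
      then have "v \<noteq> t" using s by auto
      then have sv: "slope t v = D \<sigma> t" using \<sigma> by (simp add: slope_def)
      have "slope t s = D \<sigma> t"
      proof (cases "v < t")
        case True
        then have "v < s" "s < t" using s False by auto
        then have "slope t s \<le> D \<sigma> t" "D Minus t \<le> slope t s" "D Plus t \<le> D Minus t" "D Minus t \<le> slope t v"
          using slope_antimono[of v s t] slope_left(2)[OF t, of s] slope_left(2)[OF t, of v] D_le[OF t] v t sv True by auto
        then show ?thesis using sv by (cases \<sigma>) auto
      next
        case False
        then have "t < s" "s < v" using s \<open>v \<noteq> t\<close> \<open>\<not> (s = t \<or> s = v)\<close> by auto
        then have "D \<sigma> t \<le> slope t s" "slope t s \<le> D Plus t" "D Plus t \<le> D Minus t" "slope t v \<le> D Plus t"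
          using slope_antimono[of s v t] slope_right(3)[OF t, of s] slope_right(3)[OF t, of v] D_le[OF t] v t sv by auto
        then show ?thesis using sv by (cases \<sigma>) auto
      qed
      then show ?thesis using slope_eq[of s t] False by (simp add: algebra_simps)
    qed
    then show ?R unfolding affine_between_def by blast
  next
    assume ?R
    then obtain k d where kd: "\<And>s. s \<in> {min v t..max v t} \<Longrightarrow> f s = k * s + d"
      unfolding affine_between_def by blast
    then have eq: "f v - f t = k * (v - t)" by (simp add: algebra_simps)
    consider "v = t" | "v < t" | "t < v" by linarith
    then show ?L
    proof cases
      case 2
      then have "D Minus t = k" using f_affine_D(1)[of v t k d] kd t by auto
      then show ?thesis using eq by simp
    next
      case 3
      then have "D Plus t = k" using f_affine_D(2)[of t v k d] kd t by auto
      then show ?thesis using eq by simp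
    qed simp
  qed
  then show ?thesis
    unfolding U_at_def Un_iff dir_in_U_sided_iff[OF t] by blast
qed

lemma D_eq_of_diff_dirs:
  assumes t: "0 < t" "t < 1" and "dir_of t \<in> diff_dirs g"
  shows "D Minus t = D Plus t"
proof -
  have "g differentiable (at (dir_of t))" using assms by (simp add: diff_dirs_def)
  moreover have "dir_of differentiable (at t)"
    by (intro differentiable_Pair differentiable_diff differentiable_const differentiable_ident)
  ultimately have "(g \<circ> dir_of) differentiable (at t)" by (intro differentiable_chain_at)
  moreover have "g \<circ> dir_of = f" by (auto simp: f_def)
  ultimately obtain d where "(f has_real_derivative d) (at t)" by (auto simp: real_differentiable_def)
  then have "(slope t \<longlongrightarrow> d) (at t)"
    unfolding slope_def has_field_derivative_iff by simp
  then have "(slope t \<longlongrightarrow> d) (at_left t)" "(slope t \<longlongrightarrow> d) (at_right t)"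
    by (auto simp: filterlim_at_split)
  then show ?thesis
    using slope_left(1)[OF t] slope_right(2)[OF t] tendsto_unique[of "at_left t" "slope t"] tendsto_unique[of "at_right t" "slope t"]
    by (metis trivial_limit_at_left_real trivial_limit_at_right_real)
qed

end

section \<open>Maximal linear segments of the shape function\<close>

context shape_function
begin

text \<open>All affine pieces ending at \<open>c\<close> have slope \<open>D Minus c\<close>, so
  they lie on one line, which reaches \<open>a\<close> by continuity.\<close>

lemma affine_between_close_left:
  assumes t: "0 < a" "a < c" "c < 1" and aff: "\<And>e. a < e \<Longrightarrow> e < c \<Longrightarrow> affine_between f e c"
  shows "affine_between f a c"
proof -
  define k where "k = D Minus c"
  have eq: "f s = f c + k * (s - c)" if "a < s" "s \<le> c" for s
  proof (cases "s = c")
    case False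
    then have "affine_between f s c" using aff that by simp
    then obtain k' d where *: "\<And>r. r \<in> {s..c} \<Longrightarrow> f r = k' * r + d"
      unfolding affine_between_def by blast
    then have "k' = k" using f_affine_D(1)[of s c k' d] False that t by (auto simp: k_def)
    then show ?thesis using *[of s] *[of c] False that by (simp add: algebra_simps)
  qed simp
  have "f s = k * s + (f c - k * c)" if "s \<in> {a..c}" for s
  proof (cases "s = a")
    case True
    have "\<forall>\<^sub>F s in at_right a. f c + k * (s - c) = f s"
      unfolding eventually_at_right[OF t(2)]
      by (intro exI[of _ c] conjI t(2) allI impI eq[symmetric]) auto
    moreover have "((\<lambda>s. f c + k * (s - c)) \<longlongrightarrow> f c + k * (a - c)) (at_right a)"
      by (intro tendsto_intros)
    ultimately have "(f \<longlongrightarrow> f c + k * (a - c)) (at_right a)" by (rule Lim_transform_eventually[rotated])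
    then have "f a = f c + k * (a - c)"
      using f_lim[of a Plus] t tendsto_unique[of "at_right a" f] by auto
    then show ?thesis using True by (simp add: algebra_simps)
  next
    case False
    then show ?thesis using eq[of s] that by (simp add: algebra_simps)
  qed
  then show ?thesis unfolding affine_between_def by blast
qed

lemma affine_between_reflect:
  assumes "affine_between f a c" "0 \<le> a" "c \<le> 1"
  shows "affine_between f (1 - c) (1 - a)"
proof -
  obtain k d where kd: "\<And>s. s \<in> {a..c} \<Longrightarrow> f s = k * s + d" using assms(1) unfolding affine_between_def by blast
  have "f s = - k * s + (k + d)" if "s \<in> {1 - c..1 - a}" for s
    using kd[of "1 - s"] f_reflect[of s] that assms by (auto simp: algebra_simps)
  then show ?thesis unfolding affine_between_def by blast
qed

lemma affine_between_reflect_iff: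
  "0 \<le> a \<Longrightarrow> c \<le> 1 \<Longrightarrow> affine_between f (1 - c) (1 - a) \<longleftrightarrow> affine_between f a c"
proof -
  assume "0 \<le> a" "c \<le> 1"
  moreover have "affine_between f a c" if "affine_between f (1 - c) (1 - a)"
    using affine_between_reflect[OF that] \<open>0 \<le> a\<close> \<open>c \<le> 1\<close> by simp
  ultimately show ?thesis using affine_between_reflect by blast
qed

lemma affine_between_close_right:
  assumes t: "0 < a" "a < c" "c < 1" and aff: "\<And>e. a < e \<Longrightarrow> e < c \<Longrightarrow> affine_between f a e"
  shows "affine_between f a c"
proof -
  have "affine_between f (1 - c) (1 - a)"
  proof (rule affine_between_close_left)
    fix e assume "1 - c < e" "e < 1 - a"
    then show "affine_between f e (1 - a)"
      using affine_between_reflect[OF aff[of "1 - e"]] t by simp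
  qed (use t in auto)
  then show ?thesis using affine_between_reflect_iff[of a c] t by simp
qed

text \<open>The left end of the largest interval to the left of \<open>t\<close> on which \<open>f\<close> is affine; the hypothesis
  \<open>reg\<close> is what the regularity condition says about \<open>f\<close>.\<close>

lemma left_end:
  assumes t: "0 < t" "t < 1" and end_left: "\<exists>a. 0 < a \<and> a < t \<and> \<not> affine_between f a t"
    and reg: "\<And>r v. 0 < r \<Longrightarrow> r < 1 \<Longrightarrow> 0 < v \<Longrightarrow> v < 1 \<Longrightarrow> v \<noteq> r \<Longrightarrow>
      affine_between f (min v r) (max v r) \<Longrightarrow> D Minus r = D Plus r"
  obtains l where "0 < l" "l \<le> t" "affine_between f l t" "D Minus l = D Minus t"
    "\<And>z. 0 < z \<Longrightarrow> z < l \<Longrightarrow> \<not> affine_between f z l"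
    "\<And>v. 0 < v \<Longrightarrow> v < t \<Longrightarrow> affine_between f v t \<Longrightarrow> l \<le> v"
proof -
  define S where "S = {v. 0 < v \<and> v \<le> t \<and> affine_between f v t}"
  define l where "l = Inf S"
  have tS: "t \<in> S" using t affine_between_refl by (simp add: S_def)
  have bdd: "bdd_below S" by (intro bdd_belowI[of _ 0]) (auto simp: S_def)
  obtain a where a: "0 < a" "a < t" "\<not> affine_between f a t" using end_left by blast
  have "a \<le> v" if "v \<in> S" for v
    using that a affine_between_subset[of f v t a t] by (force simp: S_def)
  then have "a \<le> l" unfolding l_def using tS by (intro cInf_greatest) auto
  then have l0: "0 < l" using a by simp
  have lt: "l \<le> t" unfolding l_def by (rule cInf_lower[OF tS bdd])
  have aff: "affine_between f l t"
  proof (cases "l = t")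
    case True
    then show ?thesis by (simp add: affine_between_refl)
  next
    case False
    show ?thesis
    proof (rule affine_between_close_left)
      fix e assume "l < e" "e < t"
      then obtain v where "v \<in> S" "v < e" using cInf_lessD[of S e] tS unfolding l_def by blast
      then show "affine_between f e t" using affine_between_subset[of f v t e t] by (auto simp: S_def)
    qed (use l0 lt False t in auto)
  qed
  \<comment> \<open>If \<open>l < t\<close>, the tangent at \<open>l\<close> touches the graph along
    the segment, and \<open>reg\<close> rules out a corner at \<open>l\<close>.\<close>
  have D: "D Minus l = D Minus t"
  proof (cases "l = t")
    case False
    then have "l < t" using lt by simp
    obtain k d where kd: "\<And>s. s \<in> {l..t} \<Longrightarrow> f s = k * s + d" using aff unfolding affine_between_def by blast
    have "D Minus t = k" "D Plus l = k"
      using f_affine_D[OF \<open>l < t\<close> kd] l0 t \<open>l < t\<close> by auto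
    moreover have "D Minus l = D Plus l"
      using reg[of l t] aff \<open>l < t\<close> l0 t by (simp add: min_absorb2 max_absorb1)
    ultimately show ?thesis by simp
  qed simp
  \<comment> \<open>Without a corner at \<open>l\<close>, an affine piece further left would have
    the same slope and prolong the segment beyond its infimum.\<close>
  have not: "\<not> affine_between f z l" if "0 < z" "z < l" for z
  proof
    assume "affine_between f z l"
    then obtain k d where kd: "\<And>s. s \<in> {z..l} \<Longrightarrow> f s = k * s + d" unfolding affine_between_def by blast
    have "D Minus l = k" using f_affine_D(1)[OF that(2) kd] l0 lt t by auto
    obtain k' d' where kd': "\<And>s. s \<in> {l..t} \<Longrightarrow> f s = k' * s + d'" using aff unfolding affine_between_def by blast
    have "f s = k * s + d" if "s \<in> {z..t}" for s
    proof (cases "s \<le> l")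
      case False
      then have "l < t" using that by auto
      then have "k' = k" using f_affine_D(1)[OF _ kd'] D \<open>D Minus l = k\<close> t by auto
      moreover have "d' = d" using kd[of l] kd'[of l] \<open>k' = k\<close> lt \<open>z < l\<close> by auto
      ultimately show ?thesis using kd'[of s] False that by auto
    qed (use kd that in auto)
    then have "z \<in> S" using that lt unfolding S_def affine_between_def by auto
    then show False using cInf_lower[OF _ bdd, of z] that by (simp add: l_def)
  qed
  have "l \<le> v" if "0 < v" "v < t" "affine_between f v t" for v
    unfolding l_def using that by (intro cInf_lower bdd) (auto simp: S_def)
  then show ?thesis using that[of l] l0 lt aff D not by blast
qed

lemma right_end:
  assumes t: "0 < t" "t < 1" and end_right: "\<exists>a. t < a \<and> a < 1 \<and> \<not> affine_between f t a"
    and reg: "\<And>r v. 0 < r \<Longrightarrow> r < 1 \<Longrightarrow> 0 < v \<Longrightarrow> v < 1 \<Longrightarrow> v \<noteq> r \<Longrightarrow>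
      affine_between f (min v r) (max v r) \<Longrightarrow> D Minus r = D Plus r"
  obtains l where "t \<le> l" "l < 1" "affine_between f t l" "D Plus l = D Plus t"
    "\<And>z. l < z \<Longrightarrow> z < 1 \<Longrightarrow> \<not> affine_between f l z"
    "\<And>v. t < v \<Longrightarrow> v < 1 \<Longrightarrow> affine_between f t v \<Longrightarrow> v \<le> l"
proof -
  show ?thesis
  proof (rule left_end[of "1 - t"])
    obtain a where "t < a" "a < 1" "\<not> affine_between f t a" using end_right by blast
    then show "\<exists>a. 0 < a \<and> a < 1 - t \<and> \<not> affine_between f a (1 - t)"
      using affine_between_reflect_iff[of t a] t by (intro exI[of _ "1 - a"]) auto
  next
    fix r v :: real
    assume "0 < r" "r < 1" "0 < v" "v < 1" "v \<noteq> r" "affine_between f (min v r) (max v r)"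
    then show "D Minus r = D Plus r" by (rule reg)
  next
    fix l
    assume l: "0 < l" "l \<le> 1 - t" "affine_between f l (1 - t)" "D Minus l = D Minus (1 - t)"
      and not: "\<And>z. 0 < z \<Longrightarrow> z < l \<Longrightarrow> \<not> affine_between f z l"
      and least: "\<And>v. 0 < v \<Longrightarrow> v < 1 - t \<Longrightarrow> affine_between f v (1 - t) \<Longrightarrow> l \<le> v"
    show ?thesis
    proof (rule that[of "1 - l"])
      show "affine_between f t (1 - l)" using affine_between_reflect[OF l(3)] l t by simp
      show "D Plus (1 - l) = D Plus t" using slope_right(1)[of "1 - l"] slope_right(1)[of t] l t by simp
      show "\<not> affine_between f (1 - l) z" if z: "1 - l < z" "z < 1" for z
      proof -
        have "0 \<le> 1 - l" using l t by simp
        then show ?thesis using not[of "1 - z"] affine_between_reflect[of "1 - l" z] z by auto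
      qed
      show "v \<le> 1 - l" if v: "t < v" "v < 1" "affine_between f t v" for v
        using least[of "1 - v"] affine_between_reflect[OF v(3)] v t by simp
    qed (use l t in auto)
  qed (use t in auto)
qed

text \<open>By \<open>grad_eq\<close> the components of the gradient are the values of the tangent
  line of \<open>f\<close> at 1 and at 0, so a common tangent line means equal gradients.\<close>

lemma grad_eq_of_affine:
  assumes "0 < a" "a < 1" "0 < c" "c < 1" "D \<sigma> a = D \<sigma> c" "f c - f a = D \<sigma> a * (c - a)"
  shows "grad g (dir_of a) \<sigma> = grad g (dir_of c) \<sigma>"
proof -
  have "f c = f a + D \<sigma> a * (c - a)" using assms(6) by simp
  then show ?thesis
    unfolding grad_eq[OF assms(1,2)] grad_eq[OF assms(3,4)] assms(5)[symmetric] by (simp add: algebra_simps)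
qed

end

section \<open>Directions of geodesics\<close>

text \<open>The index is the level, so the first coordinate alone determines the direction.\<close>

definition ratio :: "(int \<Rightarrow> site) \<Rightarrow> nat \<Rightarrow> real" where
  "ratio \<pi> n = real_of_int (fst (\<pi> (int n))) / real n"

lemma path_from_bounds:
  assumes "path_from x \<pi>" "level x \<le> k"
  shows "level (\<pi> k) = k \<and> fst x \<le> fst (\<pi> k) \<and> fst (\<pi> k) \<le> fst x + (k - level x)"
  using assms(2)
proof (induction k rule: int_ge_induct)
  case base
  then show ?case using assms(1) by (simp add: path_from_def)
next
  case (step k)
  have "\<pi> (k + 1) - \<pi> k \<in> {e1, e2}" using assms(1) step by (auto simp: path_from_def)
  then have "\<pi> (k + 1) = \<pi> k + e1 \<or> \<pi> (k + 1) = \<pi> k + e2"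
    by (metis add.commute diff_add_cancel insert_iff singletonD)
  then show ?case using step by auto
qed

lemma ratio_subsequence:
  fixes r :: "nat \<Rightarrow> nat"
  assumes \<pi>: "path_from x \<pi>" and r: "strict_mono r"
  obtains r' a where "strict_mono r'" "(\<lambda>j. ratio \<pi> (r (r' j))) \<longlonglongrightarrow> a"
proof -
  \<comment> \<open>The shift by \<open>N\<close> skips the indices below the starting level, where
    \<open>\<pi>\<close> is unconstrained, and the division by 0.\<close>
  define N where "N = nat \<bar>level x\<bar> + 1"
  have bound: "\<bar>ratio \<pi> (r (j + N))\<bar> \<le> \<bar>real_of_int (fst x)\<bar> + \<bar>real_of_int (level x)\<bar> + 1" for j
  proof -
    define n where "n = r (j + N)"
    have "j + N \<le> n" unfolding n_def by (rule strict_mono_imp_increasing[OF r])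
    then have n: "1 \<le> n" "level x \<le> int n" by (auto simp: N_def)
    have "\<bar>fst (\<pi> (int n))\<bar> \<le> \<bar>fst x\<bar> + \<bar>level x\<bar> + int n"
      using path_from_bounds[OF \<pi> n(2)] by linarith
    then have "real_of_int \<bar>fst (\<pi> (int n))\<bar> \<le> real_of_int (\<bar>fst x\<bar> + \<bar>level x\<bar> + int n)" by linarith
    also have "\<dots> \<le> (\<bar>real_of_int (fst x)\<bar> + \<bar>real_of_int (level x)\<bar> + 1) * real n"
      using n(1) mult_left_mono[of 1 "real n" "\<bar>real_of_int (fst x)\<bar> + \<bar>real_of_int (level x)\<bar>"]
      by (simp add: algebra_simps)
    finally show ?thesis using n(1) by (simp add: ratio_def n_def[symmetric] pos_divide_le_eq)
  qed
  have "bounded (range (\<lambda>j. ratio \<pi> (r (j + N))))"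
    unfolding bounded_iff using bound by (intro exI) auto
  from bounded_imp_convergent_subsequence[OF this] obtain a q
    where q: "strict_mono q" "((\<lambda>j. ratio \<pi> (r (j + N))) \<circ> q) \<longlonglongrightarrow> a" by blast
  have "strict_mono (\<lambda>j. q j + N)" using q(1) by (simp add: strict_mono_def)
  then show ?thesis using that[of "\<lambda>j. q j + N" a] q(2) by (simp add: comp_def)
qed

lemma ratio_limit_dir:
  fixes r :: "nat \<Rightarrow> nat"
  assumes \<pi>: "path_from x \<pi>" and r: "strict_mono r" and lim: "(\<lambda>j. ratio \<pi> (r j)) \<longlonglongrightarrow> a"
  shows "(\<lambda>j. to_dir (\<pi> (int (r j))) /\<^sub>R real (r j)) \<longlonglongrightarrow> dir_of a"
proof -
  have "\<forall>\<^sub>F j in sequentially. dir_of (ratio \<pi> (r j)) = to_dir (\<pi> (int (r j))) /\<^sub>R real (r j)"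
    unfolding eventually_sequentially
  proof (intro exI[of _ "nat \<bar>level x\<bar> + 1"] allI impI)
    fix j assume "nat \<bar>level x\<bar> + 1 \<le> j"
    moreover have "j \<le> r j" by (rule strict_mono_imp_increasing[OF r])
    ultimately have n: "1 \<le> r j" "level x \<le> int (r j)" by auto
    have "fst (\<pi> (int (r j))) + snd (\<pi> (int (r j))) = int (r j)"
      using path_from_bounds[OF \<pi> n(2)] by (simp add: level_def)
    then have "real_of_int (snd (\<pi> (int (r j)))) = real (r j) - real_of_int (fst (\<pi> (int (r j))))"
      by linarith
    then show "dir_of (ratio \<pi> (r j)) = to_dir (\<pi> (int (r j))) /\<^sub>R real (r j)"
      using n(1) by (simp add: ratio_def to_dir_def divide_inverse right_diff_distrib mult.commute)
  qed
  moreover have "(\<lambda>j. dir_of (ratio \<pi> (r j))) \<longlonglongrightarrow> dir_of a" by (intro tendsto_intros lim)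
  ultimately show ?thesis by (rule Lim_transform_eventually[rotated])
qed

lemma directed_intoI:
  assumes \<pi>: "path_from x \<pi>"
    and A: "\<And>r a. strict_mono r \<Longrightarrow> (\<lambda>j. ratio \<pi> (r j)) \<longlonglongrightarrow> a \<Longrightarrow> dir_of a \<in> A"
  shows "directed_into \<pi> A"
  unfolding directed_into_def
proof (intro allI impI)
  fix r :: "nat \<Rightarrow> nat" and v
  assume r: "strict_mono r" and v: "(\<lambda>j. to_dir (\<pi> (int (r j))) /\<^sub>R real (r j)) \<longlonglongrightarrow> v"
  have "(\<lambda>j. fst (to_dir (\<pi> (int (r j))) /\<^sub>R real (r j))) \<longlonglongrightarrow> fst v" by (intro tendsto_fst v)
  then have lim: "(\<lambda>j. ratio \<pi> (r j)) \<longlonglongrightarrow> fst v"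
    by (simp add: ratio_def to_dir_def divide_inverse mult.commute)
  then have "v = dir_of (fst v)" using ratio_limit_dir[OF \<pi> r] v LIMSEQ_unique by blast
  then show "v \<in> A" using A[OF r lim] by simp
qed

lemma directed_intoD:
  assumes "path_from x \<pi>" "directed_into \<pi> A" "strict_mono r" "(\<lambda>j. ratio \<pi> (r j)) \<longlonglongrightarrow> a"
  shows "dir_of a \<in> A"
  using ratio_limit_dir[OF assms(1,3,4)] assms(2,3) unfolding directed_into_def by blast

lemma directed_into_tail:
  assumes \<rho>: "directed_into \<rho> A" and eq: "\<And>k. N \<le> k \<Longrightarrow> \<pi> k = \<rho> k"
  shows "directed_into \<pi> A"
  unfolding directed_into_def
proof (intro allI impI)
  fix r :: "nat \<Rightarrow> nat" and v
  assume r: "strict_mono r" and v: "(\<lambda>j. to_dir (\<pi> (int (r j))) /\<^sub>R real (r j)) \<longlonglongrightarrow> v"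
  have "\<forall>\<^sub>F j in sequentially. to_dir (\<pi> (int (r j))) /\<^sub>R real (r j) = to_dir (\<rho> (int (r j))) /\<^sub>R real (r j)"
    unfolding eventually_sequentially
  proof (intro exI[of _ "nat N"] allI impI)
    fix j assume "nat N \<le> j"
    then have "N \<le> int (r j)" using strict_mono_imp_increasing[OF r, of j] by linarith
    then show "to_dir (\<pi> (int (r j))) /\<^sub>R real (r j) = to_dir (\<rho> (int (r j))) /\<^sub>R real (r j)" by (simp add: eq)
  qed
  then have "(\<lambda>j. to_dir (\<rho> (int (r j))) /\<^sub>R real (r j)) \<longlonglongrightarrow> v" using v by (rule Lim_transform_eventually[rotated])
  then show "v \<in> A" using \<rho> r unfolding directed_into_def by blast
qed

lemma path_multiset_level:
  assumes "path_between x y \<pi>" "level x \<le> k" "k < level y"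
  shows "filter_mset (\<lambda>v. level v = k) (image_mset \<pi> (mset_set {level x..<level y})) = {#\<pi> k#}"
proof -
  have lev: "level (\<pi> i) = i" if "level x \<le> i" "i \<le> level y" for i
    using that
  proof (induction i rule: int_ge_induct)
    case base
    then show ?case using assms(1) by (simp add: path_between_def)
  next
    case (step i)
    have "\<pi> (i + 1) - \<pi> i \<in> {e1, e2}" using assms(1) step by (auto simp: path_between_def)
    then have "\<pi> (i + 1) = \<pi> i + e1 \<or> \<pi> (i + 1) = \<pi> i + e2"
      by (metis add.commute diff_add_cancel insert_iff singletonD)
    then show ?case using step by auto
  qed
  have "{i \<in> {level x..<level y}. level (\<pi> i) = k} = {k}" using assms(2,3) by (auto simp: lev)
  then show ?thesis by (simp add: filter_mset_image_mset filter_mset_mset_set comp_def)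
qed

section \<open>Uniqueness and ordering of geodesics\<close>

context busemann_realization
begin

text \<open>Equal passage times are equal weight sums, so \<open>generic\<close> identifies the
  visited sites as multisets, and the level singles out the one at index \<open>k\<close>.\<close>

lemma geodesic_unique:
  assumes "geodesic_between w x y \<pi>" "geodesic_between w x y \<rho>" "level x \<le> k" "k \<le> level y"
  shows "\<pi> k = \<rho> k"
proof (cases "k = level y")
  case True
  then show ?thesis using assms by (simp add: geodesic_between_def path_between_def)
next
  case False
  have p: "path_between x y \<pi>" "path_between x y \<rho>" using assms by (auto simp: geodesic_between_def)
  have "path_weight w x y \<pi> = path_weight w x y \<rho>" using assms by (simp add: geodesic_between_def)
  then have "(\<Sum>v\<in>#image_mset \<pi> (mset_set {level x..<level y}). w v) =
      (\<Sum>v\<in>#image_mset \<rho> (mset_set {level x..<level y}). w v)"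
    by (simp add: path_weight_def sum_unfold_sum_mset image_mset.compositionality comp_def)
  then have "image_mset \<pi> (mset_set {level x..<level y}) = image_mset \<rho> (mset_set {level x..<level y})"
    by (rule generic)
  then have "{#\<pi> k#} = {#\<rho> k#}"
    using path_multiset_level[OF p(1), of k] path_multiset_level[OF p(2), of k] assms(3,4) False by simp
  then show ?thesis by simp
qed

text \<open>First coordinates on one level cannot jump past each other, so changing sides requires a
  meeting; that would give two geodesics from \<open>x\<close> to one site which differ at index
  \<open>k\<close>.\<close>

lemma geodesics_stay_separated:
  assumes \<pi>: "geodesic_from w x \<pi>" and \<rho>: "geodesic_from w x \<rho>"
    and k: "level x \<le> k" "fst (\<pi> k) < fst (\<rho> k)" and l: "k \<le> l"
  shows "fst (\<pi> l) < fst (\<rho> l)"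
  using l
proof (induction l rule: int_ge_induct)
  case (step l)
  have p: "path_from x \<pi>" "path_from x \<rho>" using \<pi> \<rho> by (auto simp: geodesic_from_def)
  have xl: "level x \<le> l" "level x \<le> l + 1" using step k by auto
  have "\<pi> (l + 1) - \<pi> l \<in> {e1, e2}" "\<rho> (l + 1) - \<rho> l \<in> {e1, e2}"
    using p xl by (auto simp: path_from_def)
  then have "fst (\<pi> (l + 1)) - fst (\<pi> l) \<le> 1" "0 \<le> fst (\<rho> (l + 1)) - fst (\<rho> l)"
    by (auto simp flip: fst_diff)
  then have le: "fst (\<pi> (l + 1)) \<le> fst (\<rho> (l + 1))" using step.IH by linarith
  have "fst (\<pi> (l + 1)) \<noteq> fst (\<rho> (l + 1))"
  proof
    assume eq: "fst (\<pi> (l + 1)) = fst (\<rho> (l + 1))"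
    have lev: "level (\<pi> (l + 1)) = l + 1" "level (\<rho> (l + 1)) = l + 1"
      using path_from_bounds[OF p(1) xl(2)] path_from_bounds[OF p(2) xl(2)] by auto
    then have same: "\<pi> (l + 1) = \<rho> (l + 1)" using eq by (intro site_eqI) auto
    have "\<pi> (level x) = x" "\<rho> (level x) = x" using p by (auto simp: path_from_def)
    then have "geodesic_between w x (\<pi> (l + 1)) \<pi>" "geodesic_between w x (\<pi> (l + 1)) \<rho>"
      using \<pi> \<rho> xl(2) same unfolding geodesic_from_def by (metis order_refl)+
    then have "\<pi> k = \<rho> k" using geodesic_unique[of x "\<pi> (l + 1)" \<pi> \<rho> k] k(1) step lev by simp
    then show False using k(2) by simp
  qed
  then show ?case using le by simp
qed (use k in simp)

lemma path_from_flow: "path_from x (flow (st t \<sigma>) x)"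
proof -
  have "flow (st t \<sigma>) x (k + 1) - flow (st t \<sigma>) x k \<in> {e1, e2}" if "level x \<le> k" for k
    using flow_Suc[OF that, of "st t \<sigma>"] up_right_stepD[OF st, of t \<sigma> "flow (st t \<sigma>) x k"] by auto
  then show ?thesis by (simp add: path_from_def)
qed

end

section \<open>Limit directions of geodesics and the regularity condition\<close>

locale directed_realization = busemann_realization w b + shape_function g
  for w :: "site \<Rightarrow> real" and b :: "dir \<Rightarrow> sign \<Rightarrow> site \<Rightarrow> site \<Rightarrow> real" and g :: "dir \<Rightarrow> real" +
  assumes coalescence: "\<And>q x y. q \<in> \<rat> \<Longrightarrow> 0 < q \<Longrightarrow> q < 1 \<Longrightarrow>
      \<exists>k. level x \<le> k \<and> level y \<le> k \<and> flow (st q Plus) x k = flow (st q Plus) y k"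
    and gradient_determines: "\<And>s t \<sigma> x y. 0 < s \<Longrightarrow> s < 1 \<Longrightarrow> 0 < t \<Longrightarrow> t < 1 \<Longrightarrow>
      grad g (dir_of s) \<sigma> = grad g (dir_of t) \<sigma> \<Longrightarrow> b (dir_of s) \<sigma> x y = b (dir_of t) \<sigma> x y"
    and blow_up_e1: "filterlim (\<lambda>t. b (dir_of t) Minus 0 (0 + e1)) at_top (at_right 0)"
    and blow_up_e2: "filterlim (\<lambda>t. b (dir_of t) Plus 0 (0 + e2)) at_top (at_left 1)"
    and lpp_shape:
      "(\<lambda>n. (MAX x\<in>quadrant_sphere n. \<bar>lpp w 0 x - g (to_dir x)\<bar>) / real n) \<longlonglongrightarrow> 0"
    and busemann_shape: "\<And>q. q \<in> \<rat> \<Longrightarrow> 0 < q \<Longrightarrow> q < 1 \<Longrightarrow>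
      (\<lambda>n. (MAX x\<in>quadrant_sphere n. \<bar>b (dir_of q) Plus 0 x - to_dir x \<bullet> grad g (dir_of q) Plus\<bar>) / real n)
        \<longlonglongrightarrow> 0"
begin

text \<open>An affine piece of \<open>f\<close> reaching an end of the unit interval would make the Busemann functions constant near
  that end, but they blow up there.\<close>

lemma not_affine_left:
  assumes t: "0 < t" "t < 1"
  shows "\<exists>a. 0 < a \<and> a < t \<and> \<not> affine_between f a t"
proof (rule ccontr)
  assume "\<not> ?thesis"
  then have aff: "affine_between f a t" if "0 < a" "a < t" for a using that by blast
  have const: "b (dir_of s) Minus 0 (0 + e1) = b (dir_of t) Minus 0 (0 + e1)" if s: "0 < s" "s < t" for s
  proof (rule gradient_determines)
    obtain k d where kd: "\<And>r. r \<in> {s / 2..t} \<Longrightarrow> f r = k * r + d"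
      using aff[of "s / 2"] s unfolding affine_between_def by auto
    have "D Minus t = k" "D Minus s = k"
      using f_affine_D(1)[of "s / 2" t k d] f_affine_D(1)[of "s / 2" s k d] kd s t by auto
    then show "grad g (dir_of s) Minus = grad g (dir_of t) Minus"
      using kd[of s] kd[of t] s t by (intro grad_eq_of_affine) (auto simp: algebra_simps)
  qed (use s t in auto)
  have "\<forall>\<^sub>F s in at_right 0. b (dir_of t) Minus 0 (0 + e1) < b (dir_of s) Minus 0 (0 + e1)"
    using blow_up_e1 unfolding filterlim_at_top_dense by blast
  moreover have "\<forall>\<^sub>F s in at_right 0. 0 < s \<and> s < t"
    unfolding eventually_at_right[OF t(1)] using t by blast
  ultimately have "\<forall>\<^sub>F s in at_right (0::real). False"
    by eventually_elim (metis const less_irrefl)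
  then show False by (simp add: trivial_limit_at_right_real)
qed

lemma not_affine_right:
  assumes t: "0 < t" "t < 1"
  shows "\<exists>a. t < a \<and> a < 1 \<and> \<not> affine_between f t a"
proof (rule ccontr)
  assume "\<not> ?thesis"
  then have aff: "affine_between f t a" if "t < a" "a < 1" for a using that by blast
  have const: "b (dir_of s) Plus 0 (0 + e2) = b (dir_of t) Plus 0 (0 + e2)" if s: "t < s" "s < 1" for s
  proof (rule gradient_determines)
    obtain k d where kd: "\<And>r. r \<in> {t..(s + 1) / 2} \<Longrightarrow> f r = k * r + d"
      using aff[of "(s + 1) / 2"] s unfolding affine_between_def by auto
    have "D Plus t = k" "D Plus s = k"
      using f_affine_D(2)[of t "(s + 1) / 2" k d] f_affine_D(2)[of s "(s + 1) / 2" k d] kd s t by auto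
    then show "grad g (dir_of s) Plus = grad g (dir_of t) Plus"
      using kd[of s] kd[of t] s t by (intro grad_eq_of_affine) (auto simp: algebra_simps)
  qed (use s t in auto)
  have "\<forall>\<^sub>F s in at_left 1. b (dir_of t) Plus 0 (0 + e2) < b (dir_of s) Plus 0 (0 + e2)"
    using blow_up_e2 unfolding filterlim_at_top_dense by blast
  moreover have "\<forall>\<^sub>F s in at_left 1. t < s \<and> s < 1"
    unfolding eventually_at_left[OF t(2)] using t by blast
  ultimately have "\<forall>\<^sub>F s in at_left (1::real). False"
    by eventually_elim (metis const less_irrefl)
  then show False by (simp add: trivial_limit_at_left_real)
qed

lemma finite_quadrant_sphere: "finite (quadrant_sphere n)"
proof -
  have "quadrant_sphere n \<subseteq> {0..int n} \<times> {0..int n}"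
    by (auto simp: quadrant_sphere_def less_eq_prod_def level_def)
  then show ?thesis by (rule finite_subset) auto
qed

lemma sphere_limit:
  assumes lim: "(\<lambda>n. (MAX x\<in>quadrant_sphere n. \<bar>h x :: real\<bar>) / real n) \<longlonglongrightarrow> 0"
    and F: "\<And>n. F n \<in> quadrant_sphere n"
  shows "(\<lambda>n. h (F n) / real n) \<longlonglongrightarrow> 0"
proof (rule Lim_null_comparison[OF _ lim])
  show "\<forall>\<^sub>F n in sequentially. norm (h (F n) / real n) \<le> (MAX x\<in>quadrant_sphere n. \<bar>h x\<bar>) / real n"
  proof (rule always_eventually, rule allI)
    fix n
    have "\<bar>h (F n)\<bar> \<le> (MAX x\<in>quadrant_sphere n. \<bar>h x\<bar>)"
      using F finite_quadrant_sphere by (intro Max_ge) auto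
    then show "norm (h (F n) / real n) \<le> (MAX x\<in>quadrant_sphere n. \<bar>h x\<bar>) / real n"
      by (simp add: divide_right_mono)
  qed
qed

text \<open>Along its own geodesic a Busemann function is a passage time; comparing the two shape theorems shows that
  \<open>f\<close> touches its tangent line at every limit direction.\<close>

lemma rational_directed_origin:
  assumes q: "q \<in> \<rat>" "0 < q" "q < 1"
  shows "directed_into (flow (st q Plus) 0) (U_at g (dir_of q))"
proof (rule directed_intoI[OF path_from_flow])
  fix r :: "nat \<Rightarrow> nat" and a
  assume r: "strict_mono r" and a: "(\<lambda>j. ratio (flow (st q Plus) 0) (r j)) \<longlonglongrightarrow> a"
  define F where "F n = flow (st q Plus) 0 (int n)" for n
  define \<rho> where "\<rho> n = ratio (flow (st q Plus) 0) n" for n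
  define d where "d = D Plus q"
  have level0: "level (0::site) = 0" by (simp add: level_def)
  have F: "level (F n) = int n" "0 \<le> fst (F n)" "fst (F n) \<le> int n" "0 \<le> F n" for n
    using path_from_bounds[OF path_from_flow, of 0 "int n" q Plus] flow_ge[OF st, of 0 "int n" q Plus]
    by (auto simp: F_def level0)
  have sphere: "F n \<in> quadrant_sphere n" for n using F by (simp add: quadrant_sphere_def)
  have \<rho>01: "0 \<le> \<rho> n" "\<rho> n \<le> 1" for n
    using F(2,3)[of n] by (auto simp: \<rho>_def ratio_def F_def[symmetric] divide_le_eq_1)
  have F_dir: "to_dir (F n) = real n *\<^sub>R dir_of (\<rho> n)" if "1 \<le> n" for n
  proof -
    have "real_of_int (snd (F n)) = real n - real_of_int (fst (F n))"
      using F(1)[of n] unfolding level_def by linarith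
    then show ?thesis using that
      by (simp add: to_dir_def \<rho>_def ratio_def F_def[symmetric] right_diff_distrib)
  qed
  \<comment> \<open>At \<open>F n\<close> the Busemann function and the passage time coincide, so
    subtracting the two shape theorems leaves the vertical distance of \<open>f\<close> from its
    tangent.\<close>
  have "(\<lambda>n. (b (dir_of q) Plus 0 (F n) - to_dir (F n) \<bullet> grad g (dir_of q) Plus) / real n -
      (lpp w 0 (F n) - g (to_dir (F n))) / real n) \<longlonglongrightarrow> 0 - 0"
    by (intro tendsto_diff sphere_limit[OF busemann_shape[OF q]] sphere_limit[OF lpp_shape] sphere)
  moreover have "\<forall>\<^sub>F n in sequentially. (b (dir_of q) Plus 0 (F n) - to_dir (F n) \<bullet> grad g (dir_of q) Plus) / real n -
      (lpp w 0 (F n) - g (to_dir (F n))) / real n = f (\<rho> n) - f q - d * (\<rho> n - q)"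
    unfolding eventually_sequentially
  proof (intro exI[of _ 1] allI impI)
    fix n :: nat assume n: "1 \<le> n"
    have "lpp w 0 (F n) = b (dir_of q) Plus 0 (F n)"
      unfolding F_def using lpp_flow(1)[OF q(2,3), of 0 "int n" Plus] by (simp add: level0)
    moreover have "g (to_dir (F n)) = real n * f (\<rho> n)"
      using homogeneous[of "real n" "dir_of (\<rho> n)"] \<rho>01[of n] F_dir[OF n]
      by (simp add: f_def less_eq_prod_def)
    moreover have "to_dir (F n) \<bullet> grad g (dir_of q) Plus = real n * (f q + d * (\<rho> n - q))"
      unfolding F_dir[OF n] grad_eq[OF q(2,3)] d_def by (simp add: algebra_simps)
    ultimately have "(b (dir_of q) Plus 0 (F n) - to_dir (F n) \<bullet> grad g (dir_of q) Plus) -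
        (lpp w 0 (F n) - g (to_dir (F n))) = real n * (f (\<rho> n) - f q - d * (\<rho> n - q))"
      by (simp add: right_diff_distrib distrib_left)
    then show "(b (dir_of q) Plus 0 (F n) - to_dir (F n) \<bullet> grad g (dir_of q) Plus) / real n -
      (lpp w 0 (F n) - g (to_dir (F n))) / real n = f (\<rho> n) - f q - d * (\<rho> n - q)"
      using n unfolding diff_divide_distrib[symmetric] by simp
  qed
  ultimately have "(\<lambda>n. f (\<rho> n) - f q - d * (\<rho> n - q)) \<longlonglongrightarrow> 0 - 0"
    by (rule Lim_transform_eventually)
  from LIMSEQ_subseq_LIMSEQ[OF this r]
  have err: "(\<lambda>j. f (\<rho> (r j)) - f q - d * (\<rho> (r j) - q)) \<longlonglongrightarrow> 0" by (simp add: comp_def)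
  have lim: "(\<lambda>j. \<rho> (r j)) \<longlonglongrightarrow> a" using a by (simp add: \<rho>_def)
  have a01: "0 \<le> a" "a \<le> 1"
    using LIMSEQ_le_const[OF lim, of 0] LIMSEQ_le_const2[OF lim, of 1] \<rho>01 by auto
  have err_eq: "f x - f q - d * (x - q) = (slope q x - d) * (x - q)" if "x \<noteq> q" for x
    using slope_eq[OF that] by (simp add: algebra_simps)
  have line: "f s = d * s + (f q - d * q)" if "slope q s = d" "s \<noteq> q" for s
    using slope_eq[OF that(2)] that(1) by (simp add: algebra_simps)
  have "0 < a \<and> a < 1 \<and> affine_between f (min a q) (max a q)"
  proof -
    consider "a = q" | "a < q" | "q < a" by linarith
    then show ?thesis
    proof cases
      case 1
      then show ?thesis using q by (simp add: affine_between_refl)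
    next
      case 2
      \<comment> \<open>A slope above \<open>d\<close> at \<open>s\<close> would keep the error
        below a fixed negative number as soon as the ratios lie left of \<open>s\<close>.\<close>
      have "slope q s = d" if s: "a < s" "s < q" for s
      proof -
        have ge: "d \<le> slope q s" using slope_right(4)[OF q(2,3), of s] s a01 by (simp add: d_def)
        have "\<forall>\<^sub>F j in sequentially. \<rho> (r j) < s" using order_tendstoD(2)[OF lim s(1)] .
        then have "\<forall>\<^sub>F j in sequentially. f (\<rho> (r j)) - f q - d * (\<rho> (r j) - q) \<le> (slope q s - d) * (s - q)"
        proof eventually_elim
          case (elim j)
          let ?x = "\<rho> (r j)"
          have "slope q s \<le> slope q ?x" using slope_antimono[of ?x s q] elim s \<rho>01[of "r j"] q by auto
          then have "(slope q ?x - d) * (?x - q) \<le> (slope q s - d) * (?x - q)"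
            using elim s by (intro mult_right_mono_neg) auto
          also have "\<dots> \<le> (slope q s - d) * (s - q)" using elim ge by (intro mult_left_mono) auto
          finally show ?case using err_eq[of ?x] elim s by simp
        qed
        then have "0 \<le> (slope q s - d) * (s - q)" using tendsto_upperbound[OF err] by simp
        then have "slope q s - d \<le> 0" using s by (simp add: zero_le_mult_iff)
        then show ?thesis using ge by simp
      qed
      then have on_line: "f r = d * r + (f q - d * q)" if "a < r" "r \<le> q" for r
        using line[of r] that by (cases "r = q") auto
      have aff: "affine_between f e q" if "a < e" for e
        unfolding affine_between_def
        by (rule exI[of _ d], rule exI[of _ "f q - d * q"], rule ballI, rule on_line) (use that in auto)
      \<comment> \<open>Otherwise the affine stretch would reach the end of the unit
        interval.\<close>
      have "a \<noteq> 0" using not_affine_left[OF q(2,3)] aff by auto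
      then have "0 < a" using a01 by simp
      then show ?thesis using affine_between_close_left[OF _ 2 q(3)] aff 2 q by (simp add: min_absorb1 max_absorb2)
    next
      case 3
      have "slope q s = d" if s: "q < s" "s < a" for s
      proof -
        have le: "slope q s \<le> d" using slope_right(3)[OF q(2,3), of s] s a01 by (simp add: d_def)
        have "\<forall>\<^sub>F j in sequentially. s < \<rho> (r j)" using order_tendstoD(1)[OF lim s(2)] .
        then have "\<forall>\<^sub>F j in sequentially. f (\<rho> (r j)) - f q - d * (\<rho> (r j) - q) \<le> (slope q s - d) * (s - q)"
        proof eventually_elim
          case (elim j)
          let ?x = "\<rho> (r j)"
          have "slope q ?x \<le> slope q s" using slope_antimono[of s ?x q] elim s \<rho>01[of "r j"] q by auto
          then have "(slope q ?x - d) * (?x - q) \<le> (slope q s - d) * (?x - q)"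
            using elim s by (intro mult_right_mono) auto
          also have "\<dots> \<le> (slope q s - d) * (s - q)" using elim le by (intro mult_left_mono_neg) auto
          finally show ?case using err_eq[of ?x] elim s by simp
        qed
        then have "0 \<le> (slope q s - d) * (s - q)" using tendsto_upperbound[OF err] by simp
        then have "0 \<le> slope q s - d" using s by (simp add: zero_le_mult_iff)
        then show ?thesis using le by simp
      qed
      then have on_line: "f r = d * r + (f q - d * q)" if "q \<le> r" "r < a" for r
        using line[of r] that by (cases "r = q") auto
      have aff: "affine_between f q e" if "e < a" for e
        unfolding affine_between_def
        by (rule exI[of _ d], rule exI[of _ "f q - d * q"], rule ballI, rule on_line) (use that in auto)
      have "a \<noteq> 1" using not_affine_right[OF q(2,3)] aff by auto
      then have "a < 1" using a01 by simp
      then show ?thesis using affine_between_close_right[OF q(2) 3] aff 3 q by (simp add: min_absorb2 max_absorb1)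
    qed
  qed
  then show "dir_of a \<in> U_at g (dir_of q)" unfolding U_at_iff[OF q(2,3)] by blast
qed

text \<open>Coalescence joins the line from \<open>x\<close> to the one from the origin, and limit
  directions depend only on the tail.\<close>

lemma rational_directed:
  assumes q: "q \<in> \<rat>" "0 < q" "q < 1"
  shows "directed_into (flow (st q Plus) x) (U_at g (dir_of q))"
proof -
  obtain k where k: "level x \<le> k" "level (0::site) \<le> k" "flow (st q Plus) x k = flow (st q Plus) 0 k"
    using coalescence[OF q] by blast
  show ?thesis
    by (rule directed_into_tail[OF rational_directed_origin[OF q]]) (rule flow_meet[OF st k(1,2) _ k(3)])
qed

text \<open>The shape theorem for \<open>b\<close> covers rational directions only. If a limit point
  \<open>a\<close> lies left of \<open>t\<close>, the line of a rational \<open>q\<close> between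
  them runs left of the given one and has a limit direction \<open>v \<le> a\<close>; so
  \<open>f\<close> is affine from \<open>v\<close> to \<open>q\<close>, hence from \<open>a\<close>
  to \<open>q\<close>, and \<open>q\<close> tends to \<open>t\<close>. The other side is
  symmetric.\<close>

lemma Busemann_directed:
  assumes t: "0 < t" "t < 1"
  shows "directed_into (flow (st t \<sigma>) x) (U_at g (dir_of t))"
proof (rule directed_intoI[OF path_from_flow])
  fix r :: "nat \<Rightarrow> nat" and a
  assume r: "strict_mono r" and a: "(\<lambda>j. ratio (flow (st t \<sigma>) x) (r j)) \<longlonglongrightarrow> a"
  have sandwich: "\<exists>v. 0 < v \<and> v < 1 \<and> affine_between f (min v q) (max v q) \<and> (if q < t then v \<le> a else a \<le> v)"
    if q: "q \<in> \<rat>" "0 < q" "q < 1" "q \<noteq> t" for q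
  proof -
    \<comment> \<open>Refining the given subsequence lets both ratios converge along the same
      indices, so their order passes to the limits.\<close>
    obtain r' v where r': "strict_mono r'" "(\<lambda>j. ratio (flow (st q Plus) x) (r (r' j))) \<longlonglongrightarrow> v"
      using ratio_subsequence[OF path_from_flow r] by blast
    have rr: "strict_mono (\<lambda>j. r (r' j))" using r r'(1) by (simp add: strict_mono_def)
    have "dir_of v \<in> U_at g (dir_of q)"
      using directed_intoD[OF path_from_flow rational_directed[OF q(1-3)] rr r'(2)] .
    then have v: "0 < v" "v < 1" "affine_between f (min v q) (max v q)"
      unfolding U_at_iff[OF q(2,3)] by auto
    have a': "(\<lambda>j. ratio (flow (st t \<sigma>) x) (r (r' j))) \<longlonglongrightarrow> a"
      using LIMSEQ_subseq_LIMSEQ[OF a r'(1)] by (simp add: comp_def)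
    have ev: "\<forall>\<^sub>F j in sequentially. level x \<le> int (r (r' j))"
      unfolding eventually_sequentially
    proof (intro exI[of _ "nat (level x)"] allI impI)
      fix j assume "nat (level x) \<le> j"
      then show "level x \<le> int (r (r' j))" using strict_mono_imp_increasing[OF rr, of j] by linarith
    qed
    have "if q < t then v \<le> a else a \<le> v"
    proof (cases "q < t")
      case True
      have "\<forall>\<^sub>F j in sequentially. ratio (flow (st q Plus) x) (r (r' j)) \<le> ratio (flow (st t \<sigma>) x) (r (r' j))"
        using ev
      proof eventually_elim
        case (elim j)
        have "fst (flow (st q Plus) x (int (r (r' j)))) \<le> fst (flow (st t \<sigma>) x (int (r (r' j))))"
          using True q t elim by (intro flow_mono_start step_mono st) (auto simp: before_def)
        then show ?case by (simp add: ratio_def divide_right_mono)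
      qed
      then show ?thesis using tendsto_le[OF _ a' r'(2)] True by simp
    next
      case False
      have "\<forall>\<^sub>F j in sequentially. ratio (flow (st t \<sigma>) x) (r (r' j)) \<le> ratio (flow (st q Plus) x) (r (r' j))"
        using ev
      proof eventually_elim
        case (elim j)
        have "fst (flow (st t \<sigma>) x (int (r (r' j)))) \<le> fst (flow (st q Plus) x (int (r (r' j))))"
          using False q t elim by (intro flow_mono_start step_mono st) (auto simp: before_def)
        then show ?case by (simp add: ratio_def divide_right_mono)
      qed
      then show ?thesis using tendsto_le[OF _ r'(2) a'] False by simp
    qed
    then show ?thesis using v by blast
  qed
  have "0 < a \<and> a < 1 \<and> affine_between f (min a t) (max a t)"
  proof -
    consider "a = t" | "a < t" | "t < a" by linarith
    then show ?thesis
    proof cases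
      case 1
      then show ?thesis using t by (simp add: affine_between_refl)
    next
      case 2
      have left: "0 < a \<and> affine_between f a q" if q: "q \<in> \<rat>" "max 0 a < q" "q < t" for q
      proof -
        obtain v where "0 < v" "v \<le> a" "affine_between f (min v q) (max v q)"
          using sandwich[of q] q t by auto
        then show ?thesis using affine_between_subset[of f "min v q" "max v q" a q] q by auto
      qed
      obtain q where "q \<in> \<rat>" "max 0 a < q" "q < t" using Rats_dense_in_real[of "max 0 a" t] 2 t by auto
      then have a0: "0 < a" using left by blast
      have "affine_between f a t"
      proof (rule affine_between_close_right[OF a0 2 t(2)])
        fix e assume "a < e" "e < t"
        then obtain q where q: "q \<in> \<rat>" "e < q" "q < t" using Rats_dense_in_real by blast
        then have "affine_between f a q" using left[of q] \<open>a < e\<close> a0 by simp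
        then show "affine_between f a e" using affine_between_subset q(2) by fastforce
      qed
      then show ?thesis using a0 2 t by (simp add: min_absorb1 max_absorb2)
    next
      case 3
      have right: "a < 1 \<and> affine_between f q a" if q: "q \<in> \<rat>" "t < q" "q < min 1 a" for q
      proof -
        obtain v where "v < 1" "a \<le> v" "affine_between f (min v q) (max v q)"
          using sandwich[of q] q t by auto
        then show ?thesis using affine_between_subset[of f "min v q" "max v q" q a] q by auto
      qed
      obtain q where "q \<in> \<rat>" "t < q" "q < min 1 a" using Rats_dense_in_real[of t "min 1 a"] 3 t by auto
      then have a1: "a < 1" using right by blast
      have "affine_between f t a"
      proof (rule affine_between_close_left[OF t(1) 3 a1])
        fix e assume "t < e" "e < a"
        then obtain q where q: "q \<in> \<rat>" "t < q" "q < e" using Rats_dense_in_real by blast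
        then have "affine_between f q a" using right[of q] \<open>e < a\<close> a1 by simp
        then show "affine_between f e a" using affine_between_subset q(3) by fastforce
      qed
      then show ?thesis using a1 3 t by (simp add: min_absorb2 max_absorb1)
    qed
  qed
  then show "dir_of a \<in> U_at g (dir_of t)" unfolding U_at_iff[OF t] by blast
qed

text \<open>A second contact point \<open>v\<close> contradicts strict concavity at
  \<open>r\<close>, so the regularity condition makes \<open>g\<close> differentiable there.\<close>

lemma regularity_D:
  assumes reg: "\<forall>\<zeta>\<in>riU. \<zeta> \<notin> diff_dirs g \<longrightarrow> strictly_concave_at g \<zeta>"
    and r: "0 < r" "r < 1" and v: "0 < v" "v < 1" "v \<noteq> r" "affine_between f (min v r) (max v r)"
  shows "D Minus r = D Plus r"
proof (rule D_eq_of_diff_dirs[OF r], rule ccontr)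
  assume "dir_of r \<notin> diff_dirs g"
  moreover have "dir_of r \<in> riU" using r by (auto simp: riU_iff)
  ultimately have "U_at g (dir_of r) = {dir_of r}" using reg by (auto simp: strictly_concave_at_def)
  moreover have "dir_of v \<in> U_at g (dir_of r)" unfolding U_at_iff[OF r] using v by blast
  ultimately show False using v(3) by auto
qed

text \<open>A geodesic on the wrong side of a Busemann geodesic stays there, by uniqueness of finite geodesics, and
  then so does its direction.\<close>

lemma ratio_limits_ordered:
  assumes "path_from x \<pi>" "path_from x \<rho>" and le: "\<And>l. N \<le> l \<Longrightarrow> fst (\<pi> l) \<le> fst (\<rho> l)"
    and "directed_into \<pi> A" "directed_into \<rho> C"
  obtains v v' where "v \<le> v'" "dir_of v \<in> A" "dir_of v' \<in> C"
proof -
  have id: "strict_mono (\<lambda>n::nat. n)" by (simp add: strict_mono_def)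
  obtain r v where r: "strict_mono r" "(\<lambda>j. ratio \<pi> (r j)) \<longlonglongrightarrow> v"
    using ratio_subsequence[OF assms(1) id] by blast
  obtain r' v' where r': "strict_mono r'" "(\<lambda>j. ratio \<rho> (r (r' j))) \<longlonglongrightarrow> v'"
    using ratio_subsequence[OF assms(2) r(1)] by blast
  have rr: "strict_mono (\<lambda>j. r (r' j))" using r(1) r'(1) by (simp add: strict_mono_def)
  have lim: "(\<lambda>j. ratio \<pi> (r (r' j))) \<longlonglongrightarrow> v"
    using LIMSEQ_subseq_LIMSEQ[OF r(2) r'(1)] by (simp add: comp_def)
  have "v \<le> v'"
  proof (rule tendsto_le[OF _ r'(2) lim])
    show "\<forall>\<^sub>F j in sequentially. ratio \<pi> (r (r' j)) \<le> ratio \<rho> (r (r' j))"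
      unfolding eventually_sequentially
    proof (intro exI[of _ "nat N"] allI impI)
      fix j assume "nat N \<le> j"
      then have "N \<le> int (r (r' j))" using strict_mono_imp_increasing[OF rr, of j] by linarith
      then show "ratio \<pi> (r (r' j)) \<le> ratio \<rho> (r (r' j))" using le by (simp add: ratio_def divide_right_mono)
    qed
  qed simp
  moreover have "dir_of v \<in> A" using directed_intoD[OF assms(1,4) rr lim] .
  moreover have "dir_of v' \<in> C" using directed_intoD[OF assms(2,5) rr r'(2)] .
  ultimately show ?thesis using that by blast
qed

text \<open>The left end \<open>l\<close> of the linear segment of \<open>t\<close> has the same
  \<open>Minus\<close> gradient as \<open>t\<close>, hence the same \<open>Minus\<close> geodesics,
  and a rational \<open>z < l\<close> reproduces the one from \<open>x\<close> up to level
  \<open>k\<close>. Were \<open>\<pi>\<close> left of it at level \<open>k\<close>, it would remain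
  so; as its limit directions are at least \<open>l\<close>, the geodesic of \<open>z\<close> would
  have a limit direction beyond \<open>l\<close> or at \<open>l\<close>, and \<open>f\<close> would
  be affine from \<open>z\<close> to \<open>l\<close>.\<close>

lemma geodesic_right_of_Minus:
  assumes reg: "\<forall>\<zeta>\<in>riU. \<zeta> \<notin> diff_dirs g \<longrightarrow> strictly_concave_at g \<zeta>" and t: "0 < t" "t < 1"
    and \<pi>: "geodesic_from w x \<pi>" "directed_into \<pi> (U_at g (dir_of t))" and k: "level x \<le> k"
  shows "fst (flow (st t Minus) x k) \<le> fst (\<pi> k)"
proof -
  obtain l where l: "0 < l" "l \<le> t" "affine_between f l t" "D Minus l = D Minus t"
    and not: "\<And>z. 0 < z \<Longrightarrow> z < l \<Longrightarrow> \<not> affine_between f z l"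
    and least: "\<And>v. 0 < v \<Longrightarrow> v < t \<Longrightarrow> affine_between f v t \<Longrightarrow> l \<le> v"
  proof (rule left_end[OF t not_affine_left[OF t]])
    show "D Minus r = D Plus r"
      if "0 < r" "r < 1" "0 < v" "v < 1" "v \<noteq> r" "affine_between f (min v r) (max v r)" for r v
      using regularity_D[OF reg that] .
  qed (rule that; blast)
  have l1: "l < 1" using l t by simp
  have "f t - f l = D Minus l * (t - l)"
  proof (cases "l = t")
    case False
    then have "l < t" using l by simp
    obtain c d where cd: "\<And>s. s \<in> {l..t} \<Longrightarrow> f s = c * s + d" using l(3) unfolding affine_between_def by blast
    have "D Minus t = c" using f_affine_D(1)[OF \<open>l < t\<close> cd] t by simp
    then show ?thesis using cd[of l] cd[of t] l by (simp add: algebra_simps)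
  qed simp
  then have "grad g (dir_of l) Minus = grad g (dir_of t) Minus"
    using l t l1 by (intro grad_eq_of_affine) auto
  then have "b (dir_of l) Minus = b (dir_of t) Minus"
    using gradient_determines[OF l(1) l1 t] by (intro ext) blast
  then have st_eq: "st l Minus = st t Minus" by simp
  obtain z where z: "z \<in> \<rat>" "0 < z" "z < l" "flow (st z Plus) x k = flow (st l Minus) x k"
    by (rule rational_left[OF l(1) l1 flow_eventually[OF step_eventually_left[OF l(1) l1] k]]) blast
  have z1: "z < 1" using z l1 by simp
  have "\<not> fst (\<pi> k) < fst (flow (st z Plus) x k)"
  proof
    assume lt: "fst (\<pi> k) < fst (flow (st z Plus) x k)"
    have "fst (\<pi> m) \<le> fst (flow (st z Plus) x m)" if "k \<le> m" for m
      using geodesics_stay_separated[OF \<pi>(1) geodesic_from_flow[OF z(2) z1] k lt that] by simp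
    moreover have "path_from x \<pi>" using \<pi>(1) by (simp add: geodesic_from_def)
    ultimately obtain v v' where v: "v \<le> v'" "dir_of v \<in> U_at g (dir_of t)" "dir_of v' \<in> U_at g (dir_of z)"
      using ratio_limits_ordered[OF _ path_from_flow _ \<pi>(2) rational_directed[OF z(1,2) z1]] by metis
    have "0 < v" "v < 1" "affine_between f (min v t) (max v t)" using v(2) unfolding U_at_iff[OF t] by auto
    then have "l \<le> v" using least[of v] l(2) by (cases "v < t") auto
    then have "l \<le> v'" using v(1) by simp
    moreover have "affine_between f (min v' z) (max v' z)" using v(3) unfolding U_at_iff[OF z(2) z1] by auto
    ultimately have "affine_between f z l" using z(3) affine_between_subset[of f "min v' z" "max v' z" z l] by auto
    then show False using not z by blast
  qed
  then show ?thesis using z(4) st_eq by simp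
qed

lemma geodesic_left_of_Plus:
  assumes reg: "\<forall>\<zeta>\<in>riU. \<zeta> \<notin> diff_dirs g \<longrightarrow> strictly_concave_at g \<zeta>" and t: "0 < t" "t < 1"
    and \<pi>: "geodesic_from w x \<pi>" "directed_into \<pi> (U_at g (dir_of t))" and k: "level x \<le> k"
  shows "fst (\<pi> k) \<le> fst (flow (st t Plus) x k)"
proof -
  obtain l where l: "t \<le> l" "l < 1" "affine_between f t l" "D Plus l = D Plus t"
    and not: "\<And>z. l < z \<Longrightarrow> z < 1 \<Longrightarrow> \<not> affine_between f l z"
    and greatest: "\<And>v. t < v \<Longrightarrow> v < 1 \<Longrightarrow> affine_between f t v \<Longrightarrow> v \<le> l"
  proof (rule right_end[OF t not_affine_right[OF t]])
    show "D Minus r = D Plus r"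
      if "0 < r" "r < 1" "0 < v" "v < 1" "v \<noteq> r" "affine_between f (min v r) (max v r)" for r v
      using regularity_D[OF reg that] .
  qed (rule that; blast)
  have l0: "0 < l" using l t by simp
  have "f t - f l = D Plus l * (t - l)"
  proof (cases "l = t")
    case False
    then have "t < l" using l by simp
    obtain c d where cd: "\<And>s. s \<in> {t..l} \<Longrightarrow> f s = c * s + d" using l(3) unfolding affine_between_def by blast
    have "D Plus t = c" using f_affine_D(2)[OF \<open>t < l\<close> cd] t by simp
    then show ?thesis using cd[of l] cd[of t] l by (simp add: algebra_simps)
  qed simp
  then have "grad g (dir_of l) Plus = grad g (dir_of t) Plus"
    using l t l0 by (intro grad_eq_of_affine) auto
  then have "b (dir_of l) Plus = b (dir_of t) Plus"
    using gradient_determines[OF l0 l(2) t] by (intro ext) blast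
  then have st_eq: "st l Plus = st t Plus" by simp
  obtain z where z: "z \<in> \<rat>" "l < z" "z < 1" "flow (st z Plus) x k = flow (st l Plus) x k"
    by (rule rational_right[OF l0 l(2) flow_eventually[OF step_eventually_right[OF l0 l(2)] k]]) blast
  have z0: "0 < z" using z l0 by simp
  have "\<not> fst (flow (st z Plus) x k) < fst (\<pi> k)"
  proof
    assume lt: "fst (flow (st z Plus) x k) < fst (\<pi> k)"
    have "fst (flow (st z Plus) x m) \<le> fst (\<pi> m)" if "k \<le> m" for m
      using geodesics_stay_separated[OF geodesic_from_flow[OF z0 z(3)] \<pi>(1) k lt that] by simp
    moreover have "path_from x \<pi>" using \<pi>(1) by (simp add: geodesic_from_def)
    ultimately obtain v' v where v: "v' \<le> v" "dir_of v' \<in> U_at g (dir_of z)" "dir_of v \<in> U_at g (dir_of t)"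
      using ratio_limits_ordered[OF path_from_flow _ _ rational_directed[OF z(1) z0 z(3)] \<pi>(2)] by metis
    have "0 < v" "v < 1" "affine_between f (min v t) (max v t)" using v(3) unfolding U_at_iff[OF t] by auto
    then have "v \<le> l" using greatest[of v] l(1) by (cases "t < v") auto
    then have "v' \<le> l" using v(1) by simp
    moreover have "affine_between f (min v' z) (max v' z)" using v(2) unfolding U_at_iff[OF z0 z(3)] by auto
    ultimately have "affine_between f l z" using z(2) affine_between_subset[of f "min v' z" "max v' z" l z] by auto
    then show False using not z by blast
  qed
  then show ?thesis using z(4) st_eq by simp
qed

lemma support_iff_disjoint_Busemann:
  assumes t: "0 < t" "t < 1"
  shows "dir_of t \<in> busemann_support b x y \<longleftrightarrow>
      busemann_points b x (dir_of t) Minus \<inter> busemann_points b y (dir_of t) Plus = {} \<or>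
      busemann_points b x (dir_of t) Plus \<inter> busemann_points b y (dir_of t) Minus = {}"
  by (rule support_iff_disjoint[OF _ t]) (rule coalescence)

theorem support_iff_disjoint_geodesics:
  assumes reg: "\<forall>\<zeta>\<in>riU. \<zeta> \<notin> diff_dirs g \<longrightarrow> strictly_concave_at g \<zeta>" and t: "0 < t" "t < 1"
  shows "dir_of t \<in> busemann_support b x y \<longleftrightarrow> (\<exists>\<pi> \<rho>.
      geodesic_from w x \<pi> \<and> directed_into \<pi> (U_at g (dir_of t)) \<and>
      geodesic_from w y \<rho> \<and> directed_into \<rho> (U_at g (dir_of t)) \<and>
      points_from x \<pi> \<inter> points_from y \<rho> = {})" (is "_ \<longleftrightarrow> ?R")
proof
  assume "dir_of t \<in> busemann_support b x y"
  then obtain \<sigma> \<tau> where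
    "points_from x (flow (st t \<sigma>) x) \<inter> points_from y (flow (st t \<tau>) y) = {}"
    unfolding support_iff_disjoint_Busemann[OF t] busemann_points_def busemann_geodesic_flow by blast
  then show ?R
    using geodesic_from_flow[OF t] Busemann_directed[OF t] by blast
next
  assume ?R
  then obtain \<pi> \<rho> where \<pi>: "geodesic_from w x \<pi>" "directed_into \<pi> (U_at g (dir_of t))"
    and \<rho>: "geodesic_from w y \<rho>" "directed_into \<rho> (U_at g (dir_of t))"
    and disj: "points_from x \<pi> \<inter> points_from y \<rho> = {}" by blast
  show "dir_of t \<in> busemann_support b x y"
  proof (rule ccontr)
    assume "dir_of t \<notin> busemann_support b x y"
    then obtain k l where k: "level x \<le> k" "level y \<le> k" "flow (st t Minus) x k = flow (st t Plus) y k"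
      and l: "level x \<le> l" "level y \<le> l" "flow (st t Plus) x l = flow (st t Minus) y l"
      unfolding support_iff_disjoint_Busemann[OF t] busemann_points_def busemann_geodesic_flow
        flow_points_disjoint_iff[OF st st] by blast
    have le: "fst (st t Minus z) \<le> fst (st t Plus z)" for z
      by (rule step_mono[OF t]) (simp add: before_def)
    obtain n m where n: "level x \<le> n" "level y \<le> n"
      and m: "flow (st t Minus) x n = m" "flow (st t Plus) x n = m" "flow (st t Minus) y n = m" "flow (st t Plus) y n = m"
      using flow_four_meet[OF st st le k l] by blast
    have lm: "level m = n" using level_flow[OF st n(1)] m(1) by blast
    have pinch: "\<pi>' n = m" if "level z \<le> n" "flow (st t Minus) z n = m" "flow (st t Plus) z n = m"
      "geodesic_from w z \<pi>'" "directed_into \<pi>' (U_at g (dir_of t))" for z \<pi>'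
    proof (rule site_eqI)
      show "fst (\<pi>' n) = fst m"
        using geodesic_right_of_Minus[OF reg t that(4,5,1)] geodesic_left_of_Plus[OF reg t that(4,5,1)] that(2,3) by simp
      have "path_from z \<pi>'" using that(4) by (simp add: geodesic_from_def)
      then show "level (\<pi>' n) = level m" using path_from_bounds[of z \<pi>' n] that(1) lm by simp
    qed
    have "\<pi> n = \<rho> n" using pinch[OF n(1) m(1,2) \<pi>] pinch[OF n(2) m(3,4) \<rho>] by simp
    then show False using disj n unfolding points_from_def by auto
  qed
qed

end

section \<open>Almost sure properties\<close>

sublocale lpp_setting \<subseteq> shape_function g
  by unfold_locales (rule g_concave g_symmetric g_homogeneous; assumption)+

context busemann_setting
begin

text \<open>The pointwise part of \<open>B1\<close> under one name, so that it can be transferred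
  from the invariant event to single realizations.\<close>

definition B1_at :: "'w \<Rightarrow> bool" where
  "B1_at \<omega> \<longleftrightarrow>
      (\<forall>\<xi>\<in>riU. \<forall>\<sigma> x y z. B \<omega> \<xi> \<sigma> (x + z) (y + z) = B (T z \<omega>) \<xi> \<sigma> x y) \<and>
      (\<forall>\<xi>\<in>riU. \<forall>\<sigma> x y z. B \<omega> \<xi> \<sigma> x y + B \<omega> \<xi> \<sigma> y z = B \<omega> \<xi> \<sigma> x z) \<and>
      (\<forall>\<xi>\<in>riU. \<forall>\<sigma> x. min (B \<omega> \<xi> \<sigma> x (x + e1)) (B \<omega> \<xi> \<sigma> x (x + e2)) = W \<omega> x) \<and>
      (\<forall>\<xi>\<in>riU. \<forall>\<xi>'\<in>riU. dir_less \<xi> \<xi>' \<longrightarrow> (\<forall>x.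
        B \<omega> \<xi> Minus x (x + e1) \<ge> B \<omega> \<xi> Plus x (x + e1) \<and>
        B \<omega> \<xi> Plus x (x + e1) \<ge> B \<omega> \<xi>' Minus x (x + e1) \<and>
        B \<omega> \<xi>' Minus x (x + e1) \<ge> B \<omega> \<xi>' Plus x (x + e1) \<and>
        B \<omega> \<xi> Minus x (x + e2) \<le> B \<omega> \<xi> Plus x (x + e2) \<and>
        B \<omega> \<xi> Plus x (x + e2) \<le> B \<omega> \<xi>' Minus x (x + e2) \<and>
        B \<omega> \<xi>' Minus x (x + e2) \<le> B \<omega> \<xi>' Plus x (x + e2))) \<and>
      (\<forall>\<xi>\<in>riU. \<forall>\<sigma> x y.
        ((\<lambda>\<zeta>. B \<omega> \<zeta> \<sigma> x y) \<longlongrightarrow> B \<omega> \<xi> Minus x y) (at_below \<xi>) \<and>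
        ((\<lambda>\<zeta>. B \<omega> \<zeta> \<sigma> x y) \<longlongrightarrow> B \<omega> \<xi> Plus x y) (at_above \<xi>)) \<and>
      (\<forall>\<sigma> x.
        filterlim (\<lambda>\<xi>. B \<omega> \<xi> \<sigma> x (x + e1)) at_top (at e2 within riU) \<and>
        filterlim (\<lambda>\<xi>. B \<omega> \<xi> \<sigma> x (x + e2)) at_top (at e1 within riU))"

lemma B1_atD:
  assumes "B1_at \<omega>" "\<xi> \<in> riU"
  shows "B \<omega> \<xi> \<sigma> (x + z) (y + z) = B (T z \<omega>) \<xi> \<sigma> x y"
    and "B \<omega> \<xi> \<sigma> x y + B \<omega> \<xi> \<sigma> y z = B \<omega> \<xi> \<sigma> x z"
    and "min (B \<omega> \<xi> \<sigma> x (x + e1)) (B \<omega> \<xi> \<sigma> x (x + e2)) = W \<omega> x"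
    and "((\<lambda>\<zeta>. B \<omega> \<zeta> \<sigma> x y) \<longlongrightarrow> B \<omega> \<xi> Minus x y) (at_below \<xi>)"
    and "((\<lambda>\<zeta>. B \<omega> \<zeta> \<sigma> x y) \<longlongrightarrow> B \<omega> \<xi> Plus x y) (at_above \<xi>)"
proof -
  note * = assms(1)[unfolded B1_at_def]
  show "B \<omega> \<xi> \<sigma> (x + z) (y + z) = B (T z \<omega>) \<xi> \<sigma> x y"
    using *[THEN conjunct1] assms(2) by blast
  show "B \<omega> \<xi> \<sigma> x y + B \<omega> \<xi> \<sigma> y z = B \<omega> \<xi> \<sigma> x z"
    using *[THEN conjunct2, THEN conjunct1] assms(2) by blast
  show "min (B \<omega> \<xi> \<sigma> x (x + e1)) (B \<omega> \<xi> \<sigma> x (x + e2)) = W \<omega> x"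
    using *[THEN conjunct2, THEN conjunct2, THEN conjunct1] assms(2) by blast
  note lim = *[THEN conjunct2, THEN conjunct2, THEN conjunct2, THEN conjunct2, THEN conjunct1,
      rule_format, OF assms(2)]
  show "((\<lambda>\<zeta>. B \<omega> \<zeta> \<sigma> x y) \<longlongrightarrow> B \<omega> \<xi> Minus x y) (at_below \<xi>)"
    by (rule lim[THEN conjunct1])
  show "((\<lambda>\<zeta>. B \<omega> \<zeta> \<sigma> x y) \<longlongrightarrow> B \<omega> \<xi> Plus x y) (at_above \<xi>)"
    by (rule lim[THEN conjunct2])
qed

lemma B1_atD_mono:
  assumes "B1_at \<omega>" "\<xi> \<in> riU" "\<xi>' \<in> riU" "dir_less \<xi> \<xi>'"
  shows "B \<omega> \<xi> Plus x (x + e1) \<le> B \<omega> \<xi> Minus x (x + e1)"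
    and "B \<omega> \<xi>' Minus x (x + e1) \<le> B \<omega> \<xi> Plus x (x + e1)"
    and "B \<omega> \<xi>' Plus x (x + e1) \<le> B \<omega> \<xi>' Minus x (x + e1)"
    and "B \<omega> \<xi> Minus x (x + e2) \<le> B \<omega> \<xi> Plus x (x + e2)"
    and "B \<omega> \<xi> Plus x (x + e2) \<le> B \<omega> \<xi>' Minus x (x + e2)"
    and "B \<omega> \<xi>' Minus x (x + e2) \<le> B \<omega> \<xi>' Plus x (x + e2)"
  using assms(1)[unfolded B1_at_def, THEN conjunct2, THEN conjunct2, THEN conjunct2, THEN conjunct1,
      rule_format, OF assms(2-4), of x]
  by blast+

lemma B1_set: "\<exists>\<Omega>\<^sub>0 \<in> events. prob \<Omega>\<^sub>0 = 1 \<and> (\<forall>z. T z -` \<Omega>\<^sub>0 = \<Omega>\<^sub>0) \<and> (\<forall>\<omega>\<in>\<Omega>\<^sub>0. B1_at \<omega>)"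
  unfolding B1_at_def by (rule B1)

text \<open>\<open>B4\<close> is applied to the half-plane of nonnegative levels: no site of
  negative level dominates one of its sites, so all weights below level 0 are independent of the
  increments based at level 0 or above.\<close>

lemma AE_busemann_coalescence:
  assumes \<xi>: "\<xi> \<in> riU"
  shows "AE \<omega> in M. \<forall>x y. \<exists>k. level x \<le> k \<and> level y \<le> k \<and>
    flow (busemann_step (B \<omega> \<xi> Plus) Plus) x k = flow (busemann_step (B \<omega> \<xi> Plus) Plus) y k"
proof -
  obtain \<Omega>\<^sub>0 where \<Omega>: "\<Omega>\<^sub>0 \<in> events" "prob \<Omega>\<^sub>0 = 1" "\<And>z. T z -` \<Omega>\<^sub>0 = \<Omega>\<^sub>0"
    and B: "\<And>\<omega>. \<omega> \<in> \<Omega>\<^sub>0 \<Longrightarrow> B1_at \<omega>"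
    using B1_set by blast
  let ?I = "{x :: site. 0 \<le> level x}"
  let ?F = "{(\<lambda>\<omega>. W \<omega> x) | x. x \<in> ?I} \<union> {(\<lambda>\<omega>. B \<omega> \<xi> \<sigma> x y) | \<xi> \<sigma> x y. x \<in> ?I \<and> x \<le> y \<and> \<xi> \<in> riU}"
  have gen_mono: "gen_events M F \<subseteq> gen_events M G" if "F \<subseteq> G" for F G
    unfolding gen_events_def using that by (intro sigma_sets_mono') blast
  have "indep_set (gen_events M {(\<lambda>\<omega>. B \<omega> \<xi> Plus x y) | x y. 0 \<le> level x \<and> x \<le> y})
      (gen_events M {(\<lambda>\<omega>. W \<omega> x) | x. level x < 0})"
    unfolding indep_set_def
  proof (rule indep_sets_mono_sets)
    show "indep_sets (case_bool (gen_events M ?F) (gen_events M {(\<lambda>\<omega>. W \<omega> x) | x. \<forall>z\<in>?I. \<not> z \<le> x})) UNIV"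
      using B4[of ?I] unfolding indep_set_def .
    fix i :: bool
    have "{(\<lambda>\<omega>. B \<omega> \<xi> Plus x y) | x y. 0 \<le> level x \<and> x \<le> y} \<subseteq> ?F" using \<xi> by blast
    moreover have "\<not> z \<le> x" if "level x < 0" "0 \<le> level z" for x z :: site
      using that by (auto simp: level_def less_eq_prod_def)
    then have "{(\<lambda>\<omega>. W \<omega> x) | x. level x < 0} \<subseteq> {(\<lambda>\<omega>. W \<omega> x) | x. \<forall>z\<in>?I. \<not> z \<le> x}" by blast
    ultimately show "case_bool (gen_events M {(\<lambda>\<omega>. B \<omega> \<xi> Plus x y) | x y. 0 \<le> level x \<and> x \<le> y})
        (gen_events M {(\<lambda>\<omega>. W \<omega> x) | x. level x < 0}) i \<subseteq>
      case_bool (gen_events M ?F) (gen_events M {(\<lambda>\<omega>. W \<omega> x) | x. \<forall>z\<in>?I. \<not> z \<le> x}) i"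
      using gen_mono by (simp split: bool.split)
  qed
  then interpret stationary_cocycle M T W g "\<lambda>\<omega>. B \<omega> \<xi> Plus" \<Omega>\<^sub>0
  proof (unfold_locales, goal_cases)
    case (1 x y)
    show ?case by (rule borel_measurable_integrable[OF B2_integrable[OF \<xi>]])
  next
    case 2
    show ?case using \<Omega>(1,2) prob_eq_1 by blast
  next
    case (3 z \<omega>)
    then show ?case using \<Omega>(3)[of z] by blast
  next
    case 4
    then show ?case by (intro B1_atD(1) B \<xi>)
  next
    case 5
    then show ?case by (intro B1_atD(2) B \<xi>)
  next
    case 6
    then show ?case by (intro B1_atD(3) B \<xi>)
  qed (assumption)
  show ?thesis by (rule AE_coalescence)
qed

lemma dir_of_filterlims:
  assumes t: "0 < t" "t < 1"
  shows "filterlim dir_of (at_below (dir_of t)) (at_left t)"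
    and "filterlim dir_of (at_above (dir_of t)) (at_right t)"
    and "filterlim dir_of (at e2 within riU) (at_right 0)"
    and "filterlim dir_of (at e1 within riU) (at_left 1)"
proof -
  have lim: "(dir_of \<longlongrightarrow> dir_of u) (at u within S)" for u :: real and S by (intro tendsto_intros)
  have ri: "dir_of s \<in> riU" if "0 < s" "s < 1" for s using that by (auto simp: riU_iff)
  have "\<forall>\<^sub>F s in at_left t. 0 < s \<and> s < t"
    unfolding eventually_at_left[OF t(1)] using t(1) by blast
  then have "\<forall>\<^sub>F s in at_left t. dir_of s \<in> {\<zeta> \<in> riU. dir_less \<zeta> (dir_of t)} \<and> dir_of s \<noteq> dir_of t"
    by eventually_elim (use t ri in auto)
  then show "filterlim dir_of (at_below (dir_of t)) (at_left t)"
    unfolding at_below_def filterlim_at using lim by blast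
  have "\<forall>\<^sub>F s in at_right t. t < s \<and> s < 1"
    unfolding eventually_at_right[OF t(2)] using t(2) by blast
  then have "\<forall>\<^sub>F s in at_right t. dir_of s \<in> {\<zeta> \<in> riU. dir_less (dir_of t) \<zeta>} \<and> dir_of s \<noteq> dir_of t"
    by eventually_elim (use t ri in auto)
  then show "filterlim dir_of (at_above (dir_of t)) (at_right t)"
    unfolding at_above_def filterlim_at using lim by blast
  have "\<forall>\<^sub>F s in at_right (0::real). 0 < s \<and> s < 1"
    unfolding eventually_at_right[OF zero_less_one] using zero_less_one by blast
  then have "\<forall>\<^sub>F s in at_right 0. dir_of s \<in> riU \<and> dir_of s \<noteq> e2"
    by eventually_elim (use ri in auto)
  then show "filterlim dir_of (at e2 within riU) (at_right 0)"
    unfolding filterlim_at using lim[of 0 "{0<..}"] by auto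
  have "\<forall>\<^sub>F s in at_left (1::real). 0 < s \<and> s < 1"
    unfolding eventually_at_left[OF zero_less_one] using zero_less_one by blast
  then have "\<forall>\<^sub>F s in at_left 1. dir_of s \<in> riU \<and> dir_of s \<noteq> e1"
    by eventually_elim (use ri in auto)
  then show "filterlim dir_of (at e1 within riU) (at_left 1)"
    unfolding filterlim_at using lim[of 1 "{..<1}"] by auto
qed

lemma AE_directed_realization: "AE \<omega> in M. directed_realization (W \<omega>) (B \<omega>) g"
proof -
  obtain \<Omega>\<^sub>0 where \<Omega>: "\<Omega>\<^sub>0 \<in> events" "prob \<Omega>\<^sub>0 = 1" "\<And>z. T z -` \<Omega>\<^sub>0 = \<Omega>\<^sub>0"
    and B: "\<And>\<omega>. \<omega> \<in> \<Omega>\<^sub>0 \<Longrightarrow> B1_at \<omega>"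
    using B1_set by blast
  have AE_B: "AE \<omega> in M. \<omega> \<in> \<Omega>\<^sub>0" using \<Omega>(1,2) prob_eq_1 by blast
  have ri: "dir_of t \<in> riU" if "0 < t" "t < 1" for t using that by (auto simp: riU_iff)
  \<comment> \<open>The exceptional events of the rational directions are countably many and can be
    united.\<close>
  have AE_rational: "AE \<omega> in M. \<forall>r::rat. 0 < real_of_rat r \<longrightarrow> real_of_rat r < 1 \<longrightarrow> P \<omega> (real_of_rat r)"
    if "\<And>q. 0 < q \<Longrightarrow> q < 1 \<Longrightarrow> AE \<omega> in M. P \<omega> q" for P
    unfolding AE_all_countable
  proof
    fix r :: rat
    show "AE \<omega> in M. 0 < real_of_rat r \<longrightarrow> real_of_rat r < 1 \<longrightarrow> P \<omega> (real_of_rat r)"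
      using that[of "real_of_rat r"] by (cases "0 < real_of_rat r \<and> real_of_rat r < 1") auto
  qed
  have AE_ties: "AE \<omega> in M. \<forall>r::rat. 0 < real_of_rat r \<longrightarrow> real_of_rat r < 1 \<longrightarrow>
      (\<forall>\<sigma> x. B \<omega> (dir_of (real_of_rat r)) \<sigma> x (x + e1) \<noteq> B \<omega> (dir_of (real_of_rat r)) \<sigma> x (x + e2))"
    by (rule AE_rational) (rule B5_no_ties[OF ri])
  have AE_coal: "AE \<omega> in M. \<forall>r::rat. 0 < real_of_rat r \<longrightarrow> real_of_rat r < 1 \<longrightarrow>
      (\<forall>x y. \<exists>k. level x \<le> k \<and> level y \<le> k \<and>
        flow (busemann_step (B \<omega> (dir_of (real_of_rat r)) Plus) Plus) x k =
        flow (busemann_step (B \<omega> (dir_of (real_of_rat r)) Plus) Plus) y k)"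
    by (rule AE_rational) (rule AE_busemann_coalescence[OF ri])
  have AE_shape: "AE \<omega> in M. \<forall>r::rat. 0 < real_of_rat r \<longrightarrow> real_of_rat r < 1 \<longrightarrow>
      (\<forall>\<sigma>. (\<lambda>n. (MAX x\<in>quadrant_sphere n. \<bar>B \<omega> (dir_of (real_of_rat r)) \<sigma> 0 x -
        to_dir x \<bullet> grad g (dir_of (real_of_rat r)) \<sigma>\<bar>) / real n) \<longlonglongrightarrow> 0)"
    by (rule AE_rational) (rule B5_shape[OF ri])
  from AE_B AE_ties AE_coal AE_shape B3 shape_theorem AE_generic show ?thesis
  proof eventually_elim
    case (elim \<omega>)
    note B = B[OF elim(1)]
    show ?case
    proof unfold_locales
      fix t \<sigma> x y z assume t: "0 < t" "t < (1::real)"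
      show "B \<omega> (dir_of t) \<sigma> x y + B \<omega> (dir_of t) \<sigma> y z = B \<omega> (dir_of t) \<sigma> x z"
        by (rule B1_atD(2)[OF B ri[OF t]])
      show "min (B \<omega> (dir_of t) \<sigma> z (z + e1)) (B \<omega> (dir_of t) \<sigma> z (z + e2)) = W \<omega> z"
        by (rule B1_atD(3)[OF B ri[OF t]])
      from filterlim_compose[OF B1_atD(4)[OF B ri[OF t]] dir_of_filterlims(1)[OF t]]
      show "((\<lambda>s. B \<omega> (dir_of s) \<sigma> x y) \<longlongrightarrow> B \<omega> (dir_of t) Minus x y) (at_left t)" .
      from filterlim_compose[OF B1_atD(5)[OF B ri[OF t]] dir_of_filterlims(2)[OF t]]
      show "((\<lambda>s. B \<omega> (dir_of s) \<sigma> x y) \<longlongrightarrow> B \<omega> (dir_of t) Plus x y) (at_right t)" .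
    next
      fix s \<sigma> t \<tau> z assume st: "0 < s" "t < 1" "before s \<sigma> t \<tau>"
      have mono: "B \<omega> (dir_of p) Plus z (z + e1) \<le> B \<omega> (dir_of p) Minus z (z + e1) \<and>
          B \<omega> (dir_of q) Minus z (z + e1) \<le> B \<omega> (dir_of p) Plus z (z + e1) \<and>
          B \<omega> (dir_of q) Plus z (z + e1) \<le> B \<omega> (dir_of q) Minus z (z + e1) \<and>
          B \<omega> (dir_of p) Minus z (z + e2) \<le> B \<omega> (dir_of p) Plus z (z + e2) \<and>
          B \<omega> (dir_of p) Plus z (z + e2) \<le> B \<omega> (dir_of q) Minus z (z + e2) \<and>
          B \<omega> (dir_of q) Minus z (z + e2) \<le> B \<omega> (dir_of q) Plus z (z + e2)" if "0 < p" "p < q" "q < 1" for p q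
      proof -
        have "dir_of p \<in> riU" "dir_of q \<in> riU" "dir_less (dir_of p) (dir_of q)" using that ri by auto
        then show ?thesis using B1_atD_mono[OF B, of "dir_of p" "dir_of q" z] by blast
      qed
      have "s \<le> t" "s < 1" using st by (auto simp: before_def)
      have "B \<omega> (dir_of t) \<tau> z (z + e1) \<le> B \<omega> (dir_of s) \<sigma> z (z + e1) \<and>
        B \<omega> (dir_of s) \<sigma> z (z + e2) \<le> B \<omega> (dir_of t) \<tau> z (z + e2)"
      proof (cases "s = t")
        case True
        \<comment> \<open>\<open>mono\<close> compares two different directions; the auxiliary
          direction \<open>(s + 1) / 2\<close> serves only to extract the comparison of the two
          signs at \<open>s\<close>.\<close>
        then show ?thesis
          using st mono[of s "(s + 1) / 2"] \<open>s < 1\<close> by (cases \<sigma>; cases \<tau>) (auto simp: before_def)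
      next
        case False
        then have "s < t" using \<open>s \<le> t\<close> by simp
        then show ?thesis using mono[of s t] st by (cases \<sigma>; cases \<tau>) auto
      qed
      then show "B \<omega> (dir_of t) \<tau> z (z + e1) \<le> B \<omega> (dir_of s) \<sigma> z (z + e1)"
        "B \<omega> (dir_of s) \<sigma> z (z + e2) \<le> B \<omega> (dir_of t) \<tau> z (z + e2)" by auto
    next
      fix q :: real assume q: "q \<in> \<rat>" "0 < q" "q < 1"
      then obtain r where r: "q = real_of_rat r" by (auto elim: Rats_cases)
      show "B \<omega> (dir_of q) Plus z (z + e1) \<noteq> B \<omega> (dir_of q) Plus z (z + e2)" for z
        using elim(2) q unfolding r by blast
      show "\<exists>k\<ge>level x. level y \<le> k \<and> flow (busemann_step (B \<omega> (dir_of q) Plus) Plus) x k =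
          flow (busemann_step (B \<omega> (dir_of q) Plus) Plus) y k" for x y
        using elim(3) q unfolding r by blast
      show "(\<lambda>n. (MAX x\<in>quadrant_sphere n. \<bar>B \<omega> (dir_of q) Plus 0 x - to_dir x \<bullet> grad g (dir_of q) Plus\<bar>) / real n)
          \<longlonglongrightarrow> 0"
        using elim(4) q unfolding r by blast
    next
      show "A = C" if "(\<Sum>v\<in>#A. W \<omega> v) = (\<Sum>v\<in>#C. W \<omega> v)" for A C using elim(7) that by blast
      show "B \<omega> (dir_of s) \<sigma> x y = B \<omega> (dir_of t) \<sigma> x y"
        if "0 < s" "s < 1" "0 < t" "t < 1" "grad g (dir_of s) \<sigma> = grad g (dir_of t) \<sigma>" for s t \<sigma> x y
        using elim(5) ri that by blast
      have "filterlim (\<lambda>\<xi>. B \<omega> \<xi> Minus 0 (0 + e1)) at_top (at e2 within riU)"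
        "filterlim (\<lambda>\<xi>. B \<omega> \<xi> Plus 0 (0 + e2)) at_top (at e1 within riU)"
        using B[unfolded B1_at_def, THEN conjunct2, THEN conjunct2, THEN conjunct2, THEN conjunct2, THEN conjunct2]
        by blast+
      then show "filterlim (\<lambda>t. B \<omega> (dir_of t) Minus 0 (0 + e1)) at_top (at_right 0)"
        "filterlim (\<lambda>t. B \<omega> (dir_of t) Plus 0 (0 + e2)) at_top (at_left 1)"
        using dir_of_filterlims(3,4)[of "1/2"] filterlim_compose by fastforce+
      show "(\<lambda>n. (MAX x\<in>quadrant_sphere n. \<bar>lpp (W \<omega>) 0 x - g (to_dir x)\<bar>) / real n) \<longlonglongrightarrow> 0"
        by (rule elim(6))
    qed
  qed
qed

end

theorem theorem3p1:
  fixes M :: "'w::polish_space measure"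
    and T :: "site \<Rightarrow> 'w \<Rightarrow> 'w"
    and W :: "'w \<Rightarrow> site \<Rightarrow> real"
    and g :: "dir \<Rightarrow> real"
    and B :: "'w \<Rightarrow> dir \<Rightarrow> sign \<Rightarrow> site \<Rightarrow> site \<Rightarrow> real"
  assumes "busemann_setting M T W g B"
  shows "AE \<omega> in M. \<forall>x y. \<forall>\<xi>\<in>riU. x \<noteq> y \<longrightarrow>
    (\<xi> \<in> busemann_support (B \<omega>) x y \<longleftrightarrow>
      busemann_points (B \<omega>) x \<xi> Minus \<inter> busemann_points (B \<omega>) y \<xi> Plus = {} \<or>
      busemann_points (B \<omega>) x \<xi> Plus \<inter> busemann_points (B \<omega>) y \<xi> Minus = {}) \<and>
    ((\<forall>\<zeta>\<in>riU. \<zeta> \<notin> diff_dirs g \<longrightarrow> strictly_concave_at g \<zeta>) \<longrightarrow>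
      (\<xi> \<in> busemann_support (B \<omega>) x y \<longleftrightarrow>
        (\<exists>\<pi>\<^sub>x \<pi>\<^sub>y.
          geodesic_from (W \<omega>) x \<pi>\<^sub>x \<and> directed_into \<pi>\<^sub>x (U_at g \<xi>) \<and>
          geodesic_from (W \<omega>) y \<pi>\<^sub>y \<and> directed_into \<pi>\<^sub>y (U_at g \<xi>) \<and>
          points_from x \<pi>\<^sub>x \<inter> points_from y \<pi>\<^sub>y = {})))"
proof -
  interpret busemann_setting M T W g B by (rule assms)
  show ?thesis
    using AE_directed_realization
  proof eventually_elim
    case (elim \<omega>)
    interpret directed_realization "W \<omega>" "B \<omega>" g by (rule elim)
    show ?case
    proof (intro allI ballI impI conjI)
      fix x y \<xi> assume "\<xi> \<in> riU"
      then obtain t where t: "0 < t" "t < 1" "\<xi> = dir_of t" by (auto simp: riU_iff)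
      show "\<xi> \<in> busemann_support (B \<omega>) x y \<longleftrightarrow>
          busemann_points (B \<omega>) x \<xi> Minus \<inter> busemann_points (B \<omega>) y \<xi> Plus = {} \<or>
          busemann_points (B \<omega>) x \<xi> Plus \<inter> busemann_points (B \<omega>) y \<xi> Minus = {}"
        unfolding t(3) by (rule support_iff_disjoint_Busemann[OF t(1,2)])
      show "\<xi> \<in> busemann_support (B \<omega>) x y \<longleftrightarrow> (\<exists>\<pi>\<^sub>x \<pi>\<^sub>y.
          geodesic_from (W \<omega>) x \<pi>\<^sub>x \<and> directed_into \<pi>\<^sub>x (U_at g \<xi>) \<and>
          geodesic_from (W \<omega>) y \<pi>\<^sub>y \<and> directed_into \<pi>\<^sub>y (U_at g \<xi>) \<and>
          points_from x \<pi>\<^sub>x \<inter> points_from y \<pi>\<^sub>y = {})"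
        if "\<forall>\<zeta>\<in>riU. \<zeta> \<notin> diff_dirs g \<longrightarrow> strictly_concave_at g \<zeta>"
        unfolding t(3) by (rule support_iff_disjoint_geodesics[OF that t(1,2)])
    qed
  qed
qed

end
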